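(* Let $1\le p<\infty$ and $\omega\in A^{\rho,\infty}_p(\mathbb R^d)$, and let $f\in L^1_{\mathrm{loc}}(\mathbb R^d)$ be real-valued. Then the following statements are true. (1) $f\in\mathrm{BMO}_{\rho,\infty}(\mathbb R^d)$ if and only if there exist a constant $C>0$ and some $\mathcal N>0$ such that for every cube $\mathcal Q=Q(x_0,r)\subset\mathbb R^d$, $$\bigg(\frac{1}{\omega(\mathcal Q)}\int_{\mathcal Q}|f(x)-f_{\mathcal Q}|^p\,\omega(x)\,dx\bigg)^{1/p}\le C\bigg(1+\frac{r}{\rho(x_0)}\bigg)^{\mathcal N}.$$ (2) Let $0<\beta<1$. Then $f\in\mathrm{Lip}_\beta^{\rho,\infty}(\mathbb R^d)$ if and only if there exist a constant $C>0$ and some $\mathcal N'>0$ such that for every ball $\mathcal B=B(x_0,r)\subset\mathbb R^d$, $$\frac{1}{|\mathcal B|^{\beta/d}}\bigg(\frac{1}{\omega(\mathcal B)}\int_{\mathcal B}|f(x)-f_{\mathcal B}|^p\,\omega(x)\,dx\bigg)^{1/p}\le C\bigg(1+\frac{r}{\rho(x_0)}\bigg)^{\mathcal N'}.$$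
   Context: Setting: $d\ge 3$, and $V:\mathbb R^d\to[0,\infty)$ is locally integrable, not identically zero, and belongs to the reverse Hölder class $RH_s(\mathbb R^d)$ for some $s\ge d/2$, i.e. there is a constant $C>0$ with $\big(\frac1{|B|}\int_B V^s\big)^{1/s}\le C\,\frac1{|B|}\int_B V$ for every ball $B$ (usual modification if $s=\infty$). $B(x,r)$ is the open ball with center $x$ and radius $r$; $Q(x_0,r)$ is the cube centered at $x_0$ with sidelength $r$ and sides parallel to the axes. The critical radius function is $$\rho(x):=\sup\Big\{r>0:\ \frac{1}{r^{d-2}}\int_{B(x,r)}V(y)\,dy\le 1\Big\},\qquad x\in\mathbb R^d,$$ which satisfies $0<\rho(x)<\infty$. Weights: a weight is a nonnegative locally integrable function $\omega$ on $\mathbb R^d$, not a.e. zero; $\omega(E):=\int_E\omega(x)\,dx$. Let $p'$ denote the conjugate exponent, $1/p+1/p'=1$. For $0<\theta<\infty$ and $1<p<\infty$, $\omega\in A_p^{\rho,\theta}(\mathbb R^d)$ means that there is $C>0$ such that for all balls $B=B(x_0,r)$ $$\Big(\frac1{|B|}\int_B\omega\Big)^{1/p}\Big(\frac1{|B|}\int_B\omega^{-p'/p}\Big)^{1/p'}\le C\Big(1+\frac r{\rho(x_0)}\Big)^{\theta},$$ and $\omega\in A_1^{\rho,\theta}(\mathbb R^d)$ means that there is $C>0$ with $\frac1{|B|}\int_B\omega\le C\big(1+\frac r{\rho(x_0)}\big)^{\theta}\operatorname{ess\,inf}_{B}\omega$ for all balls $B=B(x_0,r)$. $A_p^{\rho,\infty}(\mathbb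 R^d):=\bigcup_{\theta>0}A_p^{\rho,\theta}(\mathbb R^d)$. Function spaces: $f_E:=\frac1{|E|}\int_E f$. For $0<\theta<\infty$, $\mathrm{BMO}_{\rho,\theta}(\mathbb R^d)$ is the set of real-valued $f\in L^1_{\mathrm{loc}}(\mathbb R^d)$ with $\sup_{Q=Q(x_0,r)}\big(1+\frac r{\rho(x_0)}\big)^{-\theta}\frac1{|Q|}\int_Q|f-f_Q|\,dx<\infty$ (supremum over all cubes), and for $0<\beta<1$, $\mathrm{Lip}_\beta^{\rho,\theta}(\mathbb R^d)$ is the set of real-valued $f\in L^1_{\mathrm{loc}}(\mathbb R^d)$ with $\sup_{B=B(x_0,r)}\big(1+\frac r{\rho(x_0)}\big)^{-\theta}\frac1{|B|^{1+\beta/d}}\int_B|f-f_B|\,dx<\infty$ (supremum over all balls). $\mathrm{BMO}_{\rho,\infty}(\mathbb R^d):=\bigcup_{\theta>0}\mathrm{BMO}_{\rho,\theta}(\mathbb R^d)$ and $\mathrm{Lip}_\beta^{\rho,\infty}(\mathbb R^d):=\bigcup_{\theta>0}\mathrm{Lip}_\beta^{\rho,\theta}(\mathbb R^d)$. *)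

theory Defs
  imports "HOL-Analysis.Analysis" "HOL-Probability.Essential_Supremum"
begin

text \<open>Euclidean space of dimension $d$ is \<^typ>\<open>real ^ 'n\<close> with $d$ = \<^term>\<open>CARD('n)\<close>, carrying
  Lebesgue measure.  Integrals whose finiteness is part of a condition are
  \<^typ>\<open>ennreal\<close>-valued, since the Bochner integral of a non-integrable function is 0.\<close>

definition locally_integrable :: "(real ^ 'n \<Rightarrow> real) \<Rightarrow> bool" where
  "locally_integrable f \<longleftrightarrow> (\<forall>K. compact K \<longrightarrow> set_integrable lebesgue K f)"

definition cube :: "real ^ 'n \<Rightarrow> real \<Rightarrow> (real ^ 'n) set" where
  "cube x0 r = {y. \<forall>i. \<bar>y $ i - x0 $ i\<bar> < r / 2}"

definition mean :: "(real ^ 'n \<Rightarrow> real) \<Rightarrow> (real ^ 'n) set \<Rightarrow> real" where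
  "mean f E = (LINT x:E|lebesgue. f x) / measure lebesgue E"

definition emean :: "(real ^ 'n \<Rightarrow> ennreal) \<Rightarrow> (real ^ 'n) set \<Rightarrow> ennreal" where
  "emean g E = (\<integral>\<^sup>+x\<in>E. g x \<partial>lebesgue) / emeasure lebesgue E"

text \<open>Real powers on $[0,\infty]$, with $0^a = \infty$ and $\infty^a = 0$ for $a < 0$
  (in contrast to \<^term>\<open>0 powr a = (0::real)\<close>).\<close>

definition epowr :: "ennreal \<Rightarrow> real \<Rightarrow> ennreal" where
  "epowr t a =
     (if a = 0 then 1
      else if t = 0 then (if a < 0 then \<infinity> else 0)
      else if t = \<infinity> then (if a < 0 then 0 else \<infinity>)
      else ennreal (enn2real t powr a))"

definition essinf :: "'a measure \<Rightarrow> ('a \<Rightarrow> ennreal) \<Rightarrow> ennreal" where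
  "essinf M g = Sup {c. AE x in M. c \<le> g x}"

definition conjugate_exponent :: "real \<Rightarrow> real" where
  "conjugate_exponent p = p / (p - 1)"

definition reverse_holder :: "ennreal \<Rightarrow> (real ^ 'n \<Rightarrow> real) \<Rightarrow> bool" where
  "reverse_holder s V \<longleftrightarrow>
     (\<exists>C>0. \<forall>x0. \<forall>r>0.
        (if s = \<infinity> then esssup (lebesgue_on (ball x0 r)) (\<lambda>x. ennreal (V x))
         else epowr (emean (\<lambda>x. epowr (ennreal (V x)) (enn2real s)) (ball x0 r)) (1 / enn2real s))
        \<le> ennreal C * emean (\<lambda>x. ennreal (V x)) (ball x0 r))"

text \<open>The supremum is taken in \<^typ>\<open>real\<close>; it is the intended one when the set is nonempty
  and bounded, i.e. when $0 < \rho(x) < \infty$.\<close>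

definition critical_radius :: "(real ^ 'n \<Rightarrow> real) \<Rightarrow> real ^ 'n \<Rightarrow> real" where
  "critical_radius V x =
     Sup {r. r > 0 \<and> 1 / r ^ (CARD('n) - 2) * (LINT y:ball x r|lebesgue. V y) \<le> 1}"

definition is_weight :: "(real ^ 'n \<Rightarrow> real) \<Rightarrow> bool" where
  "is_weight w \<longleftrightarrow>
     (\<forall>x. 0 \<le> w x) \<and> locally_integrable w \<and> \<not> (AE x in lebesgue. w x = 0)"

definition weight_of :: "(real ^ 'n \<Rightarrow> real) \<Rightarrow> (real ^ 'n) set \<Rightarrow> ennreal" where
  "weight_of w E = (\<integral>\<^sup>+x\<in>E. ennreal (w x) \<partial>lebesgue)"

text \<open>The class $A_p^{\rho,\theta}$ for $1 \le p < \infty$.  A weight that vanishes on a set of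
  positive measure has $\int_B \omega^{-p'/p} = \infty$ on large balls $B$, so it does not
  belong to the class.\<close>

definition muckenhoupt ::
  "(real ^ 'n \<Rightarrow> real) \<Rightarrow> real \<Rightarrow> real \<Rightarrow> (real ^ 'n \<Rightarrow> real) set" where
  "muckenhoupt \<rho> \<theta> p = {w. is_weight w \<and>
     (\<exists>C>0. \<forall>x0. \<forall>r>0.
        if p = 1 then
          emean (\<lambda>x. ennreal (w x)) (ball x0 r)
            \<le> ennreal (C * (1 + r / \<rho> x0) powr \<theta>)
              * essinf (lebesgue_on (ball x0 r)) (\<lambda>x. ennreal (w x))
        else
          epowr (emean (\<lambda>x. ennreal (w x)) (ball x0 r)) (1 / p)
            * epowr (emean (\<lambda>x. epowr (ennreal (w x)) (- conjugate_exponent p / p)) (ball x0 r))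
                (1 / conjugate_exponent p)
            \<le> ennreal (C * (1 + r / \<rho> x0) powr \<theta>))}"

definition muckenhoupt_inf ::
  "(real ^ 'n \<Rightarrow> real) \<Rightarrow> real \<Rightarrow> (real ^ 'n \<Rightarrow> real) set" where
  "muckenhoupt_inf \<rho> p = (\<Union>\<theta>\<in>{0<..}. muckenhoupt \<rho> \<theta> p)"

definition BMO :: "(real ^ 'n \<Rightarrow> real) \<Rightarrow> real \<Rightarrow> (real ^ 'n \<Rightarrow> real) set" where
  "BMO \<rho> \<theta> = {f. locally_integrable f \<and>
     (SUP x0. SUP r\<in>{0<..}.
        ennreal ((1 + r / \<rho> x0) powr (- \<theta>))
        * emean (\<lambda>x. ennreal \<bar>f x - mean f (cube x0 r)\<bar>) (cube x0 r)) < \<infinity>}"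

definition BMO_inf :: "(real ^ 'n \<Rightarrow> real) \<Rightarrow> (real ^ 'n \<Rightarrow> real) set" where
  "BMO_inf \<rho> = (\<Union>\<theta>\<in>{0<..}. BMO \<rho> \<theta>)"

definition Lip :: "(real ^ 'n \<Rightarrow> real) \<Rightarrow> real \<Rightarrow> real \<Rightarrow> (real ^ 'n \<Rightarrow> real) set" where
  "Lip \<rho> \<theta> \<beta> = {f. locally_integrable f \<and>
     (SUP x0. SUP r\<in>{0<..}.
        ennreal ((1 + r / \<rho> x0) powr (- \<theta>))
        * ((\<integral>\<^sup>+x\<in>ball x0 r. ennreal \<bar>f x - mean f (ball x0 r)\<bar> \<partial>lebesgue)
           / epowr (emeasure lebesgue (ball x0 r)) (1 + \<beta> / real CARD('n)))) < \<infinity>}"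

definition Lip_inf :: "(real ^ 'n \<Rightarrow> real) \<Rightarrow> real \<Rightarrow> (real ^ 'n \<Rightarrow> real) set" where
  "Lip_inf \<rho> \<beta> = (\<Union>\<theta>\<in>{0<..}. Lip \<rho> \<theta> \<beta>)"

definition weighted_osc ::
  "real \<Rightarrow> (real ^ 'n \<Rightarrow> real) \<Rightarrow> (real ^ 'n \<Rightarrow> real) \<Rightarrow> (real ^ 'n) set \<Rightarrow> ennreal" where
  "weighted_osc p w f E =
     epowr ((\<integral>\<^sup>+x\<in>E. ennreal (\<bar>f x - mean f E\<bar> powr p * w x) \<partial>lebesgue) / weight_of w E) (1 / p)"

end

theory Submission
  imports Defs
begin

text \<open>Let \<open>d\<close> be the dimension and \<open>\<Psi> = 1 + r / \<rho> x0\<close> for a cube or ball of size \<open>r\<close> about \<open>x0\<close>.  All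
constants may be powers of \<open>\<Psi>\<close>, and the proof rests on four facts.

The critical radius varies slowly: \<open>1 + h / \<rho> y \<le> C * \<Psi> powr N\<close> as soon as \<open>h \<le> r\<close> and
\<open>dist x0 y \<le> r\<close> (\<open>slowly_varying_critical_radius\<close>).  Hence the constants which the hypotheses on
\<open>f\<close> and on the weight attach to the parts of a cube are powers of the \<open>\<Psi>\<close> of that cube.  Slow variation is
a consequence of the reverse Hoelder inequality with exponent \<open>d / 2\<close>, through doubling of the integrals
of \<open>V\<close> and reverse doubling of the integrals of \<open>V powr (d / 2)\<close> over concentric balls.

The \<open>A\<^sub>p\<close> condition bounds the mean of any \<open>g \<ge> 0\<close> on a ball \<open>B\<close> by
\<open>C * \<Psi> powr \<theta>\<close> times the \<open>p\<close>-th root of the \<open>w\<close>-average of \<open>g powr p\<close>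
(\<open>muckenhoupt_average_bound\<close>).  With \<open>g = \<bar>f - mean f B\<bar>\<close> this is the passage from weighted to
unweighted oscillation, for BMO and for Lip alike.  With \<open>g\<close> an indicator it says that a set which fills
at most half of a cube misses a fraction \<open>\<kappa>\<close> of the weight, where \<open>1 / \<kappa>\<close> is at most a power of
\<open>\<Psi>\<close> (\<open>muckenhoupt_small_sets\<close>).

The weighted oscillation of a BMO function is controlled by a John-Nirenberg argument carried out for
the weight itself.  If \<open>f\<close> has mean oscillation at most \<open>A\<close> on all dyadic subcubes of \<open>Q\<close>, stop at the
maximal subcubes whose average deviates from that of \<open>Q\<close> by more than \<open>2 * A\<close>.  They fill at most half
of \<open>Q\<close>, so they carry at most the fraction \<open>1 - \<kappa>\<close> of the weight, and their averages deviate by at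
most a multiple of \<open>A\<close>.  With \<open>\<eta>\<close> a small multiple of \<open>\<kappa> / A\<close> the \<open>w\<close>-average \<open>X\<close> of
\<open>exp (\<eta> * \<bar>f - mean f Q\<bar>)\<close> therefore satisfies
\<open>X \<le> exp 1 + (1 - \<kappa>) * exp (\<kappa> / 2) * X\<close>, which gives \<open>X \<le> 2 * exp 1 / \<kappa>\<close>
(\<open>expint_bound\<close>, \<open>exp_integrability\<close>).  The resulting bound for the \<open>p\<close>-th moments is polynomial in
\<open>A\<close> and \<open>1 / \<kappa>\<close>, hence again a power of \<open>\<Psi>\<close>.  The recursion is run on the dyadic averages of a
finite generation, where it is an induction, and reaches \<open>f\<close> by Fatou's lemma.

For Lip the averages over successive dyadic cubes differ by terms of a geometric series, so that
\<open>\<bar>f - mean f B\<bar> \<le> C * \<Psi> powr N * r powr \<beta>\<close> almost everywhere on \<open>B\<close> (\<open>Lip_AE_bound\<close>), and this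
bound survives averaging against any weight.\<close>

section \<open>Integrals over bounded sets and powers of extended reals\<close>

lemma locally_integrable_on_bounded:
  fixes f :: "real ^ 'n \<Rightarrow> real"
  assumes "locally_integrable f" "bounded E" "E \<in> sets lebesgue"
  shows "set_integrable lebesgue E f"
proof -
  have "compact (closure E)" using assms(2) by (simp add: compact_closure)
  then have "set_integrable lebesgue (closure E) f"
    using assms(1) unfolding locally_integrable_def by blast
  then show ?thesis
    by (rule set_integrable_subset) (use assms closure_subset in auto)
qed

lemma locally_integrable_measurable:
  fixes f :: "real ^ 'n \<Rightarrow> real"
  assumes "locally_integrable f"
  shows "f \<in> borel_measurable lebesgue"
proof (rule borel_measurable_LIMSEQ_real)
  fix x :: "real ^ 'n"
  show "(\<lambda>k. indicator (ball 0 (real k)) x * f x) \<longlonglongrightarrow> f x"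
  proof (rule tendsto_eventually)
    obtain N where N: "norm x < real N" using reals_Archimedean2 by blast
    show "\<forall>\<^sub>F k in sequentially. indicator (ball 0 (real k)) x * f x = f x"
      using eventually_ge_at_top[of N] by eventually_elim (use N in \<open>auto simp: indicator_def\<close>)
  qed
next
  fix k
  have "set_integrable lebesgue (ball 0 (real k)) f"
    by (rule locally_integrable_on_bounded[OF assms]) auto
  then show "(\<lambda>x. indicator (ball 0 (real k)) x * f x) \<in> borel_measurable lebesgue"
    unfolding set_integrable_def using borel_measurable_integrable by fastforce
qed

lemma set_LINT_nonneg:
  "(\<And>x. 0 \<le> h x) \<Longrightarrow> 0 \<le> (LINT x:E|M. h x :: real)"
  unfolding set_lebesgue_integral_def by (intro Bochner_Integration.integral_nonneg) auto

lemma measure_ball_scaling: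
  fixes x :: "real ^ 'n"
  assumes "r \<ge> 0"
  shows "measure lebesgue (ball x r) = measure lebesgue (ball (0::real^'n) 1) * r ^ CARD('n)"
  using content_ball[of r x] content_ball[of 1 "0::real^'n"] assms by (simp add: measure_def)

lemma measure_unit_ball_pos: "measure lebesgue (ball (0::real^'n) 1) > 0"
  using content_ball_pos[of 1 "0::real^'n"] by (simp add: measure_def)

text \<open>Hoelder's inequality against the constant 1, with an extra factor 2.  Cutting at height \<open>s\<close> gives
\<open>V \<le> s + s powr (1 - q) * V powr q\<close>; the integrals of the two terms are equal for the right \<open>s\<close>.\<close>

lemma set_integral_powr_bound:
  assumes q: "q > 1" and V: "\<And>x. 0 \<le> V x"
    and i1: "set_integrable M E V" and i2: "set_integrable M E (\<lambda>x. V x powr q)"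
    and E: "E \<in> fmeasurable M"
  shows "(LINT x:E|M. V x) \<le> 2 * measure M E powr (1 - 1/q) * (LINT x:E|M. V x powr q) powr (1/q)"
proof -
  define m where "m = measure M E"
  define U where "U = (LINT x:E|M. V x powr q)"
  have Em: "E \<in> sets M" using E by auto
  have ic: "set_integrable M E (\<lambda>x. c::real)" for c
    using E by (auto simp: set_integrable_def fmeasurable_def less_top[symmetric])
  have key: "(LINT x:E|M. V x) \<le> s * m + s powr (1 - q) * U" if s: "s > 0" for s
  proof -
    have "(LINT x:E|M. V x) \<le> (LINT x:E|M. s + s powr (1-q) * V x powr q)"
    proof (rule set_integral_mono[OF i1])
      show "set_integrable M E (\<lambda>x. s + s powr (1-q) * V x powr q)"
        by (intro set_integral_add ic) (use i2 in auto)
      fix x assume "x \<in> E"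
      show "V x \<le> s + s powr (1-q) * V x powr q"
      proof (cases "V x \<le> s")
        case True then show ?thesis using s by (simp add: add_increasing2)
      next
        case False
        then have "V x = V x powr (1 - q) * V x powr q" using s by (simp add: powr_add[symmetric])
        also have "\<dots> \<le> s powr (1-q) * V x powr q"
          using False s q by (intro mult_right_mono powr_mono2') auto
        finally show ?thesis using s by simp
      qed
    qed
    also have "\<dots> = s * m + s powr (1 - q) * U"
      using E i2 ic[of s] unfolding U_def m_def
      by (subst set_integral_add) (auto simp: set_lebesgue_integral_def fmeasurable_def less_top[symmetric])
    finally show ?thesis .
  qed
  have m0: "m \<ge> 0" unfolding m_def by simp
  have U0: "U \<ge> 0" unfolding U_def by (intro set_LINT_nonneg) simp
  consider "m = 0" | "m > 0" "U = 0" | "m > 0" "U > 0" using m0 U0 by linarith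
  then have "(LINT x:E|M. V x) \<le> 2 * m powr (1 - 1/q) * U powr (1/q)"
  proof cases
    case 1
    then have "emeasure M E = 0" using E unfolding m_def
      by (metis emeasure_eq_measure2 ennreal_0)
    then have "E \<in> null_sets M" using Em by (rule null_setsI)
    then have "AE x in M. indicator E x *\<^sub>R V x = 0"
      by (auto dest!: AE_not_in elim!: eventually_mono simp: indicator_def)
    then have "(LINT x:E|M. V x) = 0"
      unfolding set_lebesgue_integral_def by (rule integral_eq_zero_AE)
    then show ?thesis by simp
  next
    case 2
    have "(LINT x:E|M. V x) \<le> 0"
    proof (rule field_le_epsilon)
      fix e :: real assume "e > 0"
      then show "(LINT x:E|M. V x) \<le> 0 + e" using key[of "e/m"] 2 by simp
    qed
    then show ?thesis using 2 by simp
  next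
    case 3
    \<comment> \<open>This height makes the two terms of \<open>key\<close> equal.\<close>
    define s where "s = (U/m) powr (1/q)"
    have s: "s > 0" unfolding s_def using 3 by simp
    have "s * m = m powr (1 - 1/q) * U powr (1/q)"
    proof -
      have "m powr (1 - 1/q) = m / m powr (1/q)" using 3 by (simp add: powr_diff)
      then show ?thesis using 3 by (simp add: s_def powr_divide)
    qed
    moreover have "s powr (1-q) * U = m powr (1 - 1/q) * U powr (1/q)"
    proof -
      have "s powr (1-q) = s * s powr (-q)" using s powr_add[of s 1 "-q"] by simp
      also have "s powr (-q) = (U/m) powr (-1)" using q by (simp add: s_def powr_powr)
      also have "\<dots> = m / U" using 3 by (simp add: powr_minus_divide)
      finally have "s powr (1-q) * U = s * m" using 3 by simp
      then show ?thesis using \<open>s * m = _\<close> by simp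
    qed
    ultimately show ?thesis using key[OF s] by (simp add: mult_ac)
  qed
  then show ?thesis unfolding m_def U_def .
qed

lemma epowr_ennreal:
  assumes "a \<ge> 0" "e > 0" shows "epowr (ennreal a) e = ennreal (a powr e)"
  using assms by (auto simp: epowr_def)

lemma epowr_ennreal_pos:
  assumes "a > 0" shows "epowr (ennreal a) e = ennreal (a powr e)"
  using assms by (auto simp: epowr_def)

lemma epowr_top: "e > 0 \<Longrightarrow> epowr \<infinity> e = \<infinity>"
  by (simp add: epowr_def)

lemma epowr_mono:
  assumes "e > 0" "a \<le> b" shows "epowr a e \<le> epowr b e"
proof (cases b)
  case top then show ?thesis using assms epowr_top by simp
next
  case (real y)
  then obtain x where "a = ennreal x" "x \<ge> 0"
    using assms(2) by (cases a) (auto simp: top_unique)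
  then show ?thesis using real assms by (auto simp: epowr_ennreal powr_mono2 intro!: ennreal_leI)
qed

lemma le_powr_if_epowr_inverse_le:
  assumes "e > 0" "T \<ge> 0" "epowr a (1/e) \<le> ennreal T"
  shows "a \<le> ennreal (T powr e)"
proof (cases a)
  case top then show ?thesis using assms epowr_top[of "1/e"] by (simp add: top_unique)
next
  case (real x)
  then have "ennreal (x powr (1/e)) \<le> ennreal T" using assms by (simp add: epowr_ennreal)
  then have "x powr (1/e) \<le> T" using assms by (simp add: ennreal_le_iff)
  then have "(x powr (1/e)) powr e \<le> T powr e" using assms by (intro powr_mono2) auto
  then have "x \<le> T powr e" using assms real by (simp add: powr_powr)
  then show ?thesis using real by (simp add: ennreal_leI)
qed

lemma nn_set_integral_eq_LINT:
  assumes "set_integrable M E g" "\<And>x. 0 \<le> g x"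
  shows "(\<integral>\<^sup>+x\<in>E. ennreal (g x) \<partial>M) = ennreal (LINT x:E|M. g x)"
proof -
  have "(\<integral>\<^sup>+x\<in>E. ennreal (g x) \<partial>M) = (\<integral>\<^sup>+x. ennreal (indicator E x *\<^sub>R g x) \<partial>M)"
    by (intro nn_integral_cong) (auto simp: indicator_def)
  also have "\<dots> = ennreal (LINT x:E|M. g x)"
    unfolding set_lebesgue_integral_def
    by (intro nn_integral_eq_integral) (use assms in \<open>auto simp: set_integrable_def indicator_def\<close>)
  finally show ?thesis .
qed

lemma set_integrable_if_nn_le:
  fixes g :: "'a \<Rightarrow> real"
  assumes "g \<in> borel_measurable M" "\<And>x. 0 \<le> g x" "E \<in> sets M" "T \<ge> 0"
    and le: "(\<integral>\<^sup>+x\<in>E. ennreal (g x) \<partial>M) \<le> ennreal T"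
  shows "set_integrable M E g" "(LINT x:E|M. g x) \<le> T"
proof -
  have eq: "(\<integral>\<^sup>+x\<in>E. ennreal (g x) \<partial>M) = (\<integral>\<^sup>+x. ennreal (norm (indicator E x *\<^sub>R g x)) \<partial>M)"
    using assms(2) by (intro nn_integral_cong) (auto simp: indicator_def)
  have "(\<integral>\<^sup>+x. ennreal (norm (indicator E x *\<^sub>R g x)) \<partial>M) < \<infinity>"
    using le unfolding eq by (auto simp: top.not_eq_extremum intro: le_less_trans)
  then show i: "set_integrable M E g"
    using assms unfolding set_integrable_def by (intro integrableI_bounded) auto
  show "(LINT x:E|M. g x) \<le> T"
    using le assms nn_set_integral_eq_LINT[OF i assms(2)] by (simp add: ennreal_le_iff)
qed

lemma emeasure_ball_eq:
  fixes x :: "real ^ 'n" shows "emeasure lebesgue (ball x r) = ennreal (measure lebesgue (ball x r))"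
proof -
  have "ball x r \<in> lmeasurable" by simp
  then show ?thesis by (simp add: emeasure_eq_measure2)
qed

lemma measure_ball_pos:
  fixes x :: "real ^ 'n" assumes "r > 0" shows "measure lebesgue (ball x r) > 0"
  using assms measure_unit_ball_pos[where 'n='n] by (simp add: measure_ball_scaling)

lemma emean_ball_eq:
  fixes V :: "real ^ 'n \<Rightarrow> real"
  assumes "set_integrable lebesgue (ball x r) V" "\<And>x. 0 \<le> V x" "r > 0"
  shows "emean (\<lambda>x. ennreal (V x)) (ball x r) = ennreal ((LINT y:ball x r|lebesgue. V y) / measure lebesgue (ball x r))"
  unfolding emean_def
  using assms by (simp add: nn_set_integral_eq_LINT emeasure_ball_eq measure_ball_pos divide_ennreal
      set_lebesgue_integral_def Bochner_Integration.integral_nonneg)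

section \<open>Reverse Hoelder potentials and the critical radius\<close>

text \<open>With \<open>T\<close> the right-hand side of the reverse Hoelder inequality on a ball, the pointwise bound
\<open>V powr q \<le> T powr q + T powr (q - s) * V powr s\<close> integrates to twice \<open>T powr q\<close> times the volume.
In this way every exponent \<open>s \<ge> d / 2\<close>, finite or not, is replaced by \<open>d / 2\<close>.\<close>

lemma reverse_holder_lower_exponent:
  fixes V :: "real ^ 'n \<Rightarrow> real"
  assumes V: "\<And>x. 0 \<le> V x" "locally_integrable V" and q: "q > 0"
    and s: "ennreal q \<le> s" and RH: "reverse_holder s V"
  obtains C where "C > 0"
    "\<And>x r. r > 0 \<Longrightarrow> set_integrable lebesgue (ball x r) (\<lambda>y. V y powr q)"
    "\<And>x r. r > 0 \<Longrightarrow> (LINT y:ball x r|lebesgue. V y powr q)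
        \<le> 2 * measure lebesgue (ball x r)
            * (C * ((LINT y:ball x r|lebesgue. V y) / measure lebesgue (ball x r))) powr q"
proof -
  obtain C where C: "C > 0" and RH: "\<And>x0 r. r > 0 \<Longrightarrow>
        (if s = \<infinity> then esssup (lebesgue_on (ball x0 r)) (\<lambda>x. ennreal (V x))
         else epowr (emean (\<lambda>x. epowr (ennreal (V x)) (enn2real s)) (ball x0 r)) (1 / enn2real s))
        \<le> ennreal C * emean (\<lambda>x. ennreal (V x)) (ball x0 r)"
    using RH unfolding reverse_holder_def by blast
  have Vm[measurable]: "V \<in> borel_measurable lebesgue"
    using V(2) by (rule locally_integrable_measurable)
  have main: "(\<integral>\<^sup>+y\<in>ball x r. ennreal (V y powr q) \<partial>lebesgue) \<le>
     ennreal (2 * measure lebesgue (ball x r)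
            * (C * ((LINT y:ball x r|lebesgue. V y) / measure lebesgue (ball x r))) powr q)"
    if r: "r > 0" for x :: "real ^ 'n" and r
  proof -
    define B where "B = ball x r"
    define m where "m = measure lebesgue B"
    define v where "v = (LINT y:B|lebesgue. V y) / m"
    define T where "T = C * v"
    have Bs[measurable]: "B \<in> sets lebesgue" unfolding B_def by simp
    have m: "m > 0" "emeasure lebesgue B = ennreal m"
      unfolding m_def B_def using r by (auto simp: measure_ball_pos emeasure_ball_eq)
    have iV: "set_integrable lebesgue B V"
      unfolding B_def by (rule locally_integrable_on_bounded[OF V(2)]) auto
    have v0: "v \<ge> 0" unfolding v_def set_lebesgue_integral_def
      using m V by (intro divide_nonneg_nonneg Bochner_Integration.integral_nonneg) auto
    then have T0: "T \<ge> 0" unfolding T_def using C by simp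
    have emv: "emean (\<lambda>x. ennreal (V x)) B = ennreal v"
      unfolding v_def m_def B_def using iV V r B_def by (intro emean_ball_eq) auto
    have CT: "ennreal C * emean (\<lambda>x. ennreal (V x)) B = ennreal T"
      unfolding emv T_def using C v0 by (simp add: ennreal_mult)
    have "(\<integral>\<^sup>+y\<in>B. ennreal (V y powr q) \<partial>lebesgue) \<le> ennreal (2 * m * T powr q)"
    proof (cases "v = 0")
      case True
      have "(\<integral>\<^sup>+y\<in>B. ennreal (V y) \<partial>lebesgue) = 0"
        using True m V by (simp add: nn_set_integral_eq_LINT[OF iV] v_def)
      then have "AE y in lebesgue. ennreal (V y) * indicator B y = 0"
        by (subst (asm) nn_integral_0_iff_AE) auto
      then have "AE y in lebesgue. ennreal (V y powr q) * indicator B y = 0"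
      proof eventually_elim
        case (elim y)
        then show ?case using V(1)[of y] by (auto simp: indicator_def split: if_splits)
      qed
      then have "(\<integral>\<^sup>+y\<in>B. ennreal (V y powr q) \<partial>lebesgue) = 0"
        by (subst nn_integral_0_iff_AE) auto
      then show ?thesis by simp
    next
      case False
      then have T: "T > 0" using v0 C unfolding T_def by auto
      have const: "(\<integral>\<^sup>+y\<in>B. ennreal c \<partial>lebesgue) = ennreal (c * m)" if "c \<ge> 0" for c
        using that m by (simp add: nn_integral_cmult_indicator ennreal_mult)
      show ?thesis
      proof (cases "s = \<infinity>")
        case True
        have "esssup (lebesgue_on B) (\<lambda>x. ennreal (V x)) \<le> ennreal T"
          using RH[OF r, of x] True CT unfolding B_def by simp
        then have "AE y in lebesgue_on B. ennreal (V y) \<le> ennreal T"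
          using esssup_AE[of "\<lambda>x. ennreal (V x)" "lebesgue_on B"] by (auto elim: eventually_mono)
        then have "AE y in lebesgue. y \<in> B \<longrightarrow> V y \<le> T"
          using T0 by (simp add: AE_restrict_space_iff ennreal_le_iff)
        then have "(\<integral>\<^sup>+y\<in>B. ennreal (V y powr q) \<partial>lebesgue) \<le> (\<integral>\<^sup>+y\<in>B. ennreal (T powr q) \<partial>lebesgue)"
          by (intro nn_integral_mono_AE, eventually_elim)
             (use V q in \<open>auto simp: indicator_def intro!: ennreal_leI powr_mono2\<close>)
        also have "\<dots> \<le> ennreal (2 * m * T powr q)"
          using m by (subst const) (auto intro!: ennreal_leI)
        finally show ?thesis .
      next
        case False
        define \<sigma> where "\<sigma> = enn2real s"
        have s\<sigma>: "s = ennreal \<sigma>" using False unfolding \<sigma>_def by (simp add: top.not_eq_extremum)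
        have \<sigma>: "q \<le> \<sigma>" using s q unfolding s\<sigma> by (metis \<sigma>_def enn2real_nonneg ennreal_le_iff)
        have "epowr (emean (\<lambda>x. epowr (ennreal (V x)) \<sigma>) B) (1 / \<sigma>) \<le> ennreal T"
          using RH[OF r, of x] False CT unfolding B_def \<sigma>_def by simp
        then have "emean (\<lambda>x. epowr (ennreal (V x)) \<sigma>) B \<le> ennreal (T powr \<sigma>)"
          using \<sigma> q T0 by (intro le_powr_if_epowr_inverse_le) auto
        then have "(\<integral>\<^sup>+y\<in>B. ennreal (V y powr \<sigma>) \<partial>lebesgue) / ennreal m \<le> ennreal (T powr \<sigma>)"
          using V \<sigma> q unfolding emean_def m by (simp add: epowr_ennreal)
        then have "(\<integral>\<^sup>+y\<in>B. ennreal (V y powr \<sigma>) \<partial>lebesgue) / ennreal m * ennreal m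
            \<le> ennreal (T powr \<sigma>) * ennreal m" by (rule mult_right_mono) simp
        then have \<sigma>i: "(\<integral>\<^sup>+y\<in>B. ennreal (V y powr \<sigma>) \<partial>lebesgue) \<le> ennreal (T powr \<sigma>) * ennreal m"
          using m(1) by (simp add: ennreal_divide_times ennreal_mult_divide_eq)
        have "(\<integral>\<^sup>+y\<in>B. ennreal (V y powr q) \<partial>lebesgue) \<le>
           (\<integral>\<^sup>+y. (ennreal (T powr q) * indicator B y
                + ennreal (T powr (q - \<sigma>)) * (ennreal (V y powr \<sigma>) * indicator B y)) \<partial>lebesgue)"
        proof (intro nn_integral_mono)
          fix y
          have "V y powr q \<le> T powr q + T powr (q - \<sigma>) * V y powr \<sigma>"
          proof (cases "V y \<le> T")
            case True then show ?thesis using V q by (simp add: add_increasing2 powr_mono2)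
          next
            case False
            then have "V y powr q = V y powr (q - \<sigma>) * V y powr \<sigma>" using T by (simp add: powr_add[symmetric])
            also have "\<dots> \<le> T powr (q - \<sigma>) * V y powr \<sigma>"
              using False T \<sigma> by (intro mult_right_mono powr_mono2') auto
            finally show ?thesis by (simp add: add_increasing)
          qed
          then show "ennreal (V y powr q) * indicator B y \<le> ennreal (T powr q) * indicator B y
                + ennreal (T powr (q - \<sigma>)) * (ennreal (V y powr \<sigma>) * indicator B y)"
            by (auto simp: indicator_def ennreal_mult'[symmetric] ennreal_plus[symmetric] simp del: ennreal_plus intro!: ennreal_leI)
        qed
        also have "\<dots> = ennreal (T powr q * m) + ennreal (T powr (q - \<sigma>)) * (\<integral>\<^sup>+y\<in>B. ennreal (V y powr \<sigma>) \<partial>lebesgue)"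
          using const[of "T powr q"] by (subst nn_integral_add, simp, simp, subst nn_integral_cmult) auto
        also have "\<dots> \<le> ennreal (T powr q * m) + ennreal (T powr (q - \<sigma>)) * (ennreal (T powr \<sigma>) * ennreal m)"
          by (intro add_left_mono mult_left_mono \<sigma>i) simp
        also have "\<dots> = ennreal (2 * m * T powr q)"
        proof -
          have "T powr (q - \<sigma>) * T powr \<sigma> = T powr q" using T by (simp add: powr_add[symmetric])
          then have "T powr q * m + T powr (q - \<sigma>) * (T powr \<sigma> * m) = 2 * m * T powr q"
            by (simp add: algebra_simps)
          then show ?thesis using m(1)
            by (simp add: ennreal_mult'[symmetric] ennreal_plus[symmetric] del: ennreal_plus)
        qed
        finally show ?thesis .
      qed
    qed
    then show ?thesis unfolding B_def m_def T_def v_def by simp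
  qed
  show thesis
  proof (rule that[OF C])
    fix x :: "real^'n" and r :: real assume r: "r > 0"
    show "set_integrable lebesgue (ball x r) (\<lambda>y. V y powr q)"
      by (rule set_integrable_if_nn_le(1)[OF _ _ _ _ main[OF r]]) auto
    show "(LINT y:ball x r|lebesgue. V y powr q)
        \<le> 2 * measure lebesgue (ball x r)
            * (C * ((LINT y:ball x r|lebesgue. V y) / measure lebesgue (ball x r))) powr q"
      by (rule set_integrable_if_nn_le(2)[OF _ _ _ _ main[OF r]]) auto
  qed
qed

text \<open>At \<open>q = d / 2\<close> the powers of \<open>r\<close> match, because \<open>d * (1 - q) = - (d - 2) * q\<close>: the integral of
\<open>V powr q\<close> over a ball is controlled by the quantity that defines the critical radius.\<close>

lemma reverse_holder_balls:
  fixes V :: "real ^ 'n \<Rightarrow> real"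
  defines "q \<equiv> real CARD('n) / 2"
  assumes d: "3 \<le> CARD('n)" and V: "\<And>x. 0 \<le> V x" "locally_integrable V"
    and s: "ennreal q \<le> s" and RH: "reverse_holder s V"
  obtains K where "K > 0"
    "\<And>x r. r > 0 \<Longrightarrow> set_integrable lebesgue (ball x r) (\<lambda>y. V y powr q)"
    "\<And>x r. r > 0 \<Longrightarrow> (LINT y:ball x r|lebesgue. V y powr q)
        \<le> K * ((LINT y:ball x r|lebesgue. V y) / r ^ (CARD('n) - 2)) powr q"
proof -
  have q: "q > 1" using d by (simp add: q_def)
  obtain C where C: "C > 0"
    "\<And>x r. r > 0 \<Longrightarrow> set_integrable lebesgue (ball x r) (\<lambda>y. V y powr q)"
    "\<And>x r. r > 0 \<Longrightarrow> (LINT y:ball x r|lebesgue. V y powr q)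
        \<le> 2 * measure lebesgue (ball x r)
            * (C * ((LINT y:ball x r|lebesgue. V y) / measure lebesgue (ball x r))) powr q"
    by (rule reverse_holder_lower_exponent[OF V _ s RH]) (use q in auto)
  define w where "w = measure lebesgue (ball (0::real^'n) 1)"
  have w: "w > 0" unfolding w_def by (rule measure_unit_ball_pos)
  show thesis
  proof (rule that[OF _ C(2)])
    show "2 * C powr q * w powr (1 - q) > 0" using C(1) w by simp
    fix x :: "real^'n" and r :: real assume r: "r > 0"
    define W where "W = (LINT y:ball x r|lebesgue. V y)"
    have W: "W \<ge> 0" unfolding W_def by (intro set_LINT_nonneg V)
    have pw: "r ^ k = r powr real k" for k using r by (simp add: powr_realpow)
    have "2 * measure lebesgue (ball x r) * (C * (W / measure lebesgue (ball x r))) powr q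
       = 2 * (w * r ^ CARD('n)) * (C * (W / (w * r ^ CARD('n)))) powr q"
      unfolding w_def using measure_ball_scaling[of r x] r by simp
    also have "\<dots> = 2 * C powr q * (w * w powr (-q)) * W powr q * (r powr CARD('n) * r powr (- CARD('n) * q))"
      using w C(1) W r unfolding pw by (simp add: powr_mult powr_divide powr_powr powr_minus_divide)
    also have "w * w powr (-q) = w powr (1 - q)" using w powr_add[of w 1 "-q"] by simp
    also have "r powr CARD('n) * r powr (- CARD('n) * q) = r powr (- (real (CARD('n) - 2) * q))"
    proof -
      have "CARD('n) + (- CARD('n) * q) = - (real (CARD('n) - 2) * q)"
        using d by (simp add: q_def of_nat_diff field_simps)
      then show ?thesis by (simp add: powr_add[symmetric])
    qed
    also have "2 * C powr q * w powr (1 - q) * W powr q * r powr (- (real (CARD('n) - 2) * q))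
       = 2 * C powr q * w powr (1 - q) * (W / r ^ (CARD('n) - 2)) powr q"
      using r W unfolding pw by (simp add: powr_divide powr_powr powr_minus_divide)
    finally show "(LINT y:ball x r|lebesgue. V y powr q)
        \<le> 2 * C powr q * w powr (1 - q) * ((LINT y:ball x r|lebesgue. V y) / r ^ (CARD('n) - 2)) powr q"
      using C(3)[OF r, of x] unfolding W_def by simp
  qed
qed

lemma set_integral_ball_split:
  fixes h :: "real ^ 'n \<Rightarrow> real"
  assumes "set_integrable lebesgue (ball x r) h" "s \<le> r"
  shows "(LINT y:ball x r|lebesgue. h y)
     = (LINT y:ball x s|lebesgue. h y) + (LINT y:ball x r - ball x s|lebesgue. h y)"
proof -
  have "ball x r = ball x s \<union> (ball x r - ball x s)" using subset_ball[OF assms(2)] by blast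
  moreover have "set_integrable lebesgue (ball x s) h" "set_integrable lebesgue (ball x r - ball x s) h"
    by (rule set_integrable_subset[OF assms(1)]; use subset_ball[OF assms(2)] in auto)+
  then have "(LINT y:ball x s \<union> (ball x r - ball x s)|lebesgue. h y)
     = (LINT y:ball x s|lebesgue. h y) + (LINT y:ball x r - ball x s|lebesgue. h y)"
    by (intro set_integral_Un) auto
  ultimately show ?thesis by simp
qed

text \<open>The ball is cut along a smaller concentric ball.  If that ball is small, Hoelder's inequality makes its
share of the integral of \<open>V\<close> small, so by the reverse inequality the annulus carries a fixed share of
the integral of \<open>V powr q\<close>.  If the annulus is thin, the same two inequalities show that it carries at
most half of the integral of \<open>V\<close>.\<close>

lemma reverse_doubling_and_doubling:
  fixes V :: "real ^ 'n \<Rightarrow> real"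
  defines "q \<equiv> real CARD('n) / 2"
  defines "W \<equiv> \<lambda>x r. (LINT y:ball x r|lebesgue. V y)"
  defines "U \<equiv> \<lambda>x r. (LINT y:ball x r|lebesgue. V y powr q)"
  assumes d: "3 \<le> CARD('n)" and V: "\<And>x. 0 \<le> V x" "locally_integrable V"
    and K: "K > 0"
    and iU: "\<And>x r. r > 0 \<Longrightarrow> set_integrable lebesgue (ball x r) (\<lambda>y. V y powr q)"
    and RH: "\<And>x r. r > 0 \<Longrightarrow> U x r \<le> K * (W x r / r ^ (CARD('n) - 2)) powr q"
  shows "\<exists>c>0. \<forall>x. \<forall>r>0. (W x r / r ^ (CARD('n) - 2)) powr q \<le> c * U x r"
    and "\<exists>l \<eta>. 0 < l \<and> l < 1 \<and> 0 < \<eta> \<and> \<eta> < 1 \<and> (\<forall>x. \<forall>r>0. U x (l * r) \<le> (1 - \<eta>) * U x r)"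
    and "\<exists>\<tau>. 0 < \<tau> \<and> \<tau> < 1 \<and> (\<forall>x. \<forall>r>0. W x r \<le> 2 * W x (\<tau> * r))"
proof -
  define n where "n = CARD('n) - 2"
  have n: "n \<ge> 1" "real n = real CARD('n) - 2" using d by (auto simp: n_def)
  have q: "q > 1" using d by (simp add: q_def)
  have dq: "real CARD('n) * (1 - 1/q) = real n" using d by (simp add: q_def n field_simps)
  define w where "w = measure lebesgue (ball (0::real^'n) 1) powr (1 - 1/q)"
  have w: "w > 0" unfolding w_def using measure_unit_ball_pos[where 'n='n] by simp
  have mb: "measure lebesgue (ball x r) powr (1 - 1/q) = w * r ^ n" if "r > 0" for x :: "real^'n" and r
  proof -
    have "measure lebesgue (ball x r) powr (1 - 1/q) = w * (r ^ CARD('n)) powr (1 - 1/q)"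
      unfolding w_def using that measure_ball_scaling[of r x] by (simp add: powr_mult)
    also have "(r ^ CARD('n)) powr (1 - 1/q) = r powr n"
      using that dq by (simp add: powr_realpow[symmetric] powr_powr)
    finally show ?thesis using that by (simp add: powr_realpow)
  qed
  have W0: "W x r \<ge> 0" for x r unfolding W_def by (intro set_LINT_nonneg V)
  have U0: "U x r \<ge> 0" for x r unfolding U_def by (intro set_LINT_nonneg) simp
  have iW: "set_integrable lebesgue (ball x r) V" for x r
    by (rule locally_integrable_on_bounded[OF V(2)]) auto
  define K' where "K' = K powr (1/q)"
  have K': "K' > 0" using K by (simp add: K'_def)
  have RH': "U x r powr (1/q) \<le> K' * W x r / r ^ n" if "r > 0" for x r
  proof -
    have "U x r powr (1/q) \<le> (K * (W x r / r ^ n) powr q) powr (1/q)"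
      using RH[OF that, of x] U0 q unfolding n_def by (intro powr_mono2) auto
    also have "\<dots> = K' * (W x r / r ^ n)"
      using K W0[of x r] q that unfolding K'_def by (simp add: powr_mult powr_powr)
    finally show ?thesis by simp
  qed
  have H: "W x r \<le> 2 * w * r ^ n * U x r powr (1/q)" if "r > 0" for x r
    using set_integral_powr_bound[OF q V(1) iW iU[OF that], of x] mb[OF that, of x]
    unfolding W_def U_def by (simp add: algebra_simps)
  have Ha: "W x r - W x s \<le> 2 * measure lebesgue (ball x r - ball x s) powr (1 - 1/q) * (U x r - U x s) powr (1/q)"
    if "r > 0" "s \<le> r" for x r s
  proof -
    define A where "A = ball x r - ball x s"
    have eqs: "W x r - W x s = (LINT y:A|lebesgue. V y)" "U x r - U x s = (LINT y:A|lebesgue. V y powr q)"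
      unfolding W_def U_def A_def
      using set_integral_ball_split[OF iW that(2)] set_integral_ball_split[OF iU[OF that(1)] that(2)] by simp_all
    have "set_integrable lebesgue A V" "set_integrable lebesgue A (\<lambda>y. V y powr q)"
      unfolding A_def by (rule set_integrable_subset[OF iW[of x r]] set_integrable_subset[OF iU[OF that(1), of x]]; auto)+
    moreover have "A \<in> lmeasurable" unfolding A_def by (intro fmeasurable.Diff) auto
    ultimately show ?thesis
      using set_integral_powr_bound[OF q V(1), where E = A and M = lebesgue]
      unfolding eqs A_def[symmetric] by simp
  qed
  have Ule: "U x s \<le> U x r" if "s \<le> r" "r > 0" for x r s
  proof -
    have "(LINT y:ball x r - ball x s|lebesgue. V y powr q) \<ge> 0"
      by (intro set_LINT_nonneg) simp
    then show ?thesis using set_integral_ball_split[OF iU[OF that(2)] that(1)] unfolding U_def by simp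
  qed
  show "\<exists>c>0. \<forall>x. \<forall>r>0. (W x r / r ^ (CARD('n) - 2)) powr q \<le> c * U x r"
  proof (intro exI[of _ "(2 * w) powr q"] conjI allI impI)
    show "(2 * w) powr q > 0" using w by simp
    fix x :: "real^'n" and r :: real assume r: "r > 0"
    have "W x r / r ^ n \<le> 2 * w * U x r powr (1/q)" using H[OF r, of x] r by (simp add: field_simps)
    then have "(W x r / r ^ n) powr q \<le> (2 * w * U x r powr (1/q)) powr q"
      using W0[of x r] r q by (intro powr_mono2) auto
    also have "\<dots> = (2 * w) powr q * U x r" using w U0[of x r] q by (simp add: powr_mult powr_powr)
    finally show "(W x r / r ^ (CARD('n) - 2)) powr q \<le> (2 * w) powr q * U x r" unfolding n_def .
  qed
  show "\<exists>l \<eta>. 0 < l \<and> l < 1 \<and> 0 < \<eta> \<and> \<eta> < 1 \<and> (\<forall>x. \<forall>r>0. U x (l * r) \<le> (1 - \<eta>) * U x r)"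
  proof -
    \<comment> \<open>The small ball then contributes at most half of the left-hand side, which is absorbed.\<close>
    define l where "l = min (1/2) (1 / (4 * K' * w))"
    define L where "L = 4 * K' * w"
    define \<eta> where "\<eta> = min (1/2) (L powr (-q))"
    have l: "0 < l" "l < 1" "2 * K' * w * l \<le> 1/2" unfolding l_def using K' w by (auto simp: min_def field_simps)
    have L: "L > 0" unfolding L_def using K' w by simp
    have "U x (l * r) \<le> (1 - \<eta>) * U x r" if r: "r > 0" for x r
    proof -
      define u v where "u = U x r" and "v = U x (l * r)"
      have vu: "v \<le> u" "0 \<le> v" unfolding u_def v_def using Ule[of "l*r" r x] l r U0 by auto
      have "W x r - W x (l*r) \<le> 2 * (w * r ^ n) * (u - v) powr (1/q)"
      proof -
        have "W x r - W x (l*r) \<le> 2 * measure lebesgue (ball x r - ball x (l*r)) powr (1 - 1/q) * (u - v) powr (1/q)"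
          unfolding u_def v_def using l r by (intro Ha) auto
        also have "\<dots> \<le> 2 * measure lebesgue (ball x r) powr (1 - 1/q) * (u - v) powr (1/q)"
          using q by (intro mult_right_mono mult_left_mono powr_mono2 measure_mono_fmeasurable) auto
        finally show ?thesis unfolding mb[OF r] by simp
      qed
      moreover have "W x (l*r) \<le> 2 * w * (l * r) ^ n * v powr (1/q)"
        unfolding v_def using l r by (intro H) auto
      moreover have "2 * w * (l * r) ^ n * v powr (1/q) \<le> 2 * w * (l * r ^ n) * u powr (1/q)"
      proof -
        have "(l * r) ^ n \<le> l * r ^ n"
          using power_decreasing[OF n(1), of l] l r by (simp add: power_mult_distrib)
        then show ?thesis using w vu q r l by (intro mult_mono powr_mono2) auto
      qed
      ultimately have "W x r \<le> 2 * w * r ^ n * (l * u powr (1/q) + (u - v) powr (1/q))"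
        by (simp add: algebra_simps)
      then have "W x r / r ^ n \<le> 2 * w * (l * u powr (1/q) + (u - v) powr (1/q))"
        using r by (simp add: field_simps)
      then have "K' * (W x r / r ^ n) \<le> K' * (2 * w * (l * u powr (1/q) + (u - v) powr (1/q)))"
        using K' by (intro mult_left_mono) auto
      then have "u powr (1/q) \<le> K' * (2 * w * (l * u powr (1/q) + (u - v) powr (1/q)))"
        using RH'[OF r, of x] unfolding u_def times_divide_eq_right by (rule order_trans[rotated])
      also have "\<dots> = (2 * K' * w * l) * u powr (1/q) + 2 * K' * w * (u - v) powr (1/q)"
        by (simp add: algebra_simps)
      also have "\<dots> \<le> (1/2) * u powr (1/q) + 2 * K' * w * (u - v) powr (1/q)"
        using l by (intro add_right_mono mult_right_mono) auto
      finally have "u powr (1/q) \<le> L * (u - v) powr (1/q)" unfolding L_def by simp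
      then have "(u powr (1/q)) powr q \<le> (L * (u - v) powr (1/q)) powr q"
        using q by (intro powr_mono2) auto
      then have "u \<le> L powr q * (u - v)" using q vu L by (simp add: powr_mult powr_powr)
      then have "L powr (-q) * u \<le> u - v" using L by (simp add: powr_minus field_simps)
      moreover have "\<eta> * u \<le> L powr (-q) * u" unfolding \<eta>_def using vu by (intro mult_right_mono) auto
      ultimately show ?thesis unfolding u_def v_def by (simp add: algebra_simps)
    qed
    moreover have "0 < \<eta>" "\<eta> < 1" unfolding \<eta>_def using L by auto
    ultimately show ?thesis using l by blast
  qed
  show "\<exists>\<tau>. 0 < \<tau> \<and> \<tau> < 1 \<and> (\<forall>x. \<forall>r>0. W x r \<le> 2 * W x (\<tau> * r))"
  proof -
    define a where "a = 1 - 1/q"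
    have a: "a > 0" unfolding a_def using q by simp
    \<comment> \<open>\<open>\<epsilon>\<close> is the share of the annulus in the volume of the ball.\<close>
    define \<epsilon> where "\<epsilon> = min (1/2) ((1 / (4 * w * K')) powr (1/a))"
    have \<epsilon>: "0 < \<epsilon>" "\<epsilon> < 1" unfolding \<epsilon>_def using w K' by auto
    have \<epsilon>a: "\<epsilon> powr a \<le> 1 / (4 * w * K')"
    proof -
      have "\<epsilon> powr a \<le> ((1 / (4 * w * K')) powr (1/a)) powr a"
        using a \<epsilon> unfolding \<epsilon>_def by (intro powr_mono2) auto
      then show ?thesis using a w K' by (simp add: powr_powr)
    qed
    define \<tau> where "\<tau> = root CARD('n) (1 - \<epsilon>)"
    have \<tau>: "0 < \<tau>" "\<tau> < 1" "\<tau> ^ CARD('n) = 1 - \<epsilon>" unfolding \<tau>_def using \<epsilon> d by auto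
    have "W x r \<le> 2 * W x (\<tau> * r)" if r: "r > 0" for x r
    proof -
      have tr: "\<tau> * r \<le> r" using \<tau> r by simp
      have "measure lebesgue (ball x r - ball x (\<tau> * r)) = measure lebesgue (ball x r) - measure lebesgue (ball x (\<tau> * r))"
        by (rule measurable_measure_Diff) (use subset_ball[OF tr] in auto)
      also have "\<dots> = measure lebesgue (ball (0::real^'n) 1) * r ^ CARD('n) * \<epsilon>"
        using measure_ball_scaling[of r x] measure_ball_scaling[of "\<tau> * r" x] r \<tau>
        by (simp add: power_mult_distrib algebra_simps)
      also have "\<dots> = measure lebesgue (ball x r) * \<epsilon>" using measure_ball_scaling[of r x] r by simp
      finally have m: "measure lebesgue (ball x r - ball x (\<tau> * r)) powr (1 - 1/q) = w * r ^ n * \<epsilon> powr a"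
        using mb[OF r, of x] \<epsilon> by (simp add: powr_mult a_def)
      have "W x r - W x (\<tau> * r) \<le> 2 * (w * r ^ n * \<epsilon> powr a) * (U x r - U x (\<tau> * r)) powr (1/q)"
        using Ha[OF r tr, of x] unfolding m .
      also have "\<dots> \<le> 2 * (w * r ^ n * \<epsilon> powr a) * U x r powr (1/q)"
        using w r q Ule[OF tr r, of x] U0 by (intro mult_left_mono powr_mono2) auto
      also have "\<dots> \<le> 2 * (w * r ^ n * \<epsilon> powr a) * (K' * W x r / r ^ n)"
        using w r by (intro mult_left_mono RH' r) auto
      also have "\<dots> = (2 * w * K' * W x r) * \<epsilon> powr a" using r by simp
      also have "\<dots> \<le> (2 * w * K' * W x r) * (1 / (4 * w * K'))"
        using w K' W0 by (intro mult_left_mono \<epsilon>a) auto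
      also have "\<dots> = W x r / 2" using w K' by simp
      finally show ?thesis by simp
    qed
    then show ?thesis using \<tau> by blast
  qed
qed

text \<open>About \<open>ln t / ln (1 / \<tau>)\<close> applications of the doubling inequality lead from \<open>t * r\<close> down to \<open>r\<close>.\<close>

lemma doubling_power_bound:
  fixes W :: "real \<Rightarrow> real"
  assumes mono: "\<And>s r. 0 < s \<Longrightarrow> s \<le> r \<Longrightarrow> W s \<le> W r"
    and dbl: "\<And>r. r > 0 \<Longrightarrow> W r \<le> 2 * W (\<tau> * r)" and \<tau>: "0 < \<tau>" "\<tau> < 1"
    and r: "r > 0" and t: "t \<ge> 1" and W0: "W r \<ge> 0"
  shows "W (t * r) \<le> 2 * t powr (ln 2 / ln (1 / \<tau>)) * W r"
proof -
  define L where "L = ln (1 / \<tau>)"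
  have L: "L > 0" unfolding L_def using \<tau> by simp
  have it: "s > 0 \<Longrightarrow> W s \<le> 2 ^ k * W (\<tau> ^ k * s)" for k s
  proof (induction k)
    case (Suc k)
    then have "W s \<le> 2 ^ k * W (\<tau> ^ k * s)" by simp
    also have "\<dots> \<le> 2 ^ k * (2 * W (\<tau> * (\<tau> ^ k * s)))"
      using Suc \<tau> by (intro mult_left_mono dbl) auto
    finally show ?case by (simp add: mult_ac)
  qed simp
  define k where "k = nat \<lceil>ln t / L\<rceil>"
  have lt: "ln t / L \<ge> 0" using t L by simp
  have k: "ln t / L \<le> k" "k \<le> ln t / L + 1" unfolding k_def using lt by linarith+
  have "\<tau> ^ k * t \<le> 1"
  proof -
    have "ln (\<tau> ^ k * t) = - (k * L) + ln t"
      using \<tau> t unfolding L_def by (simp add: ln_mult ln_realpow ln_div)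
    also have "\<dots> \<le> 0" using k(1) L by (simp add: field_simps)
    finally show ?thesis using \<tau> t by simp
  qed
  then have "\<tau> ^ k * (t * r) \<le> r" using r by (simp add: mult.assoc[symmetric])
  then have "W (\<tau> ^ k * (t * r)) \<le> W r" using \<tau> t r by (intro mono) auto
  then have "2 ^ k * W (\<tau> ^ k * (t * r)) \<le> 2 ^ k * W r" by simp
  then have "W (t * r) \<le> 2 ^ k * W r"
    using it[of "t * r" k] t r by (auto intro: order_trans)
  also have "2 ^ k \<le> 2 * t powr (ln 2 / L)"
  proof -
    have "(2::real) ^ k = 2 powr k" by (simp add: powr_realpow)
    also have "\<dots> \<le> 2 powr (ln t / L + 1)" using k by simp
    also have "\<dots> = 2 * 2 powr (ln t / L)" by (simp add: powr_add)
    also have "2 powr (ln t / L) = t powr (ln 2 / L)"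
      using t by (simp add: powr_def)
    finally show ?thesis .
  qed
  finally show ?thesis using W0 unfolding L_def by (simp add: mult_right_mono)
qed

text \<open>\<open>W\<close> and \<open>U\<close> are to be the integrals of \<open>V\<close> and \<open>V powr q\<close> over balls; \<open>U\<close> is comparable to
the \<open>q\<close>-th power of the quantity in the definition of \<open>\<rho>\<close>, and it is monotone in the ball.  Reverse
doubling makes \<open>U\<close> decay geometrically as the radius shrinks and grow without bound as it increases, so
the set of admissible radii is nonempty and bounded.  For two points, take an admissible radius \<open>r1\<close> of
\<open>x\<close> close to \<open>\<rho> x\<close>.  By doubling, \<open>U y r1\<close> is at most a power of \<open>t = 1 + dist x y / r1\<close>, and a
number \<open>k\<close> of order \<open>ln t\<close> of contractions by \<open>l\<close> makes \<open>l ^ k * r1\<close> admissible for \<open>y\<close>.\<close>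

lemma critical_radius_lower_bound:
  fixes W U :: "'a::metric_space \<Rightarrow> real \<Rightarrow> real" and n :: nat
  defines "S \<equiv> \<lambda>x. {r. r > 0 \<and> 1 / r ^ n * W x r \<le> 1}"
  defines "\<rho> \<equiv> \<lambda>x. Sup (S x)"
  assumes W0: "\<And>x r. W x r \<ge> 0" and U0: "\<And>x r. U x r \<ge> 0" and q: "q > 0" and n: "n \<ge> 1"
    and Wmono: "\<And>x y r s. 0 < r \<Longrightarrow> dist x y + r \<le> s \<Longrightarrow> W x r \<le> W y s"
    and Umono: "\<And>x y r s. 0 < r \<Longrightarrow> dist x y + r \<le> s \<Longrightarrow> U x r \<le> U y s"
    and Upos: "\<And>x. \<exists>r>0. U x r > 0"
    and K: "K > 0" "\<And>x r. r > 0 \<Longrightarrow> U x r \<le> K * (W x r / r ^ n) powr q"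
    and c: "c > 0" "\<And>x r. r > 0 \<Longrightarrow> (W x r / r ^ n) powr q \<le> c * U x r"
    and l: "0 < l" "l < 1" and \<eta>: "0 < \<eta>" "\<eta> < 1"
    and rdbl: "\<And>x r. r > 0 \<Longrightarrow> U x (l * r) \<le> (1 - \<eta>) * U x r"
    and \<tau>: "0 < \<tau>" "\<tau> < 1" and dbl: "\<And>x r. r > 0 \<Longrightarrow> W x r \<le> 2 * W x (\<tau> * r)"
  shows "\<rho> x > 0"
    and "\<exists>a>0. \<exists>N\<ge>0. \<forall>x y. a * \<rho> x * (1 + dist x y / \<rho> x) powr (- N) \<le> \<rho> y"
proof -
  have it: "r > 0 \<Longrightarrow> U x (l ^ k * r) \<le> (1 - \<eta>) ^ k * U x r" for k r x
  proof (induction k)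
    case (Suc k)
    have "U x (l * (l ^ k * r)) \<le> (1 - \<eta>) * U x (l ^ k * r)" using Suc l by (intro rdbl) auto
    also have "\<dots> \<le> (1 - \<eta>) * ((1 - \<eta>) ^ k * U x r)" using Suc \<eta> by (intro mult_left_mono) auto
    finally show ?case by (simp add: mult_ac)
  qed simp
  have inS: "r \<in> S x" if "r > 0" "c * U x r \<le> 1" for r x
  proof -
    have "(W x r / r ^ n) powr q \<le> 1" using c(2)[OF that(1), of x] that(2) by linarith
    then have "W x r / r ^ n \<le> 1"
      using q by (metis gr_one_powr linorder_not_le)
    then show ?thesis unfolding S_def using that(1) by simp
  qed
  have bdd: "bdd_above (S x)" for x
  proof -
    obtain r0 where r0: "r0 > 0" "U x r0 > 0" using Upos by blast
    obtain k where k: "(1 - \<eta>) ^ k < U x r0 / (2*K)"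
      using real_arch_pow_inv[of "U x r0 / (2*K)" "1 - \<eta>"] r0 K(1) \<eta> by auto
    define R where "R = r0 / l ^ k"
    have R: "R > 0" "l ^ k * R = r0" unfolding R_def using r0 l by auto
    have "U x r0 \<le> (1 - \<eta>) ^ k * U x R" using it[OF R(1), of x k] R by simp
    have "r \<le> R" if "r \<in> S x" for r
    proof (rule ccontr)
      assume "\<not> r \<le> R"
      then have r: "r > R" "r > 0" using R by auto
      have W: "W x r / r ^ n \<le> 1" using that unfolding S_def by simp
      have "U x r0 \<le> (1 - \<eta>) ^ k * U x R" by fact
      also have "\<dots> \<le> (1 - \<eta>) ^ k * U x r" using r R \<eta> by (intro mult_left_mono Umono) auto
      also have "\<dots> \<le> (1 - \<eta>) ^ k * (K * (W x r / r ^ n) powr q)" using r \<eta> by (intro mult_left_mono K) auto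
      also have "\<dots> \<le> (1 - \<eta>) ^ k * (K * 1)"
        using W W0[of x r] r q \<eta> K(1) by (intro mult_left_mono powr_le1) auto
      also have "\<dots> \<le> (U x r0 / (2*K)) * (K * 1)"
        using k K(1) by (intro mult_right_mono) auto
      also have "\<dots> = U x r0 / 2" using K(1) by simp
      finally show False using r0 by simp
    qed
    then show ?thesis by (auto simp: bdd_above_def)
  qed
  have ne: "\<exists>r. r \<in> S x" for x
  proof -
    have U1: "U x 1 + 1 > 0" using U0[of x 1] by linarith
    obtain k where k: "(1 - \<eta>) ^ k < 1 / (c * (U x 1 + 1))"
      using real_arch_pow_inv[of "1 / (c * (U x 1 + 1))" "1 - \<eta>"] c(1) U1 \<eta> by auto
    have "c * U x (l ^ k * 1) \<le> c * ((1 - \<eta>) ^ k * U x 1)"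
      using it[of 1 x k] c(1) by (intro mult_left_mono) auto
    also have "\<dots> \<le> c * ((1 / (c * (U x 1 + 1))) * U x 1)"
      using k c(1) U0 by (intro mult_left_mono mult_right_mono) auto
    also have "\<dots> = U x 1 / (U x 1 + 1)" using c(1) by simp
    also have "\<dots> \<le> 1" using U1 by simp
    finally have "l ^ k * 1 \<in> S x" using l by (intro inS) auto
    then show ?thesis by blast
  qed
  have le_rho: "r \<le> \<rho> x" if "r \<in> S x" for x r
    unfolding \<rho>_def using bdd that by (intro cSup_upper)
  have pos: "\<rho> x > 0" for x
  proof -
    obtain r where "r \<in> S x" using ne by blast
    then show ?thesis using le_rho[of r x] unfolding S_def by auto
  qed
  show "\<rho> x > 0" by (rule pos)
  define M where "M = ln 2 / ln (1 / \<tau>)"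
  have M: "M \<ge> 0" unfolding M_def using \<tau> by simp
  define L where "L = ln (1 / (1 - \<eta>))"
  have L: "L > 0" unfolding L_def using \<eta> by simp
  define A where "A = max 1 (c * K * 2 powr q)"
  have A: "A \<ge> 1" "c * K * 2 powr q \<le> A" unfolding A_def by auto
  define \<Lambda> where "\<Lambda> = ln (1 / l)"
  have \<Lambda>: "\<Lambda> > 0" unfolding \<Lambda>_def using l by simp
  define N where "N = M * q / L * \<Lambda>"
  have N: "N \<ge> 0" unfolding N_def using M q L \<Lambda> by simp
  define a where "a = (1/2) * l * A powr (- \<Lambda> / L) * 2 powr (- N)"
  have a: "a > 0" unfolding a_def using l A by simp
  have "a * \<rho> x * (1 + dist x y / \<rho> x) powr (- N) \<le> \<rho> y" for x y
  proof -
    \<comment> \<open>The supremum need not be admissible itself, hence an admissible radius above half of it.\<close>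
    obtain r1 where r1: "r1 \<in> S x" "\<rho> x / 2 < r1"
      using less_cSup_iff[of "S x" "\<rho> x / 2"] pos[of x] ne[of x] bdd[of x] unfolding \<rho>_def by auto
    have r1': "r1 > 0" "W x r1 \<le> r1 ^ n" "r1 \<le> \<rho> x"
      using r1 le_rho unfolding S_def by (auto simp: field_simps)
    define t where "t = 1 + dist x y / r1"
    have t: "t \<ge> 1" "t * r1 = dist x y + r1" unfolding t_def using r1' by (auto simp: field_simps)
    have "W x (t * r1) \<le> 2 * t powr M * W x r1"
      unfolding M_def
      by (rule doubling_power_bound[where W = "W x", OF _ dbl \<tau> r1'(1) t(1) W0]) (auto intro: Wmono)
    also have "\<dots> \<le> 2 * t powr M * r1 ^ n" using r1' by (intro mult_left_mono) auto
    finally have W1: "W x (t * r1) \<le> 2 * t powr M * r1 ^ n" .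
    have "W x (t * r1) / (t * r1) ^ n \<le> 2 * t powr M"
    proof -
      have "r1 ^ n \<le> (t * r1) ^ n" using t r1' by (intro power_mono) auto
      then have "2 * t powr M * r1 ^ n \<le> 2 * t powr M * (t * r1) ^ n" by (intro mult_left_mono) auto
      then have "W x (t * r1) \<le> 2 * t powr M * (t * r1) ^ n" using W1 by linarith
      moreover have "(t * r1) ^ n > 0" using t(1) r1' by (intro zero_less_power mult_pos_pos) auto
      ultimately show ?thesis by (simp only: pos_divide_le_eq)
    qed
    then have "(W x (t * r1) / (t * r1) ^ n) powr q \<le> (2 * t powr M) powr q"
      using W0 t r1' q by (intro powr_mono2) auto
    then have W2: "(W x (t * r1) / (t * r1) ^ n) powr q \<le> 2 powr q * t powr (M * q)"
      by (simp add: powr_mult powr_powr)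
    have "U y r1 \<le> U x (t * r1)" using t r1' by (intro Umono) (auto simp: dist_commute)
    also have "\<dots> \<le> K * (W x (t * r1) / (t * r1) ^ n) powr q" using t(1) r1'(1) by (intro K mult_pos_pos) auto
    also have "\<dots> \<le> K * (2 powr q * t powr (M * q))" using W2 K(1) by (intro mult_left_mono) auto
    finally have U1: "U y r1 \<le> K * (2 powr q * t powr (M * q))" .
    define X where "X = A * t powr (M * q)"
    have X: "X \<ge> 1" unfolding X_def 
    proof -
      have "1 \<le> t powr (M * q)" using t M q by (intro ge_one_powr_ge_zero) auto
      then show "1 \<le> A * t powr (M * q)" using A by (metis mult_1 mult_mono zero_le_one order_trans)
    qed
    have cU: "c * U y r1 \<le> X"
    proof -
      have "c * U y r1 \<le> c * (K * (2 powr q * t powr (M * q)))" using U1 c(1) by (intro mult_left_mono) auto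
      also have "\<dots> = (c * K * 2 powr q) * t powr (M * q)" by simp
      also have "\<dots> \<le> X" unfolding X_def using A by (intro mult_right_mono) auto
      finally show ?thesis .
    qed
    define k where "k = nat \<lceil>ln X / L\<rceil>"
    have lX: "ln X / L \<ge> 0" using X L by simp
    have k: "ln X / L \<le> k" "k \<le> ln X / L + 1" unfolding k_def using lX by linarith+
    have "(1 - \<eta>) ^ k * X \<le> 1"
    proof -
      have "ln ((1 - \<eta>) ^ k * X) = - (k * L) + ln X"
        using \<eta> X unfolding L_def by (simp add: ln_mult ln_realpow ln_div)
      also have "\<dots> \<le> 0" using k(1) L by (simp add: field_simps)
      finally show ?thesis using \<eta> X by simp
    qed
    moreover have "c * U y (l ^ k * r1) \<le> (1 - \<eta>) ^ k * X"
    proof -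
      have "c * U y (l ^ k * r1) \<le> c * ((1 - \<eta>) ^ k * U y r1)"
        using it[of r1 y k] r1' c(1) by (intro mult_left_mono) auto
      also have "\<dots> = (1 - \<eta>) ^ k * (c * U y r1)" by simp
      also have "\<dots> \<le> (1 - \<eta>) ^ k * X" using cU \<eta> by (intro mult_left_mono) auto
      finally show ?thesis .
    qed
    ultimately have "l ^ k * r1 \<in> S y" using l r1' by (intro inS) auto
    then have le: "l ^ k * r1 \<le> \<rho> y" by (rule le_rho)
    have lk: "l * A powr (- \<Lambda> / L) * t powr (- N) \<le> l ^ k"
    proof -
      have "ln (l * A powr (- \<Lambda> / L) * t powr (- N)) = - (\<Lambda> * (ln X / L + 1))"
        using l A t M q L unfolding X_def \<Lambda>_def N_def by (simp add: ln_mult ln_powr ln_div field_simps)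
      also have "\<dots> \<le> - (\<Lambda> * k)" using k(2) \<Lambda> by simp
      also have "\<dots> = ln (l ^ k)" using l by (simp add: \<Lambda>_def ln_realpow ln_div)
      finally show ?thesis using l A t by (subst (asm) ln_le_cancel_iff) auto
    qed
    have tt: "2 powr (- N) * (1 + dist x y / \<rho> x) powr (- N) \<le> t powr (- N)"
    proof -
      have "t \<le> 2 * (1 + dist x y / \<rho> x)"
      proof -
        have "dist x y / r1 \<le> dist x y / (\<rho> x / 2)"
          using r1 r1' pos[of x] by (intro divide_left_mono) auto
        then show ?thesis unfolding t_def by (simp add: algebra_simps)
      qed
      moreover have "dist x y / \<rho> x \<ge> 0" using pos[of x] by simp
      ultimately have "(2 * (1 + dist x y / \<rho> x)) powr (- N) \<le> t powr (- N)"
        using N t by (intro powr_mono2') auto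
      then show ?thesis using \<open>dist x y / \<rho> x \<ge> 0\<close> by (subst (asm) powr_mult) auto
    qed
    have "a * \<rho> x * (1 + dist x y / \<rho> x) powr (- N)
       = (l * A powr (- \<Lambda> / L)) * (2 powr (- N) * (1 + dist x y / \<rho> x) powr (- N)) * (\<rho> x / 2)"
      unfolding a_def by simp
    also have "\<dots> \<le> (l * A powr (- \<Lambda> / L)) * t powr (- N) * r1"
      using l A tt r1 pos[of x] by (intro mult_mono) auto
    also have "\<dots> \<le> l ^ k * r1" using lk r1' by (intro mult_right_mono) auto
    also have "\<dots> \<le> \<rho> y" by (rule le)
    finally show ?thesis .
  qed
  then show "\<exists>a>0. \<exists>N\<ge>0. \<forall>x y. a * \<rho> x * (1 + dist x y / \<rho> x) powr (- N) \<le> \<rho> y"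
    using a N by blast
qed

text \<open>Written for the passage from a set of size \<open>r\<close> at \<open>x\<close> to a smaller one of size \<open>h\<close> at \<open>y\<close>, which
is how the lower bound for \<open>\<rho> y\<close> in terms of \<open>\<rho> x\<close> is applied below.\<close>

definition slowly_varying :: "(real ^ 'n \<Rightarrow> real) \<Rightarrow> bool" where
  "slowly_varying \<rho> \<longleftrightarrow> (\<forall>x. 0 < \<rho> x) \<and>
     (\<exists>C\<ge>1. \<exists>N\<ge>1. \<forall>x y r h. 0 \<le> h \<longrightarrow> h \<le> r \<longrightarrow> dist x y \<le> r \<longrightarrow>
        1 + h / \<rho> y \<le> C * (1 + r / \<rho> x) powr N)"

lemma slowly_varying_critical_radius:
  fixes V :: "real ^ 'n \<Rightarrow> real"
  assumes d: "3 \<le> CARD('n)" and V: "\<And>x. 0 \<le> V x" "locally_integrable V"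
    and V_nonzero: "\<not> (AE x in lebesgue. V x = 0)"
    and s: "ennreal (real CARD('n) / 2) \<le> s" and RH: "reverse_holder s V"
  shows "slowly_varying (critical_radius V)"
proof -
  define q where "q = real CARD('n) / 2"
  define W where "W = (\<lambda>(x::real^'n) r. (LINT y:ball x r|lebesgue. V y))"
  define U where "U = (\<lambda>(x::real^'n) r. (LINT y:ball x r|lebesgue. V y powr q))"
  define n where "n = CARD('n) - 2"
  obtain K where K: "K > 0"
    and iU: "\<And>x r. r > 0 \<Longrightarrow> set_integrable lebesgue (ball x r) (\<lambda>y. V y powr q)"
    and RH': "\<And>x r. r > 0 \<Longrightarrow> U x r \<le> K * (W x r / r ^ n) powr q"
    using reverse_holder_balls[OF d V s RH] unfolding U_def W_def q_def n_def by blast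
  note rd = reverse_doubling_and_doubling[OF d V K, folded q_def n_def, OF iU RH'[unfolded W_def U_def]]
  have rd1: "\<exists>c>0. \<forall>x. \<forall>r>0. (W x r / r ^ n) powr q \<le> c * U x r"
    and rd2: "\<exists>l \<eta>. 0 < l \<and> l < 1 \<and> 0 < \<eta> \<and> \<eta> < 1 \<and> (\<forall>x. \<forall>r>0. U x (l * r) \<le> (1 - \<eta>) * U x r)"
    and rd3: "\<exists>\<tau>. 0 < \<tau> \<and> \<tau> < 1 \<and> (\<forall>x. \<forall>r>0. W x r \<le> 2 * W x (\<tau> * r))"
    unfolding W_def U_def by (rule rd; assumption)+
  obtain c where c: "c > 0" "\<And>x r. r > 0 \<Longrightarrow> (W x r / r ^ n) powr q \<le> c * U x r"
    using rd1 by blast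
  obtain l \<eta> where l: "0 < l" "l < 1" and \<eta>: "0 < \<eta>" "\<eta> < 1"
    and rdbl: "\<And>x r. r > 0 \<Longrightarrow> U x (l * r) \<le> (1 - \<eta>) * U x r"
    using rd2 by blast
  obtain \<tau> where \<tau>: "0 < \<tau>" "\<tau> < 1" and dbl: "\<And>x r. r > 0 \<Longrightarrow> W x r \<le> 2 * W x (\<tau> * r)"
    using rd3 by blast
  have iW: "set_integrable lebesgue (ball x r) V" for x r
    by (rule locally_integrable_on_bounded[OF V(2)]) auto
  have mono: "(LINT y:A|lebesgue. h y) \<le> (LINT y:B|lebesgue. h y)"
    if "A \<subseteq> B" "A \<in> sets lebesgue" "set_integrable lebesgue B h" "\<And>x. 0 \<le> h x"
    for A B and h :: "real^'n \<Rightarrow> real"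
  proof -
    have "set_integrable lebesgue A h" using that by (auto intro: set_integrable_subset)
    then show ?thesis using that unfolding set_lebesgue_integral_def set_integrable_def
      by (intro integral_mono) (auto simp: indicator_def)
  qed
  have sub: "ball x r \<subseteq> ball y s" if "dist x y + r \<le> s" for x y :: "real^'n" and r s
    using that by (metis ball_subset_ball_iff dist_commute add.commute)
  have Wm: "W x r \<le> W y s" if "0 < r" "dist x y + r \<le> s" for x y r s
    unfolding W_def using iW V(1) sub[OF that(2)] by (intro mono) auto
  have Um: "U x r \<le> U y s" if "0 < r" "dist x y + r \<le> s" for x y r s
  proof -
    have "s > 0" using that zero_le_dist[of x y] by linarith
    then show ?thesis unfolding U_def using iU sub[OF that(2)] by (intro mono) auto
  qed
  have W0: "W x r \<ge> 0" for x r unfolding W_def by (intro set_LINT_nonneg V)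
  have U0: "U x r \<ge> 0" for x r unfolding U_def by (intro set_LINT_nonneg) simp
  have Upos: "\<exists>r>0. U x r > 0" for x
  proof (rule ccontr)
    assume "\<not> (\<exists>r>0. U x r > 0)"
    then have z: "U x (real (Suc k)) = 0" for k using U0[of x "real (Suc k)"] by (metis of_nat_0_less_iff zero_less_Suc order_less_le)
    have "AE y in lebesgue. \<forall>k. indicator (ball x (real (Suc k))) y *\<^sub>R V y powr q = 0"
      unfolding AE_all_countable
    proof
      fix k
      have "integrable lebesgue (\<lambda>y. indicator (ball x (real (Suc k))) y *\<^sub>R V y powr q)"
        using iU[of "real (Suc k)" x] unfolding set_integrable_def by simp
      then show "AE y in lebesgue. indicator (ball x (real (Suc k))) y *\<^sub>R V y powr q = 0"
        using z[of k] unfolding U_def set_lebesgue_integral_def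
        by (subst (asm) integral_nonneg_eq_0_iff_AE) auto
    qed
    then have "AE y in lebesgue. V y = 0"
    proof eventually_elim
      case (elim y)
      obtain k where "dist x y < real k" using reals_Archimedean2 by blast
      then have "y \<in> ball x (real (Suc k))" by simp
      then show "V y = 0" using elim[rule_format, of k] by simp
    qed
    then show False using V_nonzero by simp
  qed
  have q: "q > 0" and n: "n \<ge> 1" using d by (auto simp: q_def n_def)
  have cr: "critical_radius V x = Sup {r. r > 0 \<and> 1 / r ^ n * W x r \<le> 1}" for x
    unfolding critical_radius_def W_def n_def ..
  note clb = critical_radius_lower_bound[of W U q n, OF W0 U0 q n Wm Um Upos K RH' c l \<eta> rdbl \<tau> dbl, folded cr]
  have pos: "critical_radius V x > 0" for x using clb(1) by blast
  obtain a N where a: "a > 0" and N: "N \<ge> 0"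
    and lb: "\<And>x y. a * critical_radius V x * (1 + dist x y / critical_radius V x) powr (- N) \<le> critical_radius V y"
    using clb(2) by blast
  have "1 + h / critical_radius V y \<le> (1 + 1/a) * (1 + r / critical_radius V x) powr (N + 1)"
    if "0 \<le> h" "h \<le> r" "dist x y \<le> r" for x y r h
  proof -
    define t where "t = 1 + r / critical_radius V x"
    have t: "t \<ge> 1" unfolding t_def using that pos[of x] by simp
    have 1: "1 \<le> t powr (N + 1)" using t N by (intro ge_one_powr_ge_zero) auto
    have "t powr (- N) \<le> (1 + dist x y / critical_radius V x) powr (- N)"
      unfolding t_def using that N pos[of x]
      by (intro powr_mono2') (auto intro: divide_right_mono add_pos_nonneg)
    then have "a * critical_radius V x * t powr (- N)
        \<le> a * critical_radius V x * (1 + dist x y / critical_radius V x) powr (- N)"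
      using a pos[of x] by (intro mult_left_mono) auto
    also have "\<dots> \<le> critical_radius V y" by (rule lb)
    finally have lo: "a * critical_radius V x * t powr (- N) \<le> critical_radius V y" .
    have "h / critical_radius V y \<le> r / (a * critical_radius V x * t powr (- N))"
      using lo that a t pos[of x] by (intro frac_le) auto
    also have "\<dots> = (1/a) * (r / critical_radius V x) * t powr N"
      using t by (simp add: powr_minus field_simps)
    also have "\<dots> \<le> (1/a) * t * t powr N"
      using a by (intro mult_right_mono mult_left_mono) (auto simp: t_def)
    also have "\<dots> = (1/a) * t powr (N + 1)" using t by (simp add: powr_add)
    finally show ?thesis using 1 unfolding t_def[symmetric] by (simp add: algebra_simps)
  qed
  moreover have "1 + 1/a \<ge> 1" "N + 1 \<ge> 1" using a N by auto
  ultimately show ?thesis unfolding slowly_varying_def using pos by blast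
qed

section \<open>Muckenhoupt weights\<close>

text \<open>The supremum is the limit of a sequence of lower bounds, so only countably many null sets occur.\<close>

lemma essinf_AE: "AE x in M. essinf M g \<le> g x"
proof -
  define S where "S = {c. AE x in M. c \<le> g x}"
  have "S \<noteq> {}" unfolding S_def by (auto intro: exI[of _ 0])
  then obtain c :: "nat \<Rightarrow> ennreal" where c: "range c \<subseteq> S" "Sup S = (SUP i. c i)"
    using ennreal_Sup_countable_SUP[of S] by blast
  have "AE x in M. \<forall>i. c i \<le> g x"
    unfolding AE_all_countable using c(1) by (auto simp: S_def)
  then show ?thesis
    unfolding essinf_def S_def[symmetric] c(2) by eventually_elim (auto intro: SUP_least)
qed

lemma epowr_pos: "a > 0 \<Longrightarrow> e > 0 \<Longrightarrow> epowr a e > 0"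
  by (cases a) (auto simp: epowr_ennreal epowr_top[simplified])

lemma weight_of_finite:
  fixes w :: "real ^ 'n \<Rightarrow> real"
  assumes "is_weight w" "bounded E" "E \<in> sets lebesgue"
  shows "weight_of w E < \<infinity>"
  using assms nn_set_integral_eq_LINT[OF locally_integrable_on_bounded, of w E]
  unfolding is_weight_def weight_of_def by auto

lemma weight_measurable: "is_weight w \<Longrightarrow> w \<in> borel_measurable lebesgue"
  by (simp add: is_weight_def locally_integrable_measurable)

lemma weight_of_pos:
  fixes w :: "real ^ 'n \<Rightarrow> real"
  assumes "is_weight w" "AE x in lebesgue. 0 < w x" "E \<in> sets lebesgue" "emeasure lebesgue E > 0"
  shows "weight_of w E > 0"
proof (rule ccontr)
  note [measurable] = weight_measurable[OF assms(1)] assms(3)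
  assume "\<not> weight_of w E > 0"
  then have "(\<integral>\<^sup>+x\<in>E. ennreal (w x) \<partial>lebesgue) = 0" by (simp add: weight_of_def)
  then have "AE x in lebesgue. ennreal (w x) * indicator E x = 0"
    by (subst (asm) nn_integral_0_iff_AE) auto
  then have "AE x in lebesgue. x \<notin> E"
    using assms(2) by eventually_elim (auto simp: indicator_def)
  then have "E \<in> null_sets lebesgue" using assms(3) by (simp add: AE_iff_null_sets)
  then show False using assms(4) by auto
qed

text \<open>On a large ball \<open>w\<close> has positive integral.  If it vanished on a set of positive measure there, then for
\<open>p > 1\<close> the integral of the negative power of \<open>w\<close> would be infinite, and for \<open>p = 1\<close> the essential
infimum would be zero; both contradict the condition on that ball.\<close>

lemma muckenhoupt_AE_pos:
  fixes w :: "real ^ 'n \<Rightarrow> real"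
  assumes w: "w \<in> muckenhoupt \<rho> \<theta> p" and p: "1 \<le> p"
  shows "AE x in lebesgue. 0 < w x"
proof -
  have iw: "is_weight w" using w by (simp add: muckenhoupt_def)
  note [measurable] = weight_measurable[OF iw]
  have w0: "\<And>x. 0 \<le> w x" using iw by (simp add: is_weight_def)
  obtain C where C: "C > 0" and
     Ap: "\<And>x0 r. r > 0 \<Longrightarrow> if p = 1 then
          emean (\<lambda>x. ennreal (w x)) (ball x0 r)
            \<le> ennreal (C * (1 + r / \<rho> x0) powr \<theta>)
              * essinf (lebesgue_on (ball x0 r)) (\<lambda>x. ennreal (w x))
        else
          epowr (emean (\<lambda>x. ennreal (w x)) (ball x0 r)) (1 / p)
            * epowr (emean (\<lambda>x. epowr (ennreal (w x)) (- conjugate_exponent p / p)) (ball x0 r))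
                (1 / conjugate_exponent p)
            \<le> ennreal (C * (1 + r / \<rho> x0) powr \<theta>)"
    using w unfolding muckenhoupt_def by blast
  define B where "B = (\<lambda>k. ball (0::real^'n) (real (Suc k)))"
  have Bm[measurable]: "B k \<in> sets lebesgue" for k by (simp add: B_def)
  have Be: "emeasure lebesgue (B k) = ennreal (measure lebesgue (B k))" "measure lebesgue (B k) > 0" for k
    unfolding B_def by (auto simp: emeasure_ball_eq measure_ball_pos)
  have "\<exists>k. weight_of w (B k) > 0"
  proof (rule ccontr)
    assume "\<not> ?thesis"
    then have "AE x in lebesgue. \<forall>k. ennreal (w x) * indicator (B k) x = 0"
      unfolding AE_all_countable weight_of_def by (subst nn_integral_0_iff_AE[symmetric]) auto
    then have "AE x in lebesgue. w x = 0"
    proof eventually_elim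
      case (elim x)
      obtain k where "norm x < real k" using reals_Archimedean2 by blast
      then have "x \<in> B k" by (simp add: B_def)
      then show "w x = 0" using elim[rule_format, of k] w0[of x] by simp
    qed
    then show False using iw by (simp add: is_weight_def)
  qed
  then obtain k0 where k0: "weight_of w (B k0) > 0" by blast
  have "AE x in lebesgue. x \<in> B k \<longrightarrow> 0 < w x" if k: "k \<ge> k0" for k
  proof -
    have "weight_of w (B k0) \<le> weight_of w (B k)"
      unfolding weight_of_def using k
      by (intro nn_integral_mono) (auto simp: B_def indicator_def)
    then have "weight_of w (B k) > 0" using k0 by simp
    then have pos: "emean (\<lambda>x. ennreal (w x)) (B k) > 0"
      unfolding emean_def weight_of_def[symmetric] Be by (simp add: ennreal_zero_less_divide)
    define K where "K = C * (1 + real (Suc k) / \<rho> 0) powr \<theta>"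
    show ?thesis
    proof (cases "p = 1")
      case True
      have "emean (\<lambda>x. ennreal (w x)) (B k) \<le> ennreal K * essinf (lebesgue_on (B k)) (\<lambda>x. ennreal (w x))"
        using Ap[of "real (Suc k)" 0] True unfolding K_def B_def by simp
      then have e: "essinf (lebesgue_on (B k)) (\<lambda>x. ennreal (w x)) > 0"
        using pos by (metis mult_zero_right not_gr_zero not_le)
      have "AE x in lebesgue_on (B k). 0 < w x"
        using essinf_AE[of "lebesgue_on (B k)" "\<lambda>x. ennreal (w x)"]
        by eventually_elim (use e in \<open>auto dest: less_le_trans\<close>)
      then show ?thesis by (simp add: AE_restrict_space_iff)
    next
      case False
      then have p1: "p > 1" using p by simp
      define p' where "p' = conjugate_exponent p"
      have p': "p' > 0" unfolding p'_def conjugate_exponent_def using p1 by simp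
      define S where "S = (\<integral>\<^sup>+x\<in>B k. epowr (ennreal (w x)) (- p' / p) \<partial>lebesgue)"
      have le: "epowr (emean (\<lambda>x. ennreal (w x)) (B k)) (1 / p)
            * epowr (S / emeasure lebesgue (B k)) (1 / p') \<le> ennreal K"
        using Ap[of "real (Suc k)" 0] False unfolding K_def B_def S_def p'_def emean_def by simp
      have "epowr (emean (\<lambda>x. ennreal (w x)) (B k)) (1 / p) > 0"
        using pos p1 by (intro epowr_pos) auto
      then have ne: "epowr (S / ennreal (measure lebesgue (B k))) (1 / p') \<noteq> \<infinity>"
        using le unfolding Be by (metis ennreal_mult_top infinity_ennreal_def not_gr_zero ennreal_neq_top top_unique)
      have "S \<noteq> \<infinity>"
      proof
        assume "S = \<infinity>"
        then have "S / ennreal (measure lebesgue (B k)) = \<infinity>" by (simp add: ennreal_top_divide)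
        then show False using ne epowr_top[of "1/p'"] p' by simp
      qed
      moreover have [measurable]: "(\<lambda>x. epowr (ennreal (w x)) (- p' / p)) \<in> borel_measurable lebesgue"
        unfolding epowr_def by measurable
      ultimately have "AE x in lebesgue. epowr (ennreal (w x)) (- p' / p) * indicator (B k) x \<noteq> \<infinity>"
        unfolding S_def by (intro nn_integral_noteq_infinite) auto
      then show ?thesis
      proof eventually_elim
        case (elim x)
        show ?case
        proof (intro impI, rule ccontr)
          assume "x \<in> B k" "\<not> 0 < w x"
          then have "w x = 0" using w0[of x] by simp
          then have "epowr (ennreal (w x)) (- p' / p) = \<infinity>" using p' p1 by (simp add: epowr_def)
          then show False using elim \<open>x \<in> B k\<close> by simp
        qed
      qed
    qed
  qed
  then have "AE x in lebesgue. \<forall>k. k \<ge> k0 \<longrightarrow> x \<in> B k \<longrightarrow> 0 < w x"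
    unfolding AE_all_countable by auto
  then show ?thesis
  proof eventually_elim
    case (elim x)
    obtain k where k: "norm x < real k" using reals_Archimedean2 by blast
    then have "x \<in> B (max k k0)" by (simp add: B_def)
    then show "0 < w x" using elim[rule_format, of "max k k0"] by simp
  qed
qed

(* Keeps the simplifier from rewriting Lebesgue measure of a set to Borel measure of a Borel part of it. *)
declare emeasure_completion [simp del]
declare measure_completion [simp del]

text \<open>For \<open>p = 1\<close> compare \<open>g\<close> with \<open>g * w\<close> divided by the essential infimum of \<open>w\<close>.  For \<open>p > 1\<close> this
is Hoelder's inequality for \<open>g = (g * w powr (1/p)) * w powr (-1/p)\<close>; it is replaced by Young's
inequality with a free scale \<open>t\<close>, which is then optimised and loses a factor 2.\<close>

lemma muckenhoupt_average_bound:
  fixes w :: "real ^ 'n \<Rightarrow> real"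
  assumes w: "w \<in> muckenhoupt \<rho> \<theta> p" and p: "1 \<le> p" and \<rho>: "\<And>x. \<rho> x > 0"
  shows "\<exists>C>0. \<forall>x0. \<forall>r>0. \<forall>g. g \<in> borel_measurable lebesgue \<longrightarrow> (\<forall>x. 0 \<le> g x) \<longrightarrow>
    emean (\<lambda>x. ennreal (g x)) (ball x0 r) \<le> ennreal (C * (1 + r / \<rho> x0) powr \<theta>)
      * epowr ((\<integral>\<^sup>+x\<in>ball x0 r. ennreal (g x powr p * w x) \<partial>lebesgue) / weight_of w (ball x0 r)) (1 / p)"
proof -
  have iw: "is_weight w" using w by (simp add: muckenhoupt_def)
  note [measurable] = weight_measurable[OF iw]
  have w0: "\<And>x. 0 \<le> w x" using iw by (simp add: is_weight_def)
  have wpos: "AE x in lebesgue. 0 < w x" by (rule muckenhoupt_AE_pos[OF w p])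
  obtain C where C: "C > 0" and
     Ap: "\<And>x0 r. r > 0 \<Longrightarrow> if p = 1 then
          emean (\<lambda>x. ennreal (w x)) (ball x0 r)
            \<le> ennreal (C * (1 + r / \<rho> x0) powr \<theta>)
              * essinf (lebesgue_on (ball x0 r)) (\<lambda>x. ennreal (w x))
        else
          epowr (emean (\<lambda>x. ennreal (w x)) (ball x0 r)) (1 / p)
            * epowr (emean (\<lambda>x. epowr (ennreal (w x)) (- conjugate_exponent p / p)) (ball x0 r))
                (1 / conjugate_exponent p)
            \<le> ennreal (C * (1 + r / \<rho> x0) powr \<theta>)"
    using w unfolding muckenhoupt_def by blast
  have main: "emean (\<lambda>x. ennreal (g x)) B \<le> ennreal (2 * K) * epowr (I / weight_of w B) (1 / p)"
    if r: "r > 0" and gm[measurable]: "g \<in> borel_measurable lebesgue" and g0: "\<And>x. 0 \<le> g x"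
      and B_def: "B = ball x0 r" and I_def: "I = (\<integral>\<^sup>+x\<in>B. ennreal (g x powr p * w x) \<partial>lebesgue)"
      and K_def: "K = C * (1 + r / \<rho> x0) powr \<theta>"
    for x0 r g B I K
  proof -
    have Bm[measurable]: "B \<in> sets lebesgue" by (simp add: B_def)
    define m where "m = measure lebesgue B"
    have m: "emeasure lebesgue B = ennreal m" "m > 0"
      unfolding m_def B_def using r by (auto simp: emeasure_ball_eq measure_ball_pos)
    have "1 + r / \<rho> x0 > 0" using \<rho>[of x0] r by (simp add: add_pos_pos)
    then have K: "K > 0" unfolding K_def using C by simp
    obtain b where b: "weight_of w B = ennreal b" "b > 0"
    proof -
      have "weight_of w B < \<infinity>" by (rule weight_of_finite[OF iw]) (auto simp: B_def)
      moreover have "weight_of w B > 0" using m Bm by (intro weight_of_pos[OF iw wpos]) (simp_all only: ennreal_less_zero_iff)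
      ultimately show thesis using that by (cases "weight_of w B") auto
    qed
    define J where "J = (\<integral>\<^sup>+x\<in>B. ennreal (g x) \<partial>lebesgue)"
    have emw: "emean (\<lambda>x. ennreal (w x)) B = ennreal (b / m)"
      unfolding emean_def weight_of_def[symmetric] m b using m b by (simp add: divide_ennreal)
    have emg: "emean (\<lambda>x. ennreal (g x)) B = J / ennreal m"
      unfolding emean_def J_def m ..
    have Bnull: "\<not> (AE x in lebesgue. x \<notin> B)"
      using m Bm by (simp add: AE_iff_null_sets[symmetric] null_sets_def)
    show ?thesis
    proof (cases I)
      case top
      then have "I / weight_of w B = \<infinity>" by (simp add: b ennreal_top_divide)
      then have "ennreal (2*K) * epowr (I / weight_of w B) (1/p) = \<infinity>"
        using K p epowr_top[of "1/p"] by (simp add: ennreal_mult_top)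
      then show ?thesis by simp
    next
      case (real i)
      have ib: "epowr (I / weight_of w B) (1 / p) = ennreal ((i / b) powr (1/p))"
        using real b p by (simp add: divide_ennreal epowr_ennreal)
      show ?thesis
      proof (cases "p = 1")
        case True
        define c where "c = essinf (lebesgue_on B) (\<lambda>x. ennreal (w x))"
        have "ennreal (b / m) \<le> ennreal K * c"
          using Ap[OF r, of x0] True unfolding emw[symmetric] c_def K_def B_def by simp
        have "AE x in lebesgue_on B. c \<le> ennreal (w x)" unfolding c_def by (rule essinf_AE)
        then have cw: "AE x in lebesgue. x \<in> B \<longrightarrow> c \<le> ennreal (w x)"
          by (simp add: AE_restrict_space_iff)
        have "c \<noteq> \<infinity>"
        proof
          assume "c = \<infinity>"
          then have "AE x in lebesgue. x \<notin> B" using cw by (auto elim!: eventually_mono simp: top_unique)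
          then show False using Bnull by simp
        qed
        then obtain c' where c': "c = ennreal c'" "c' \<ge> 0" by (cases c) auto
        have bc: "b / m \<le> K * c'"
          using \<open>ennreal (b / m) \<le> ennreal K * c\<close> c' K by (simp add: ennreal_mult[symmetric] ennreal_le_iff)
        have c'pos: "c' > 0"
        proof (rule ccontr)
          assume "\<not> c' > 0"
          then have "c' = 0" using c' by simp
          then show False using bc b m by (simp add: divide_le_0_iff)
        qed
        have "ennreal c' * J = (\<integral>\<^sup>+x. ennreal c' * (ennreal (g x) * indicator B x) \<partial>lebesgue)"
          unfolding J_def by (simp add: nn_integral_cmult)
        also have "\<dots> \<le> I"
          unfolding I_def
        proof (intro nn_integral_mono_AE)
          show "AE x in lebesgue. ennreal c' * (ennreal (g x) * indicator B x) \<le> ennreal (g x powr p * w x) * indicator B x"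
            using cw
          proof eventually_elim
            case (elim x)
            then show ?case
              using True g0[of x] w0[of x] c'
              by (auto simp: indicator_def ennreal_mult[symmetric] ennreal_le_iff mult.commute[of c'] intro!: ennreal_leI mult_left_mono)
          qed
        qed
        finally have cJ: "ennreal c' * J \<le> ennreal i" using real by simp
        then have "J \<noteq> \<infinity>" using c'pos by (auto simp: ennreal_mult_top top_unique)
        then obtain j where j: "J = ennreal j" "j \<ge> 0" by (cases J) auto
        have cj: "c' * j \<le> i" using cJ j real c' by (simp add: ennreal_mult[symmetric] ennreal_le_iff)
        have "j / m \<le> 2 * K * (i / b)"
        proof -
          have "b * j \<le> (m * K * c') * j" using bc m j by (intro mult_right_mono) (auto simp: field_simps)
          also have "\<dots> = m * K * (c' * j)" by simp
          also have "\<dots> \<le> m * K * i" using cj m K by (intro mult_left_mono) auto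
          also have "\<dots> \<le> 2 * (m * K * i)" using m K real by simp
          finally show ?thesis using m b by (simp add: field_simps)
        qed
        then show ?thesis unfolding emg ib using True j m K real b
          by (simp add: divide_ennreal ennreal_mult[symmetric] ennreal_leI)
      next
        case False
        then have p1: "p > 1" using p by simp
        define p' where "p' = conjugate_exponent p"
        have p': "p' > 1" "1/p + 1/p' = 1" "p + p' = p * p'"
          unfolding p'_def conjugate_exponent_def using p1 by (auto simp: field_simps)
        define \<sigma> where "\<sigma> = (\<lambda>x. epowr (ennreal (w x)) (- p' / p))"
        have \<sigma>m[measurable]: "\<sigma> \<in> borel_measurable lebesgue"
          unfolding \<sigma>_def epowr_def by measurable
        have \<sigma>eq: "\<sigma> x = ennreal (w x powr (- p' / p))" if "w x > 0" for x
          unfolding \<sigma>_def using that by (simp add: epowr_ennreal_pos)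
        define S where "S = (\<integral>\<^sup>+x\<in>B. \<sigma> x \<partial>lebesgue)"
        have le: "ennreal ((b/m) powr (1/p)) * epowr (S / ennreal m) (1 / p') \<le> ennreal K"
        proof -
          have "epowr (ennreal (b/m)) (1/p) * epowr (S / ennreal m) (1 / p') \<le> ennreal K"
            using Ap[OF r, of x0] False
            unfolding emw[symmetric] K_def B_def[symmetric] S_def p'_def[symmetric] \<sigma>_def emean_def m by simp
          then show ?thesis using b m p1 by (simp add: epowr_ennreal)
        qed
        have "S \<noteq> \<infinity>"
        proof
          assume "S = \<infinity>"
          then have "S / ennreal m = \<infinity>" by (simp add: ennreal_top_divide)
          then have "ennreal ((b/m) powr (1/p)) * \<infinity> \<le> ennreal K" using le epowr_top[of "1/p'"] p' by simp
          then show False using b m by (simp add: ennreal_mult_top top_unique)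
        qed
        then obtain s where s: "S = ennreal s" "s \<ge> 0" by (cases S) auto
        have spos: "s > 0"
        proof (rule ccontr)
          assume "\<not> s > 0"
          then have "S = 0" using s by simp
          then have "AE x in lebesgue. \<sigma> x * indicator B x = 0"
            unfolding S_def by (subst (asm) nn_integral_0_iff_AE) auto
          then have "AE x in lebesgue. x \<notin> B"
            using wpos by eventually_elim (auto simp: \<sigma>eq indicator_def split: if_splits)
          then show False using Bnull by simp
        qed
        have lek: "(b/m) powr (1/p) * (s/m) powr (1/p') \<le> K"
          using le s m p' K b by (simp add: divide_ennreal epowr_ennreal ennreal_mult[symmetric] ennreal_le_iff)
        have young: "J \<le> ennreal (t powr p * i + t powr (- p') * s)" if t: "t > 0" for t
        proof -
          have "J \<le> (\<integral>\<^sup>+x. (ennreal (t powr p) * (ennreal (g x powr p * w x) * indicator B x)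
                    + ennreal (t powr (- p')) * (\<sigma> x * indicator B x)) \<partial>lebesgue)"
            unfolding J_def
          proof (intro nn_integral_mono_AE)
            show "AE x in lebesgue. ennreal (g x) * indicator B x \<le>
               ennreal (t powr p) * (ennreal (g x powr p * w x) * indicator B x)
                    + ennreal (t powr (- p')) * (\<sigma> x * indicator B x)"
              using wpos
            proof eventually_elim
              case (elim x)
              have "g x = (t * g x * w x powr (1/p)) * (w x powr (-1/p) / t)"
                using elim t by (simp add: powr_minus field_simps)
              also have "\<dots> \<le> (t * g x * w x powr (1/p)) powr p / p + (w x powr (-1/p) / t) powr p' / p'"
                using elim t g0[of x] p1 p' by (intro Youngs_inequality) auto
              also have "\<dots> \<le> (t * g x * w x powr (1/p)) powr p + (w x powr (-1/p) / t) powr p'"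
                using p1 p' by (intro add_mono) (auto simp: divide_le_eq mult_le_cancel_left1)
              also have "(t * g x * w x powr (1/p)) powr p = t powr p * (g x powr p * w x)"
                using t g0[of x] elim p1 by (simp add: powr_mult powr_powr)
              also have "(w x powr (-1/p) / t) powr p' = t powr (- p') * w x powr (- p' / p)"
                using t by (simp add: powr_divide powr_mult powr_powr powr_minus_divide)
              finally show ?case
                using elim t g0[of x] w0[of x] by (auto simp: \<sigma>eq indicator_def ennreal_mult'[symmetric] ennreal_plus[symmetric] simp del: ennreal_plus intro!: ennreal_leI)
            qed
          qed
          also have "\<dots> = ennreal (t powr p) * I + ennreal (t powr (- p')) * S"
            unfolding I_def S_def by (subst nn_integral_add, measurable, subst (1 2) nn_integral_cmult) auto
          also have "\<dots> = ennreal (t powr p * i + t powr (- p') * s)"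
            using real s by (simp add: ennreal_mult)
          finally show ?thesis .
        qed
        have "J \<le> ennreal (2 * i powr (1/p) * s powr (1/p'))"
        proof (cases "i = 0")
          case True
          then have "(\<integral>\<^sup>+x\<in>B. ennreal (g x powr p * w x) \<partial>lebesgue) = 0"
            using real unfolding I_def by simp
          then have "AE x in lebesgue. ennreal (g x powr p * w x) * indicator B x = 0"
            by (subst (asm) nn_integral_0_iff_AE) auto
          then have "AE x in lebesgue. ennreal (g x) * indicator B x = 0"
            using wpos by eventually_elim (use g0 in \<open>auto simp: indicator_def split: if_splits\<close>)
          then have "J = 0" unfolding J_def by (subst nn_integral_0_iff_AE) auto
          then show ?thesis by simp
        next
          case False
          then have i: "i > 0" using real by simp
          \<comment> \<open>The scale at which both terms of \<open>young\<close> are equal, as \<open>p + p' = p * p'\<close>.\<close>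
          define t where "t = (s / i) powr (1 / (p * p'))"
          have t: "t > 0" unfolding t_def using i spos by simp
          have "t powr p * i = (s / i) powr (1/p') * i" unfolding t_def using p1 by (simp add: powr_powr)
          also have "\<dots> = s powr (1/p') * (i powr (- (1/p')) * i powr 1)" using i spos by (simp add: powr_divide powr_minus_divide)
          also have "i powr (- (1/p')) * i powr 1 = i powr (1/p)"
          proof -
            have "- (1/p') + 1 = 1/p" using p'(2) by linarith
            then show ?thesis unfolding powr_add[symmetric] by simp
          qed
          finally have 1: "t powr p * i = i powr (1/p) * s powr (1/p')" by simp
          have "t powr (- p') * s = (s / i) powr (- (1/p)) * s" unfolding t_def using p' by (simp add: powr_powr)
          also have "\<dots> = i powr (1/p) * (s powr (- (1/p)) * s powr 1)" using i spos by (simp add: powr_divide powr_minus_divide)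
          also have "s powr (- (1/p)) * s powr 1 = s powr (1/p')"
          proof -
            have "- (1/p) + 1 = 1/p'" using p'(2) by linarith
            then show ?thesis unfolding powr_add[symmetric] by simp
          qed
          finally have 2: "t powr (- p') * s = i powr (1/p) * s powr (1/p')" .
          show ?thesis using young[OF t] unfolding 1 2 by (simp add: mult_ac)
        qed
        then have "J / ennreal m \<le> ennreal (2 * i powr (1/p) * s powr (1/p')) / ennreal m"
          by (rule divide_right_mono_ennreal)
        also have "\<dots> = ennreal (2 * i powr (1/p) * s powr (1/p') / m)"
          using m by (simp add: divide_ennreal)
        also have "2 * i powr (1/p) * s powr (1/p') / m
            = 2 * (i/b) powr (1/p) * ((b/m) powr (1/p) * (s/m) powr (1/p'))"
        proof -
          have "m = m powr (1/p) * m powr (1/p')" using m p'(2) by (simp add: powr_add[symmetric])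
          then show ?thesis using m b spos real by (simp add: powr_divide field_simps)
        qed
        also have "ennreal \<dots> \<le> ennreal (2 * (i/b) powr (1/p) * K)"
          using lek by (intro ennreal_leI mult_left_mono) auto
        also have "\<dots> = ennreal (2 * K) * ennreal ((i/b) powr (1/p))"
          using K by (simp add: ennreal_mult[symmetric] mult_ac)
        finally show ?thesis unfolding emg ib .
      qed
    qed
  qed
  show ?thesis
  proof (intro exI[of _ "2 * C"] conjI allI impI)
    show "2 * C > 0" using C by simp
    fix x0 and r :: real and g :: "real^'n \<Rightarrow> real"
    assume "r > 0" "g \<in> borel_measurable lebesgue" "\<forall>x. 0 \<le> g x"
    then show "emean (\<lambda>x. ennreal (g x)) (ball x0 r) \<le> ennreal (2 * C * (1 + r / \<rho> x0) powr \<theta>)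
      * epowr ((\<integral>\<^sup>+x\<in>ball x0 r. ennreal (g x powr p * w x) \<partial>lebesgue) / weight_of w (ball x0 r)) (1 / p)"
      using main[of r g "ball x0 r" x0] by (simp add: mult.assoc)
  qed
qed

section \<open>Dyadic cubes and averages\<close>

text \<open>Half-open cubes, given by their lower corner, because their dyadic children partition them exactly.\<close>

definition hcube :: "real ^ 'n \<Rightarrow> real \<Rightarrow> (real ^ 'n) set" where
  "hcube a h = {y. \<forall>i. a $ i \<le> y $ i \<and> y $ i < a $ i + h}"

text \<open>Lower corner of a dyadic child; \<open>e\<close> marks the coordinates in which the upper half is taken.\<close>

definition child :: "real ^ 'n \<Rightarrow> real \<Rightarrow> ('n \<Rightarrow> bool) \<Rightarrow> real ^ 'n" where
  "child a h e = (\<chi> i. a $ i + (if e i then h / 2 else 0))"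

abbreviation subcube :: "real ^ 'n \<Rightarrow> real \<Rightarrow> ('n \<Rightarrow> bool) \<Rightarrow> (real ^ 'n) set" where
  "subcube a h e \<equiv> hcube (child a h e) (h / 2)"

definition child_index :: "real ^ 'n \<Rightarrow> real \<Rightarrow> real ^ 'n \<Rightarrow> ('n \<Rightarrow> bool)" where
  "child_index a h x = (\<lambda>i. a $ i + h / 2 \<le> x $ i)"

lemma hcube_borel [measurable]: "hcube a h \<in> sets borel"
proof -
  have "hcube a h = (\<Inter>i. {y. a $ i \<le> y $ i} \<inter> {y. y $ i < a $ i + h})"
    by (auto simp: hcube_def)
  also have "\<dots> \<in> sets borel"
    by (intro sets.finite_INT sets.Int) (auto intro!: borel_closed borel_open closed_Collect_le open_Collect_less continuous_intros)
  finally show ?thesis .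
qed

lemma hcube_lebesgue [measurable, simp]: "hcube a h \<in> sets lebesgue"
  using hcube_borel[of a h] by (simp add: sets_completionI_sets)

lemma hcube_sandwich:
  "box a (\<chi> i. a $ i + h) \<subseteq> hcube a h" "hcube a h \<subseteq> cbox a (\<chi> i. a $ i + h)"
  by (auto simp: hcube_def mem_box_cart less_imp_le)

lemma hcube_bounded [simp]: "bounded (hcube a h)"
  using bounded_cbox bounded_subset hcube_sandwich(2) by blast

lemma emeasure_hcube:
  fixes a :: "real ^ 'n" assumes "h > 0"
  shows "emeasure lebesgue (hcube a h) = ennreal (h ^ CARD('n))"
proof (rule antisym)
  have c: "measure lborel (cbox a (\<chi> i. a $ i + h)) = h ^ CARD('n)"
    using assms by (subst content_cbox_cart) (auto simp: interval_ne_empty_cart)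
  have e: "emeasure lborel (cbox a (\<chi> i. a $ i + h)) = ennreal (h ^ CARD('n))"
    unfolding c[symmetric] by (rule emeasure_eq_ennreal_measure) (use emeasure_lborel_cbox_finite[of a "\<chi> i. a $ i + h"] in auto)
  have "emeasure lebesgue (hcube a h) \<le> emeasure lebesgue (cbox a (\<chi> i. a $ i + h))"
    by (intro emeasure_mono hcube_sandwich) auto
  then show "emeasure lebesgue (hcube a h) \<le> ennreal (h ^ CARD('n))" using e by (simp add: emeasure_completion)
  have "emeasure lebesgue (box a (\<chi> i. a $ i + h)) \<le> emeasure lebesgue (hcube a h)"
    by (intro emeasure_mono hcube_sandwich) auto
  moreover have "emeasure lborel (box a (\<chi> i. a $ i + h)) = emeasure lborel (cbox a (\<chi> i. a $ i + h))"
    by (simp add: emeasure_lborel_box_eq emeasure_lborel_cbox_eq)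
  ultimately show "ennreal (h ^ CARD('n)) \<le> emeasure lebesgue (hcube a h)" using e by (simp add: emeasure_completion)
qed

lemma measure_hcube: 
  fixes a :: "real ^ 'n" assumes "h > 0"
  shows "measure lebesgue (hcube a h) = h ^ CARD('n)"
  using emeasure_hcube[OF assms, of a] assms by (simp add: measure_def)

lemma hcube_lmeasurable [simp]: "hcube a h \<in> lmeasurable"
  by (intro bounded_set_imp_lmeasurable) auto

lemma hcube_child_index:
  assumes "x \<in> subcube a h e"
  shows "child_index a h x = e"
proof
  fix i
  show "child_index a h x i = e i"
    using assms by (cases "e i") (force simp: hcube_def child_def child_index_def dest: spec[of _ i])+
qed

lemma in_hcube_child_index:
  assumes "x \<in> hcube a h" shows "x \<in> hcube (child a h (child_index a h x)) (h / 2)"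
  using assms unfolding hcube_def child_def child_index_def
  by (auto simp: algebra_simps not_le dest: spec)

lemma hcube_child_subset:
  assumes "h > 0" shows "subcube a h e \<subseteq> hcube a h"
proof
  fix x assume x: "x \<in> subcube a h e"
  have "a $ i \<le> x $ i \<and> x $ i < a $ i + h" for i
    using x[unfolded hcube_def child_def] assms by (cases "e i") (auto dest!: spec[of _ i])
  then show "x \<in> hcube a h" by (simp add: hcube_def)
qed

lemma in_hcube_child_iff:
  assumes "h > 0"
  shows "x \<in> subcube a h e \<longleftrightarrow> x \<in> hcube a h \<and> e = child_index a h x"
  using hcube_child_index in_hcube_child_index hcube_child_subset[OF assms] by blast

lemma indicator_hcube_children:
  assumes "h > 0"
  shows "(indicator (hcube a h) x :: 'b::semiring_1) = (\<Sum>e\<in>UNIV. indicator (subcube a h e) x)"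
proof -
  have "(\<Sum>e\<in>UNIV. indicator (subcube a h e) x :: 'b)
     = (\<Sum>e\<in>UNIV. if e = child_index a h x then indicator (hcube a h) x else 0)"
    by (intro sum.cong) (auto simp: indicator_def in_hcube_child_iff[OF assms])
  then show ?thesis by simp
qed

lemma nn_integral_children:
  assumes "h > 0" "E \<subseteq> hcube a h" "E \<in> sets lebesgue" "g \<in> borel_measurable lebesgue"
  shows "(\<integral>\<^sup>+x\<in>E. g x \<partial>lebesgue) = (\<Sum>e\<in>UNIV. \<integral>\<^sup>+x\<in>E \<inter> subcube a h e. g x \<partial>lebesgue)"
proof -
  note [measurable] = assms(3,4)
  have "(\<integral>\<^sup>+x\<in>E. g x \<partial>lebesgue) = (\<integral>\<^sup>+x. (\<Sum>e\<in>UNIV. g x * indicator (E \<inter> subcube a h e) x) \<partial>lebesgue)"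
  proof (intro nn_integral_cong)
    fix x
    have "(indicator E x :: ennreal) = indicator E x * indicator (hcube a h) x"
      using assms(2) by (auto simp: indicator_def)
    also have "\<dots> = (\<Sum>e\<in>UNIV. indicator (E \<inter> subcube a h e) x)"
      unfolding indicator_hcube_children[OF assms(1), of a x] by (simp add: sum_distrib_left indicator_inter_arith)
    finally show "g x * indicator E x = (\<Sum>e\<in>UNIV. g x * indicator (E \<inter> subcube a h e) x)"
      by (simp add: sum_distrib_left)
  qed
  also have "\<dots> = (\<Sum>e\<in>UNIV. \<integral>\<^sup>+x\<in>E \<inter> subcube a h e. g x \<partial>lebesgue)"
    by (rule nn_integral_sum) auto
  finally show ?thesis .
qed

text \<open>The value at \<open>x\<close> of the conditional expectation of \<open>f\<close> on the \<open>k\<close>-th dyadic generation inside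
\<open>hcube a h\<close>.  The recursion runs from the large cube to its children, so that an induction on \<open>k\<close>
has its hypothesis available on every child.\<close>

fun dyadic_avg :: "(real ^ 'n \<Rightarrow> real) \<Rightarrow> nat \<Rightarrow> real ^ 'n \<Rightarrow> real \<Rightarrow> real ^ 'n \<Rightarrow> real" where
  "dyadic_avg f 0 a h x = mean f (hcube a h)"
| "dyadic_avg f (Suc k) a h x = dyadic_avg f k (child a h (child_index a h x)) (h / 2) x"

lemma child_index_measurable:
  "{x. child_index a h x = e} \<in> sets (borel :: (real^'n) measure)"
proof -
  have "{x. child_index a h x = e} = (\<Inter>i. {x. (a $ i + h / 2 \<le> x $ i) = e i})"
    by (auto simp: child_index_def fun_eq_iff)
  also have "\<dots> \<in> sets borel"
  proof (intro sets.finite_INT)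
    fix i
    have "{x :: real^'n. a $ i + h / 2 \<le> x $ i} \<in> sets borel"
      by (auto intro!: borel_closed closed_Collect_le continuous_intros)
    moreover have "{x :: real^'n. \<not> a $ i + h / 2 \<le> x $ i} \<in> sets borel"
      unfolding not_le by (auto intro!: borel_open open_Collect_less continuous_intros)
    ultimately show "{x. (a $ i + h / 2 \<le> x $ i) = e i} \<in> sets borel" by (cases "e i") auto
  qed auto
  finally show ?thesis .
qed

lemma dyadic_avg_borel: "dyadic_avg f k a h \<in> borel_measurable borel"
proof (induction k arbitrary: a h)
  case 0 then show ?case by (simp add: measurable_def)
next
  case (Suc k)
  have "dyadic_avg f (Suc k) a h x =
     (\<Sum>e\<in>UNIV. dyadic_avg f k (child a h e) (h / 2) x * indicator {x. child_index a h x = e} x)" for x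
    by (simp add: indicator_def)
  moreover have "(\<lambda>x. \<Sum>e\<in>UNIV. dyadic_avg f k (child a h e) (h / 2) x * indicator {x. child_index a h x = e} x)
     \<in> borel_measurable borel"
    using Suc child_index_measurable by (intro borel_measurable_sum borel_measurable_times borel_measurable_indicator) auto
  ultimately show ?case by (metis (no_types, lifting) ext)
qed

lemma dyadic_avg_measurable [measurable]: "dyadic_avg f k a h \<in> borel_measurable lebesgue"
  using dyadic_avg_borel[of f k a h] by (simp add: measurable_completion)

lemma dyadic_avg_child:
  assumes "x \<in> subcube a h e"
  shows "dyadic_avg f (Suc k) a h x = dyadic_avg f k (child a h e) (h / 2) x"
  using hcube_child_index[OF assms] by simp

lemma locally_integrable_diff_const:
  fixes f :: "real ^ 'n \<Rightarrow> real"
  assumes "locally_integrable f" "bounded E" "E \<in> sets lebesgue"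
  shows "set_integrable lebesgue E (\<lambda>x. f x - c)" "set_integrable lebesgue E (\<lambda>x. \<bar>f x - c\<bar>)"
proof -
  have "E \<in> lmeasurable" using assms by (intro bounded_set_imp_lmeasurable)
  then have "set_integrable lebesgue E (\<lambda>x. c)"
    by (auto simp: set_integrable_def fmeasurable_def)
  then show i: "set_integrable lebesgue E (\<lambda>x. f x - c)"
    by (intro set_integral_diff(1) locally_integrable_on_bounded[OF assms])
  show "set_integrable lebesgue E (\<lambda>x. \<bar>f x - c\<bar>)"
    using set_integrable_abs[OF i] .
qed

lemma abs_mean_diff_le:
  fixes f :: "real ^ 'n \<Rightarrow> real"
  assumes f: "locally_integrable f" and B: "bounded B" "B \<in> sets lebesgue"
    and E: "E \<subseteq> B" "E \<in> sets lebesgue" "measure lebesgue E > 0"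
  shows "\<bar>mean f E - c\<bar> \<le> (LINT x:B|lebesgue. \<bar>f x - c\<bar>) / measure lebesgue E"
proof -
  have bE: "bounded E" using B(1) E(1) by (rule bounded_subset)
  have Em: "E \<in> lmeasurable" using bE E by (intro bounded_set_imp_lmeasurable)
  have ic: "set_integrable lebesgue E (\<lambda>x. c)" using Em by (auto simp: set_integrable_def fmeasurable_def)
  have "(LINT x:E|lebesgue. f x - c) = (LINT x:E|lebesgue. f x) - c * measure lebesgue E"
    using set_integral_diff(2)[OF locally_integrable_on_bounded[OF f bE E(2)] ic] Em
    by (simp add: set_lebesgue_integral_def fmeasurable_def mult.commute)
  then have "mean f E - c = (LINT x:E|lebesgue. f x - c) / measure lebesgue E"
    using E(3) by (simp add: mean_def field_simps)
  then have "\<bar>mean f E - c\<bar> = \<bar>LINT x:E|lebesgue. f x - c\<bar> / measure lebesgue E"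
    by (simp add: abs_divide)
  also have "\<dots> \<le> (LINT x:B|lebesgue. \<bar>f x - c\<bar>) / measure lebesgue E"
  proof (rule divide_right_mono)
    have "\<bar>LINT x:E|lebesgue. f x - c\<bar> \<le> (LINT x:E|lebesgue. \<bar>f x - c\<bar>)"
      using set_integral_norm_bound[OF locally_integrable_diff_const(1)[OF f bE E(2)], of c] by simp
    also have "\<dots> \<le> (LINT x:B|lebesgue. \<bar>f x - c\<bar>)"
      using locally_integrable_diff_const(2)[OF f bE E(2), of c] locally_integrable_diff_const(2)[OF f B, of c] E(1)
      unfolding set_lebesgue_integral_def set_integrable_def
      by (intro integral_mono) (auto simp: indicator_def)
    finally show "\<bar>LINT x:E|lebesgue. f x - c\<bar> \<le> (LINT x:B|lebesgue. \<bar>f x - c\<bar>)" .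
  qed simp
  finally show ?thesis .
qed

section \<open>Exponential integrability of dyadic averages\<close>

text \<open>\<open>P\<close> singles out a family of cubes closed under passing to children, in the application the
cubes of side at most \<open>r\<close> inside a given cube of side \<open>r\<close>.  The assumption \<open>small\<close> is the quantitative \<open>A\<^sub>\<infinity>\<close> property of the weight.\<close>

locale dyadic_oscillation =
  fixes f w :: "real ^ 'n \<Rightarrow> real" and P :: "real ^ 'n \<Rightarrow> real \<Rightarrow> bool" and A \<kappa> :: real
  assumes f: "locally_integrable f" and w: "is_weight w"
    and P_pos: "P a h \<Longrightarrow> 0 < h" and P_child: "P a h \<Longrightarrow> P (child a h e) (h / 2)"
    and A: "0 < A" and \<kappa>: "0 < \<kappa>" "\<kappa> \<le> 1"
    and osc: "P a h \<Longrightarrow> (LINT x:hcube a h|lebesgue. \<bar>f x - mean f (hcube a h)\<bar>) \<le> A * h ^ CARD('n)"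
    and small: "P a h \<Longrightarrow> E \<in> sets lebesgue \<Longrightarrow> E \<subseteq> hcube a h \<Longrightarrow> measure lebesgue E \<le> h ^ CARD('n) / 2
        \<Longrightarrow> weight_of w E \<le> ennreal (1 - \<kappa>) * weight_of w (hcube a h)"
begin

text \<open>\<open>jump\<close> bounds the difference of the averages over a cube and over a child, which has \<open>2 ^ d\<close> times
less volume.  A cube at which the averages first deviate by more than \<open>2 * A\<close> thus has deviation at most
\<open>2 * A + jump\<close>, and \<open>\<eta>\<close> is chosen to make the exponential of that deviation equal to
\<open>exp (\<kappa> / 2)\<close>.  The set \<open>stopped\<close> is the union of these cubes up to generation \<open>k\<close>.\<close>

definition "jump = 2 ^ CARD('n) * A"
definition "\<eta> = \<kappa> / (2 * (2 * A + jump))"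
definition "expint k a h c =
  (\<integral>\<^sup>+x\<in>hcube a h. ennreal (exp (\<eta> * \<bar>dyadic_avg f k a h x - c\<bar>)) * ennreal (w x) \<partial>lebesgue)"
definition "stopped k a h c = {x \<in> hcube a h. \<exists>j\<le>k. 2 * A < \<bar>dyadic_avg f j a h x - c\<bar>}"

lemma w_measurable [measurable]: "w \<in> borel_measurable lebesgue"
  by (rule weight_measurable[OF w])

lemma jump: "jump > 0" unfolding jump_def using A by simp

lemma \<eta>: "\<eta> > 0" "\<eta> * (2 * A + jump) = \<kappa> / 2" "\<eta> * (2 * A) \<le> 1"
proof -
  show "\<eta> > 0" unfolding \<eta>_def using jump A \<kappa> by simp
  show e: "\<eta> * (2 * A + jump) = \<kappa> / 2" unfolding \<eta>_def using jump A by (simp add: field_simps add_pos_pos less_imp_neq[symmetric])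
  have "\<eta> * (2 * A) \<le> \<eta> * (2 * A + jump)" using jump \<open>\<eta> > 0\<close> by (intro mult_left_mono) auto
  then show "\<eta> * (2 * A) \<le> 1" using e \<kappa> by simp
qed

lemma mean_child_diff:
  assumes "P a h"
  shows "\<bar>mean f (subcube a h e) - mean f (hcube a h)\<bar> \<le> jump"
proof -
  have h: "h > 0" using assms by (rule P_pos)
  have "\<bar>mean f (subcube a h e) - mean f (hcube a h)\<bar>
     \<le> (LINT x:hcube a h|lebesgue. \<bar>f x - mean f (hcube a h)\<bar>) / measure lebesgue (subcube a h e)"
    using h hcube_child_subset[OF h] by (intro abs_mean_diff_le[OF f]) (auto simp: measure_hcube)
  also have "\<dots> \<le> A * h ^ CARD('n) / (h / 2) ^ CARD('n)"
    using osc[OF assms] h by (subst measure_hcube) (auto intro: divide_right_mono)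
  also have "\<dots> = jump" using h by (simp add: jump_def power_divide)
  finally show ?thesis .
qed

lemma stopped_measurable [measurable]: "stopped k a h c \<in> sets lebesgue"
proof -
  have "stopped k a h c = hcube a h \<inter> (\<Union>j\<in>{..k}. {x \<in> space lebesgue. 2 * A < \<bar>dyadic_avg f j a h x - c\<bar>})"
    by (auto simp: stopped_def)
  also have "\<dots> \<in> sets lebesgue" by measurable
  finally show ?thesis .
qed

lemma stopped_subset: "stopped k a h c \<subseteq> hcube a h"
  by (auto simp: stopped_def)

lemma stopped_top:
  assumes "2 * A < \<bar>mean f (hcube a h) - c\<bar>"
  shows "stopped k a h c = hcube a h"
  using assms by (auto simp: stopped_def intro!: exI[of _ 0])

lemma stopped_children:
  assumes "\<not> 2 * A < \<bar>mean f (hcube a h) - c\<bar>" "h > 0"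
  shows "stopped (Suc k) a h c \<inter> subcube a h e = stopped k (child a h e) (h / 2) c"
proof -
  have "(\<exists>j\<le>Suc k. 2 * A < \<bar>dyadic_avg f j a h x - c\<bar>)
     \<longleftrightarrow> (\<exists>j\<le>k. 2 * A < \<bar>dyadic_avg f j (child a h e) (h / 2) x - c\<bar>)"
    if x: "x \<in> subcube a h e" for x
  proof
    assume "\<exists>j\<le>Suc k. 2 * A < \<bar>dyadic_avg f j a h x - c\<bar>"
    then obtain j where j: "j \<le> Suc k" "2 * A < \<bar>dyadic_avg f j a h x - c\<bar>" by blast
    then obtain i where "j = Suc i" using assms(1) by (cases j) auto
    then show "\<exists>j\<le>k. 2 * A < \<bar>dyadic_avg f j (child a h e) (h / 2) x - c\<bar>"
      using j dyadic_avg_child[OF x, of f i] by auto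
  next
    assume "\<exists>j\<le>k. 2 * A < \<bar>dyadic_avg f j (child a h e) (h / 2) x - c\<bar>"
    then obtain j where "j \<le> k" "2 * A < \<bar>dyadic_avg f (Suc j) a h x - c\<bar>"
      using dyadic_avg_child[OF x, of f] by auto
    then show "\<exists>j\<le>Suc k. 2 * A < \<bar>dyadic_avg f j a h x - c\<bar>" by (intro exI[of _ "Suc j"]) auto
  qed
  then show ?thesis
    using hcube_child_subset[OF assms(2), of a e] unfolding stopped_def by blast
qed

lemma weight_of_children:
  assumes "h > 0" "E \<subseteq> hcube a h" "E \<in> sets lebesgue"
  shows "weight_of w E = (\<Sum>e\<in>UNIV. weight_of w (E \<inter> subcube a h e))"
  unfolding weight_of_def by (rule nn_integral_children[OF assms]) simp

lemma expint_children:
  assumes "h > 0"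
  shows "expint (Suc k) a h c = (\<Sum>e\<in>UNIV. expint k (child a h e) (h / 2) c)"
proof -
  have "expint (Suc k) a h c = (\<Sum>e\<in>UNIV. \<integral>\<^sup>+x\<in>hcube a h \<inter> subcube a h e.
      ennreal (exp (\<eta> * \<bar>dyadic_avg f (Suc k) a h x - c\<bar>)) * ennreal (w x) \<partial>lebesgue)"
    unfolding expint_def by (rule nn_integral_children[OF assms]) (auto simp del: dyadic_avg.simps)
  also have "\<dots> = (\<Sum>e\<in>UNIV. expint k (child a h e) (h / 2) c)"
  proof (intro sum.cong refl)
    fix e
    have "hcube a h \<inter> subcube a h e = subcube a h e"
      using hcube_child_subset[OF assms] by blast
    then show "(\<integral>\<^sup>+x\<in>hcube a h \<inter> subcube a h e.
      ennreal (exp (\<eta> * \<bar>dyadic_avg f (Suc k) a h x - c\<bar>)) * ennreal (w x) \<partial>lebesgue) = expint k (child a h e) (h / 2) c"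
      unfolding expint_def
      by (simp only:, intro nn_integral_cong) (auto simp: indicator_def dyadic_avg_child simp del: dyadic_avg.simps)
  qed
  finally show ?thesis .
qed

lemma expint_change_centre:
  "expint k a h c \<le> ennreal (exp (\<eta> * \<bar>c' - c\<bar>)) * expint k a h c'"
proof -
  have "expint k a h c \<le> (\<integral>\<^sup>+x. ennreal (exp (\<eta> * \<bar>c' - c\<bar>)) *
     (ennreal (exp (\<eta> * \<bar>dyadic_avg f k a h x - c'\<bar>)) * ennreal (w x) * indicator (hcube a h) x) \<partial>lebesgue)"
    unfolding expint_def
  proof (intro nn_integral_mono)
    fix x
    have "exp (\<eta> * \<bar>dyadic_avg f k a h x - c\<bar>) \<le> exp (\<eta> * (\<bar>c' - c\<bar> + \<bar>dyadic_avg f k a h x - c'\<bar>))"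
      unfolding exp_le_cancel_iff using \<eta>(1) by (intro mult_left_mono) auto
    also have "\<dots> = exp (\<eta> * \<bar>c' - c\<bar>) * exp (\<eta> * \<bar>dyadic_avg f k a h x - c'\<bar>)"
      by (simp add: exp_add[symmetric] algebra_simps)
    finally have "ennreal (exp (\<eta> * \<bar>dyadic_avg f k a h x - c\<bar>))
       \<le> ennreal (exp (\<eta> * \<bar>c' - c\<bar>)) * ennreal (exp (\<eta> * \<bar>dyadic_avg f k a h x - c'\<bar>))"
      by (simp add: ennreal_mult[symmetric] ennreal_leI)
    then have "ennreal (exp (\<eta> * \<bar>dyadic_avg f k a h x - c\<bar>)) * (ennreal (w x) * indicator (hcube a h) x)
       \<le> ennreal (exp (\<eta> * \<bar>c' - c\<bar>)) * ennreal (exp (\<eta> * \<bar>dyadic_avg f k a h x - c'\<bar>)) * (ennreal (w x) * indicator (hcube a h) x)"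
      by (rule mult_right_mono) simp
    then show "ennreal (exp (\<eta> * \<bar>dyadic_avg f k a h x - c\<bar>)) * ennreal (w x) * indicator (hcube a h) x
       \<le> ennreal (exp (\<eta> * \<bar>c' - c\<bar>)) *
     (ennreal (exp (\<eta> * \<bar>dyadic_avg f k a h x - c'\<bar>)) * ennreal (w x) * indicator (hcube a h) x)"
      by (simp add: mult.assoc)
  qed
  also have "\<dots> = ennreal (exp (\<eta> * \<bar>c' - c\<bar>)) * expint k a h c'"
    unfolding expint_def by (rule nn_integral_cmult) simp
  finally show ?thesis .
qed

lemma expint_zero:
  "expint 0 a h c = ennreal (exp (\<eta> * \<bar>mean f (hcube a h) - c\<bar>)) * weight_of w (hcube a h)"
  unfolding expint_def weight_of_def by (simp add: mult.assoc nn_integral_cmult)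

lemma expint_stopped_top:
  assumes "2 * A < \<bar>mean f (hcube a h) - c\<bar>" "\<bar>mean f (hcube a h) - c\<bar> \<le> 2 * A + jump" "M \<ge> 0"
    and "expint k a h (mean f (hcube a h)) \<le> ennreal M * weight_of w (hcube a h)"
  shows "expint k a h c \<le> ennreal (exp 1) * weight_of w (hcube a h)
      + ennreal (exp (\<kappa> / 2) * M) * weight_of w (stopped k a h c)"
proof -
  have "\<eta> * \<bar>mean f (hcube a h) - c\<bar> \<le> \<kappa> / 2"
    unfolding \<eta>(2)[symmetric] using assms(2) \<eta>(1) by (intro mult_left_mono) auto
  then have e: "ennreal (exp (\<eta> * \<bar>mean f (hcube a h) - c\<bar>)) \<le> ennreal (exp (\<kappa> / 2))"
    by (intro ennreal_leI) simp
  have "expint k a h c \<le> ennreal (exp (\<eta> * \<bar>mean f (hcube a h) - c\<bar>)) * expint k a h (mean f (hcube a h))"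
    by (rule expint_change_centre)
  also have "\<dots> \<le> ennreal (exp (\<kappa> / 2)) * (ennreal M * weight_of w (hcube a h))"
    by (rule mult_mono[OF e assms(4)]) auto
  also have "\<dots> = ennreal (exp (\<kappa> / 2) * M) * weight_of w (stopped k a h c)"
    using assms(3) unfolding stopped_top[OF assms(1)] by (simp add: ennreal_mult mult.assoc)
  finally show ?thesis by (simp add: add_increasing)
qed

text \<open>On the unstopped part the deviation from \<open>c\<close> is at most \<open>2 * A\<close>, which gives the first term.  On a
stopped cube the centre \<open>c\<close> is exchanged for the average of that cube at the price
\<open>exp (\<kappa> / 2)\<close>, and the bound \<open>M\<close> for the remaining generations applies.  The cube \<open>hcube a h\<close> itself
may be stopped; then the bound is needed for the same \<open>k\<close>, which is the purpose of \<open>top\<close>.\<close>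

lemma expint_stopping:
  assumes "P a h" "\<bar>mean f (hcube a h) - c\<bar> \<le> 2 * A + jump" and M: "M \<ge> 0"
    and IH: "\<And>j a h. j < k \<Longrightarrow> P a h \<Longrightarrow> expint j a h (mean f (hcube a h)) \<le> ennreal M * weight_of w (hcube a h)"
    and top: "2 * A < \<bar>mean f (hcube a h) - c\<bar>
      \<Longrightarrow> expint k a h (mean f (hcube a h)) \<le> ennreal M * weight_of w (hcube a h)"
  shows "expint k a h c \<le> ennreal (exp 1) * weight_of w (hcube a h)
      + ennreal (exp (\<kappa> / 2) * M) * weight_of w (stopped k a h c)"
  using assms
proof (induction k arbitrary: a h)
  case (0 a h)
  show ?case
  proof (cases "2 * A < \<bar>mean f (hcube a h) - c\<bar>")
    case True
    then show ?thesis using 0 by (intro expint_stopped_top) auto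
  next
    case False
    then have "\<eta> * \<bar>mean f (hcube a h) - c\<bar> \<le> \<eta> * (2 * A)" using \<eta>(1) by (intro mult_left_mono) auto
    then have "exp (\<eta> * \<bar>mean f (hcube a h) - c\<bar>) \<le> exp 1" using \<eta>(3) by simp
    then have "expint 0 a h c \<le> ennreal (exp 1) * weight_of w (hcube a h)"
      unfolding expint_zero by (intro mult_right_mono ennreal_leI) auto
    then show ?thesis by (simp add: add_increasing2)
  qed
next
  case (Suc k a h)
  have h: "h > 0" using Suc.prems by (auto intro: P_pos)
  show ?case
  proof (cases "2 * A < \<bar>mean f (hcube a h) - c\<bar>")
    case True
    then show ?thesis using Suc.prems(2,3,5) by (intro expint_stopped_top) auto
  next
    case False
    have sub: "hcube a h \<inter> subcube a h e = subcube a h e" for e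
      using hcube_child_subset[OF h] by blast
    have "expint (Suc k) a h c = (\<Sum>e\<in>UNIV. expint k (child a h e) (h / 2) c)" by (rule expint_children[OF h])
    also have "\<dots> \<le> (\<Sum>e\<in>UNIV. ennreal (exp 1) * weight_of w (subcube a h e)
      + ennreal (exp (\<kappa> / 2) * M) * weight_of w (stopped k (child a h e) (h / 2) c))"
    proof (intro sum_mono Suc.IH P_child Suc.prems)
      fix e
      show "\<bar>mean f (subcube a h e) - c\<bar> \<le> 2 * A + jump"
        using mean_child_diff[OF Suc.prems(1), of e] False by linarith
    qed auto
    also have "\<dots> = ennreal (exp 1) * (\<Sum>e\<in>UNIV. weight_of w (hcube a h \<inter> subcube a h e))
      + ennreal (exp (\<kappa> / 2) * M) * (\<Sum>e\<in>UNIV. weight_of w (stopped (Suc k) a h c \<inter> subcube a h e))"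
      unfolding stopped_children[OF False h] sub by (simp add: sum.distrib sum_distrib_left)
    also have "\<dots> = ennreal (exp 1) * weight_of w (hcube a h)
      + ennreal (exp (\<kappa> / 2) * M) * weight_of w (stopped (Suc k) a h c)"
      using weight_of_children[OF h order_refl hcube_lebesgue, of a] weight_of_children[OF h stopped_subset stopped_measurable]
      by simp
    finally show ?thesis .
  qed
qed

text \<open>On each maximal stopped cube the average of \<open>\<bar>f - c\<bar>\<close> exceeds \<open>2 * A\<close>, and these cubes are disjoint.\<close>

lemma measure_stopped:
  assumes "h > 0"
  shows "ennreal (2 * A) * emeasure lebesgue (stopped k a h c) \<le> (\<integral>\<^sup>+x\<in>stopped k a h c. ennreal \<bar>f x - c\<bar> \<partial>lebesgue)"
proof -
  note [measurable] = locally_integrable_measurable[OF f]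
  have top: "ennreal (2 * A) * emeasure lebesgue (hcube a h) \<le> (\<integral>\<^sup>+x\<in>hcube a h. ennreal \<bar>f x - c\<bar> \<partial>lebesgue)"
    if "2 * A < \<bar>mean f (hcube a h) - c\<bar>" "h > 0" for a h
  proof -
    have "2 * A \<le> (LINT x:hcube a h|lebesgue. \<bar>f x - c\<bar>) / h ^ CARD('n)"
      using abs_mean_diff_le[OF f, of "hcube a h" "hcube a h" c] that by (auto simp: measure_hcube)
    then have "2 * A * h ^ CARD('n) \<le> (LINT x:hcube a h|lebesgue. \<bar>f x - c\<bar>)"
      using that by (simp add: field_simps)
    then show ?thesis
      using A that nn_set_integral_eq_LINT[OF locally_integrable_diff_const(2)[OF f, of "hcube a h" c]]
      by (simp add: emeasure_hcube ennreal_mult[symmetric] ennreal_leI)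
  qed
  show ?thesis using assms
  proof (induction k arbitrary: a h)
    case (0 a h)
    show ?case
    proof (cases "2 * A < \<bar>mean f (hcube a h) - c\<bar>")
      case True then show ?thesis using top[OF True 0] by (simp only: stopped_top)
    next
      case False
      then have "stopped 0 a h c = {}" by (simp add: stopped_def)
      then show ?thesis by simp
    qed
  next
    case (Suc k a h)
    show ?case
    proof (cases "2 * A < \<bar>mean f (hcube a h) - c\<bar>")
      case True then show ?thesis using top[OF True Suc.prems] by (simp only: stopped_top)
    next
      case False
      have ch: "(\<integral>\<^sup>+x\<in>stopped (Suc k) a h c. g x \<partial>lebesgue)
          = (\<Sum>e\<in>UNIV. \<integral>\<^sup>+x\<in>stopped k (child a h e) (h / 2) c. g x \<partial>lebesgue)"
        if "g \<in> borel_measurable lebesgue" for g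
        using nn_integral_children[OF Suc.prems stopped_subset[of "Suc k" a h c] stopped_measurable that]
        unfolding stopped_children[OF False Suc.prems] .
      have "emeasure lebesgue (stopped (Suc k) a h c) = (\<Sum>e\<in>UNIV. emeasure lebesgue (stopped k (child a h e) (h / 2) c))"
        using ch[of "\<lambda>x. 1"] by simp
      then have "ennreal (2 * A) * emeasure lebesgue (stopped (Suc k) a h c)
         = (\<Sum>e\<in>UNIV. ennreal (2 * A) * emeasure lebesgue (stopped k (child a h e) (h / 2) c))"
        by (simp add: sum_distrib_left)
      also have "\<dots> \<le> (\<Sum>e\<in>UNIV. \<integral>\<^sup>+x\<in>stopped k (child a h e) (h / 2) c. ennreal \<bar>f x - c\<bar> \<partial>lebesgue)"
        using Suc by (intro sum_mono Suc.IH) auto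
      also have "\<dots> = (\<integral>\<^sup>+x\<in>stopped (Suc k) a h c. ennreal \<bar>f x - c\<bar> \<partial>lebesgue)"
        by (rule ch[symmetric]) simp
      finally show ?thesis .
    qed
  qed
qed

text \<open>The integral of \<open>\<bar>f - c\<bar>\<close> over the whole cube is at most \<open>A\<close> times its volume when \<open>c\<close> is the
average, so by Chebyshev's inequality the stopped set fills at most half of the cube.\<close>

lemma weight_of_stopped:
  assumes "P a h"
  shows "weight_of w (stopped k a h (mean f (hcube a h))) \<le> ennreal (1 - \<kappa>) * weight_of w (hcube a h)"
proof (rule small[OF assms stopped_measurable stopped_subset])
  define E where "E = stopped k a h (mean f (hcube a h))"
  have h: "h > 0" using assms by (rule P_pos)
  have Em: "E \<in> lmeasurable" unfolding E_def
    using bounded_subset[OF hcube_bounded stopped_subset] by (intro bounded_set_imp_lmeasurable) auto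
  have "ennreal (2 * A) * emeasure lebesgue E \<le> (\<integral>\<^sup>+x\<in>E. ennreal \<bar>f x - mean f (hcube a h)\<bar> \<partial>lebesgue)"
    unfolding E_def by (rule measure_stopped[OF h])
  also have "\<dots> \<le> (\<integral>\<^sup>+x\<in>hcube a h. ennreal \<bar>f x - mean f (hcube a h)\<bar> \<partial>lebesgue)"
    using stopped_subset[of k a h "mean f (hcube a h)"] unfolding E_def
    by (intro nn_integral_mono) (auto simp: indicator_def)
  also have "\<dots> = ennreal (LINT x:hcube a h|lebesgue. \<bar>f x - mean f (hcube a h)\<bar>)"
    by (intro nn_set_integral_eq_LINT locally_integrable_diff_const[OF f]) auto
  also have "\<dots> \<le> ennreal (A * h ^ CARD('n))" using osc[OF assms] by (rule ennreal_leI)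
  finally have "2 * A * measure lebesgue E \<le> A * h ^ CARD('n)"
    using A h Em by (simp add: emeasure_eq_measure2 ennreal_mult[symmetric] ennreal_le_iff)
  then show "measure lebesgue (stopped k a h (mean f (hcube a h))) \<le> h ^ CARD('n) / 2"
    using A unfolding E_def[symmetric] by simp
qed

lemma exp_contraction: "(1 - \<kappa>) * exp (\<kappa> / 2) \<le> 1 - \<kappa> / 2"
proof -
  have "1 - \<kappa> / 2 \<le> exp (- \<kappa> / 2)" using exp_ge_add_one_self[of "- \<kappa> / 2"] by simp
  then have "(1 - \<kappa> / 2) * exp (\<kappa> / 2) \<le> exp (- \<kappa> / 2) * exp (\<kappa> / 2)" by (intro mult_right_mono) auto
  then have 1: "(1 - \<kappa> / 2) * exp (\<kappa> / 2) \<le> 1" by (simp add: exp_add[symmetric])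
  have "(1 - \<kappa>) * exp (\<kappa> / 2) \<le> ((1 - \<kappa> / 2) * (1 - \<kappa> / 2)) * exp (\<kappa> / 2)"
    by (intro mult_right_mono) (auto simp: field_simps)
  also have "\<dots> = (1 - \<kappa> / 2) * ((1 - \<kappa> / 2) * exp (\<kappa> / 2))" by simp
  also have "\<dots> \<le> (1 - \<kappa> / 2) * 1" using 1 \<kappa> by (intro mult_left_mono) auto
  finally show ?thesis by simp
qed

text \<open>The recursion reads \<open>X \<le> exp 1 + exp (\<kappa> / 2) * (1 - \<kappa>) * M\<close>, and the factor of \<open>M\<close> is at most
\<open>1 - \<kappa> / 2\<close>; thus \<open>M = 2 * exp 1 / \<kappa>\<close> reproduces itself.\<close>

lemma expint_bound:
  assumes "P a h"
  shows "expint k a h (mean f (hcube a h)) \<le> ennreal (2 * exp 1 / \<kappa>) * weight_of w (hcube a h)"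
  using assms
proof (induction k arbitrary: a h rule: less_induct)
  case (less k a h)
  define M where "M = 2 * exp 1 / \<kappa>"
  have M: "M \<ge> 0" unfolding M_def using \<kappa> by simp
  define c where "c = mean f (hcube a h)"
  have "expint k a h c \<le> ennreal (exp 1) * weight_of w (hcube a h)
      + ennreal (exp (\<kappa> / 2) * M) * weight_of w (stopped k a h c)"
    using A jump less M unfolding c_def M_def by (intro expint_stopping) auto
  also have "\<dots> \<le> ennreal (exp 1) * weight_of w (hcube a h)
      + ennreal (exp (\<kappa> / 2) * M) * (ennreal (1 - \<kappa>) * weight_of w (hcube a h))"
      unfolding c_def by (intro add_left_mono mult_left_mono weight_of_stopped less.prems) auto
  also have "\<dots> = ennreal (exp 1 + exp (\<kappa> / 2) * M * (1 - \<kappa>)) * weight_of w (hcube a h)"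
      using M \<kappa> by (simp add: ennreal_mult distrib_right mult.assoc)
  also have "\<dots> \<le> ennreal M * weight_of w (hcube a h)"
    proof (intro mult_right_mono ennreal_leI)
      have "exp (\<kappa> / 2) * M * (1 - \<kappa>) = M * ((1 - \<kappa>) * exp (\<kappa> / 2))" by simp
    also have "\<dots> \<le> M * (1 - \<kappa> / 2)" using exp_contraction M by (intro mult_left_mono) auto
    also have "\<dots> = M - exp 1" unfolding M_def using \<kappa> by (simp add: field_simps)
      finally show "exp 1 + exp (\<kappa> / 2) * M * (1 - \<kappa>) \<le> M" by simp
    qed simp
  finally show ?case unfolding M_def c_def .
qed

end

section \<open>Convergence of dyadic averages\<close>

abbreviation L1_dist :: "(real ^ 'n) set \<Rightarrow> (real ^ 'n \<Rightarrow> real) \<Rightarrow> (real ^ 'n \<Rightarrow> real) \<Rightarrow> ennreal" where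
  "L1_dist E f g \<equiv> \<integral>\<^sup>+x\<in>E. ennreal \<bar>f x - g x\<bar> \<partial>lebesgue"

lemma continuous_locally_integrable:
  fixes g :: "real ^ 'n \<Rightarrow> real"
  assumes "continuous_on UNIV g" shows "locally_integrable g"
  unfolding locally_integrable_def
proof (intro allI impI)
  fix K :: "(real^'n) set" assume "compact K"
  then have "integrable lborel (\<lambda>x. indicator K x *\<^sub>R g x)"
    using borel_integrable_compact[of K g] continuous_on_subset[OF assms] by simp
  then show "set_integrable lebesgue K g"
    unfolding set_integrable_def by (simp add: integrable_completion borel_measurable_integrable)
qed

lemma L1_approximation_if_dominated:
  fixes f :: "real ^ 'n \<Rightarrow> real" and u :: "nat \<Rightarrow> real ^ 'n \<Rightarrow> real"
  assumes f: "f \<in> borel_measurable lebesgue" and u: "\<And>n. u n \<in> borel_measurable lebesgue"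
    and w: "w \<in> borel_measurable lebesgue" and E: "E \<in> sets lebesgue" and e: "\<epsilon> > 0"
    and le: "\<And>n x. ennreal \<bar>f x - u n x\<bar> \<le> w x" and fin: "(\<integral>\<^sup>+x\<in>E. w x \<partial>lebesgue) < \<infinity>"
    and lim: "AE x in lebesgue. (\<lambda>n. u n x) \<longlonglongrightarrow> f x"
  shows "\<exists>n. L1_dist E f (u n) < ennreal \<epsilon>"
proof -
  note [measurable] = f u w E
  have "(\<lambda>n. L1_dist E f (u n)) \<longlonglongrightarrow> (\<integral>\<^sup>+x. 0 \<partial>(lebesgue :: (real^'n) measure))"
  proof (rule nn_integral_dominated_convergence[where w = "\<lambda>x. w x * indicator E x"])
    show "AE x in lebesgue. ennreal \<bar>f x - u j x\<bar> * indicator E x \<le> w x * indicator E x" for j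
      by (intro AE_I2 mult_right_mono le) simp
    show "AE x in lebesgue. (\<lambda>i. ennreal \<bar>f x - u i x\<bar> * indicator E x) \<longlonglongrightarrow> 0"
      using lim
    proof eventually_elim
      case (elim x)
      have "(\<lambda>i. \<bar>f x - u i x\<bar> * indicator E x) \<longlonglongrightarrow> \<bar>f x - f x\<bar> * indicator E x"
        by (intro tendsto_intros elim)
      then have "(\<lambda>i. ennreal (\<bar>f x - u i x\<bar> * indicator E x)) \<longlonglongrightarrow> ennreal (\<bar>f x - f x\<bar> * indicator E x)"
        by (rule tendsto_ennrealI)
      moreover have "ennreal (\<bar>f x - u i x\<bar> * indicator E x) = ennreal \<bar>f x - u i x\<bar> * indicator E x" for i
        by (simp add: indicator_def)
      ultimately show ?case by simp
    qed
  qed (use fin in auto)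
  then have "\<forall>\<^sub>F n in sequentially. L1_dist E f (u n) < ennreal \<epsilon>"
    using e by (intro order_tendstoD(2)[where y = 0]) auto
  then show ?thesis by (meson eventually_sequentially order_refl)
qed

text \<open>First truncate \<open>f\<close>, then use that the truncation is an almost everywhere limit of continuous functions;
both steps are instances of dominated convergence.\<close>

lemma continuous_approximation:
  fixes f :: "real ^ 'n \<Rightarrow> real"
  assumes f: "locally_integrable f" and E: "bounded E" "E \<in> sets lebesgue" and e: "\<epsilon> > 0"
  shows "\<exists>g. continuous_on UNIV g \<and> L1_dist E f g < ennreal \<epsilon>"
proof -
  have fm[measurable]: "f \<in> borel_measurable lebesgue" by (rule locally_integrable_measurable[OF f])
  note [measurable] = E(2)
  have El: "E \<in> lmeasurable" by (rule bounded_set_imp_lmeasurable[OF E])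
  define T where "T = (\<lambda>n y. max (- real n) (min (real n) y))"
  have T: "\<bar>T n y\<bar> \<le> real n" for n y by (auto simp: T_def)
  have Tm: "(\<lambda>x. T n (f x)) \<in> borel_measurable lebesgue" for n unfolding T_def by measurable
  have "\<exists>n. L1_dist E f (\<lambda>x. T n (f x)) < ennreal (\<epsilon> / 2)"
  proof (rule L1_approximation_if_dominated[where w = "\<lambda>x. ennreal \<bar>f x\<bar>"])
    show "(\<integral>\<^sup>+x\<in>E. ennreal \<bar>f x\<bar> \<partial>lebesgue) < \<infinity>"
      using nn_set_integral_eq_LINT[OF set_integrable_abs[OF locally_integrable_on_bounded[OF f E]]] by simp
    show "ennreal \<bar>f x - T n (f x)\<bar> \<le> ennreal \<bar>f x\<bar>" for n x
      by (intro ennreal_leI) (auto simp: T_def)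
    show "AE x in lebesgue. (\<lambda>n. T n (f x)) \<longlonglongrightarrow> f x"
    proof (intro AE_I2 tendsto_eventually)
      fix x
      obtain N where N: "\<bar>f x\<bar> < real N" using reals_Archimedean2 by blast
      show "\<forall>\<^sub>F n in sequentially. T n (f x) = f x"
        using eventually_ge_at_top[of N] by eventually_elim (use N in \<open>auto simp: T_def\<close>)
    qed
  qed (use e Tm in auto)
  then obtain n where 1: "L1_dist E f (\<lambda>x. T n (f x)) < ennreal (\<epsilon> / 2)" by blast
  obtain N g where N: "negligible N" and g: "\<And>k. continuous_on UNIV (g k)"
    and lim: "\<And>x. x \<notin> N \<Longrightarrow> (\<lambda>k. g k x) \<longlonglongrightarrow> T n (f x)"
    using lebesgue_measurable_imp_measurable_on[OF Tm, of UNIV n] unfolding measurable_on_def by auto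
  \<comment> \<open>Clipping the approximants at the height of the truncation makes them uniformly bounded.\<close>
  have Gc: "continuous_on UNIV (\<lambda>x. T n (g k x))" for k unfolding T_def by (intro continuous_intros g)
  have Gm: "(\<lambda>x. T n (g k x)) \<in> borel_measurable lebesgue" for k
    using locally_integrable_measurable[OF continuous_locally_integrable[OF Gc]] .
  have "\<exists>k. L1_dist E (\<lambda>x. T n (f x)) (\<lambda>x. T n (g k x)) < ennreal (\<epsilon> / 2)"
  proof (rule L1_approximation_if_dominated[where w = "\<lambda>x. ennreal (2 * real n)"])
    show "(\<integral>\<^sup>+x\<in>E. ennreal (2 * real n) \<partial>lebesgue) < \<infinity>"
      using El by (simp add: nn_integral_cmult_indicator ennreal_mult_less_top fmeasurable_def)
    show "ennreal \<bar>T n (f x) - T n (g k x)\<bar> \<le> ennreal (2 * real n)" for k x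
      using T[of n "f x"] T[of n "g k x"] by (intro ennreal_leI) linarith
    have "AE x in lebesgue. x \<notin> N" using N by (simp add: negligible_iff_null_sets AE_not_in)
    then show "AE x in lebesgue. (\<lambda>k. T n (g k x)) \<longlonglongrightarrow> T n (f x)"
    proof eventually_elim
      case (elim x)
      have "(\<lambda>k. T n (g k x)) \<longlonglongrightarrow> T n (T n (f x))"
        unfolding T_def by (intro tendsto_intros lim[unfolded T_def] elim)
      also have "T n (T n (f x)) = T n (f x)" by (auto simp: T_def)
      finally show ?case .
    qed
  qed (use e Tm Gm in auto)
  then obtain k where 2: "L1_dist E (\<lambda>x. T n (f x)) (\<lambda>x. T n (g k x)) < ennreal (\<epsilon> / 2)" by blast
  note [measurable] = Tm Gm
  have "L1_dist E f (\<lambda>x. T n (g k x))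
     \<le> (\<integral>\<^sup>+x. (ennreal \<bar>f x - T n (f x)\<bar> * indicator E x + ennreal \<bar>T n (f x) - T n (g k x)\<bar> * indicator E x) \<partial>lebesgue)"
    by (intro nn_integral_mono) (auto simp: indicator_def ennreal_plus[symmetric] simp del: ennreal_plus intro!: ennreal_leI)
  also have "\<dots> = L1_dist E f (\<lambda>x. T n (f x)) + L1_dist E (\<lambda>x. T n (f x)) (\<lambda>x. T n (g k x))"
    by (rule nn_integral_add) auto
  also have "\<dots> < ennreal (\<epsilon> / 2) + ennreal (\<epsilon> / 2)" by (rule add_strict_mono[OF 1 2])
  also have "\<dots> = ennreal \<epsilon>" using e by (simp add: ennreal_plus[symmetric] del: ennreal_plus)
  finally show ?thesis using Gc by blast
qed

text \<open>Averaging does not increase the \<open>L\<^sup>1\<close> norm on a single cube, and the cubes of a generation add up.\<close>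

lemma dyadic_avg_contraction:
  fixes f g :: "real ^ 'n \<Rightarrow> real"
  assumes f: "locally_integrable f" and g: "locally_integrable g" and h: "h > 0"
  shows "L1_dist (hcube a h) (dyadic_avg f k a h) (dyadic_avg g k a h)
    \<le> L1_dist (hcube a h) f g"
  using h
proof (induction k arbitrary: a h)
  case (0 a h)
  have i: "set_integrable lebesgue (hcube a h) f" "set_integrable lebesgue (hcube a h) g"
    by (intro locally_integrable_on_bounded f g; simp)+
  have "mean f (hcube a h) - mean g (hcube a h) = (LINT x:hcube a h|lebesgue. f x - g x) / measure lebesgue (hcube a h)"
    using set_integral_diff(2)[OF i] by (simp add: mean_def diff_divide_distrib)
  then have "\<bar>mean f (hcube a h) - mean g (hcube a h)\<bar> = \<bar>LINT x:hcube a h|lebesgue. f x - g x\<bar> / h ^ CARD('n)"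
    using 0 by (simp add: abs_divide measure_hcube)
  also have "\<dots> \<le> (LINT x:hcube a h|lebesgue. \<bar>f x - g x\<bar>) / h ^ CARD('n)"
    using 0 set_integral_norm_bound[OF set_integral_diff(1)[OF i]] by (intro divide_right_mono) auto
  finally have "\<bar>mean f (hcube a h) - mean g (hcube a h)\<bar> * h ^ CARD('n) \<le> (LINT x:hcube a h|lebesgue. \<bar>f x - g x\<bar>)"
    using 0 by (simp add: field_simps)
  then show ?case
    using 0 nn_set_integral_eq_LINT[OF set_integrable_abs[OF set_integral_diff(1)[OF i]]]
    by (simp add: nn_integral_cmult_indicator emeasure_hcube ennreal_mult[symmetric] ennreal_leI)
next
  case (Suc k a h)
  note [measurable] = locally_integrable_measurable[OF f] locally_integrable_measurable[OF g]
  have sub: "hcube a h \<inter> subcube a h e = subcube a h e" for e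
    using hcube_child_subset[OF Suc.prems] by blast
  have "L1_dist (hcube a h) (dyadic_avg f (Suc k) a h) (dyadic_avg g (Suc k) a h)
    = (\<Sum>e\<in>UNIV. \<integral>\<^sup>+x\<in>subcube a h e. ennreal \<bar>dyadic_avg f (Suc k) a h x - dyadic_avg g (Suc k) a h x\<bar> \<partial>lebesgue)"
    by (subst nn_integral_children[OF Suc.prems order_refl hcube_lebesgue, of _ a])
      (auto simp: sub simp del: dyadic_avg.simps)
  also have "\<dots> = (\<Sum>e\<in>UNIV. \<integral>\<^sup>+x\<in>subcube a h e. ennreal \<bar>dyadic_avg f k (child a h e) (h / 2) x - dyadic_avg g k (child a h e) (h / 2) x\<bar> \<partial>lebesgue)"
    by (intro sum.cong nn_integral_cong refl) (auto simp: indicator_def dyadic_avg_child simp del: dyadic_avg.simps)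
  also have "\<dots> \<le> (\<Sum>e\<in>UNIV. \<integral>\<^sup>+x\<in>subcube a h e. ennreal \<bar>f x - g x\<bar> \<partial>lebesgue)"
    using Suc.prems by (intro sum_mono Suc.IH) auto
  also have "\<dots> = L1_dist (hcube a h) f g"
    by (subst nn_integral_children[OF Suc.prems order_refl hcube_lebesgue, of _ a]) (auto simp: sub)
  finally show ?case .
qed

text \<open>The average at \<open>x\<close> only involves values of \<open>g\<close> on the dyadic cube of side \<open>h / 2 ^ k\<close> around
\<open>x\<close>.\<close>

lemma dyadic_avg_near:
  fixes g :: "real ^ 'n \<Rightarrow> real"
  assumes g: "locally_integrable g" and x: "x \<in> hcube a h" and h: "h > 0"
    and near: "\<And>y. y \<in> hcube a h \<Longrightarrow> (\<forall>i. \<bar>y $ i - x $ i\<bar> \<le> h / 2 ^ k) \<Longrightarrow> \<bar>g y - g x\<bar> \<le> \<epsilon>"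
  shows "\<bar>dyadic_avg g k a h x - g x\<bar> \<le> \<epsilon>"
  using x h near
proof (induction k arbitrary: a h)
  case (0 a h)
  have b: "\<bar>g y - g x\<bar> \<le> \<epsilon>" if y: "y \<in> hcube a h" for y
  proof (rule 0(3)[OF y], intro allI)
    fix i
    have "a $ i \<le> x $ i" "x $ i < a $ i + h" "a $ i \<le> y $ i" "y $ i < a $ i + h"
      using y 0(1) by (auto simp: hcube_def)
    then show "\<bar>y $ i - x $ i\<bar> \<le> h / 2 ^ 0" by simp
  qed
  have ic: "set_integrable lebesgue (hcube a h) (\<lambda>x. \<epsilon>)"
    using hcube_lmeasurable[of a h] by (auto simp: set_integrable_def fmeasurable_def)
  have "\<bar>mean g (hcube a h) - g x\<bar> \<le> (LINT y:hcube a h|lebesgue. \<bar>g y - g x\<bar>) / measure lebesgue (hcube a h)"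
    using 0 by (intro abs_mean_diff_le[OF g]) (auto simp: measure_hcube)
  also have "\<dots> \<le> (LINT y:hcube a h|lebesgue. \<epsilon>) / measure lebesgue (hcube a h)"
    using b ic by (intro divide_right_mono set_integral_mono locally_integrable_diff_const[OF g]) auto
  also have "\<dots> = \<epsilon>"
    using 0(2) hcube_lmeasurable[of a h] by (simp add: set_lebesgue_integral_def measure_hcube fmeasurable_def)
  finally show ?case by simp
next
  case (Suc k a h)
  define e where "e = child_index a h x"
  have xe: "x \<in> subcube a h e" unfolding e_def using Suc.prems by (intro in_hcube_child_index)
  have "\<bar>dyadic_avg g k (child a h e) (h / 2) x - g x\<bar> \<le> \<epsilon>"
  proof (rule Suc.IH[OF xe])
    show "h / 2 > 0" using Suc.prems by simp
    fix y assume "y \<in> subcube a h e" "\<forall>i. \<bar>y $ i - x $ i\<bar> \<le> h / 2 / 2 ^ k"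
    then show "\<bar>g y - g x\<bar> \<le> \<epsilon>"
      using hcube_child_subset[OF Suc.prems(2)] by (intro Suc.prems(3)) auto
  qed
  then show ?case by (simp add: e_def)
qed

lemma dyadic_avg_L1_error:
  fixes f g :: "real ^ 'n \<Rightarrow> real"
  assumes f: "locally_integrable f" and g: "locally_integrable g" and h: "h > 0"
  shows "L1_dist (hcube a h) (dyadic_avg f k a h) f
    \<le> 2 * L1_dist (hcube a h) f g
       + L1_dist (hcube a h) (dyadic_avg g k a h) g"
proof -
  note [measurable] = locally_integrable_measurable[OF f] locally_integrable_measurable[OF g]
  let ?I = "indicator (hcube a h) :: _ \<Rightarrow> ennreal"
  have "L1_dist (hcube a h) (dyadic_avg f k a h) f
    \<le> (\<integral>\<^sup>+x. (ennreal \<bar>dyadic_avg f k a h x - dyadic_avg g k a h x\<bar> * ?I x + ennreal \<bar>f x - g x\<bar> * ?I x)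
        + ennreal \<bar>dyadic_avg g k a h x - g x\<bar> * ?I x \<partial>lebesgue)"
    by (intro nn_integral_mono) (auto simp: indicator_def ennreal_plus[symmetric] simp del: ennreal_plus intro!: ennreal_leI)
  also have "\<dots> = (L1_dist (hcube a h) (dyadic_avg f k a h) (dyadic_avg g k a h)
     + L1_dist (hcube a h) f g)
     + L1_dist (hcube a h) (dyadic_avg g k a h) g"
    by (simp add: nn_integral_add)
  also have "\<dots> \<le> (L1_dist (hcube a h) f g + L1_dist (hcube a h) f g)
     + L1_dist (hcube a h) (dyadic_avg g k a h) g"
    by (intro add_right_mono dyadic_avg_contraction f g h)
  finally show ?thesis by (simp add: mult_2)
qed

lemma dyadic_avg_uniform_limit:
  fixes g :: "real ^ 'n \<Rightarrow> real"
  assumes g: "continuous_on UNIV g" and h: "h > 0" and e: "\<epsilon> > 0"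
  shows "\<forall>\<^sub>F k in sequentially. \<forall>x\<in>hcube a h. \<bar>dyadic_avg g k a h x - g x\<bar> \<le> \<epsilon>"
proof -
  define K where "K = cbox a (\<chi> i. a $ i + h)"
  have "uniformly_continuous_on K g"
    unfolding K_def by (intro compact_uniformly_continuous continuous_on_subset[OF g]) auto
  then obtain \<delta> where \<delta>: "\<delta> > 0" "\<And>x y. x \<in> K \<Longrightarrow> y \<in> K \<Longrightarrow> dist y x < \<delta> \<Longrightarrow> dist (g y) (g x) < \<epsilon>"
    using e unfolding uniformly_continuous_on_def by metis
  have "(\<lambda>k. real CARD('n) * h * (1 / 2) ^ k) \<longlonglongrightarrow> real CARD('n) * h * 0"
    by (intro tendsto_intros LIMSEQ_realpow_zero) auto
  then have "\<forall>\<^sub>F k in sequentially. real CARD('n) * h * (1 / 2) ^ k < \<delta>"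
    using \<delta>(1) by (intro order_tendstoD(2)) auto
  then show ?thesis
  proof eventually_elim
    case (elim k)
    show ?case
    proof
      fix x assume x: "x \<in> hcube a h"
      show "\<bar>dyadic_avg g k a h x - g x\<bar> \<le> \<epsilon>"
      proof (rule dyadic_avg_near[OF continuous_locally_integrable[OF g] x h])
        fix y assume y: "y \<in> hcube a h" "\<forall>i. \<bar>y $ i - x $ i\<bar> \<le> h / 2 ^ k"
        have "dist y x \<le> (\<Sum>i\<in>UNIV. \<bar>(y - x) $ i\<bar>)" unfolding dist_norm by (rule norm_le_l1_cart)
        also have "\<dots> \<le> (\<Sum>i\<in>(UNIV::'n set). h / 2 ^ k)" using y(2) by (intro sum_mono) auto
        also have "\<dots> = real CARD('n) * h * (1 / 2) ^ k" by (simp add: power_one_over)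
        also have "\<dots> < \<delta>" by (rule elim)
        finally have "dist (g y) (g x) < \<epsilon>"
          using x y hcube_sandwich(2)[of a h] unfolding K_def by (intro \<delta>(2)[unfolded K_def]) auto
        then show "\<bar>g y - g x\<bar> \<le> \<epsilon>" by (simp add: dist_real_def)
      qed
    qed
  qed
qed

text \<open>The averages converge in \<open>L\<^sup>1\<close>: uniformly for a continuous function, and in general by approximation,
since averaging is a contraction.  A subsequence then converges almost everywhere, which is all that
Fatou's lemma and pointwise limits of inequalities require.\<close>

lemma dyadic_avg_AE_subseq:
  fixes f :: "real ^ 'n \<Rightarrow> real"
  assumes f: "locally_integrable f" and h: "h > 0"
  shows "\<exists>r :: nat \<Rightarrow> nat. strict_mono r \<and>
     (AE x in lebesgue. x \<in> hcube a h \<longrightarrow> (\<lambda>n. dyadic_avg f (r n) a h x) \<longlonglongrightarrow> f x)"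
proof -
  note [measurable] = locally_integrable_measurable[OF f]
  define u where "u = (\<lambda>k x. indicator (hcube a h) x *\<^sub>R (dyadic_avg f k a h x - f x))"
  define I where "I = (\<lambda>k. \<integral>\<^sup>+x\<in>hcube a h. ennreal \<bar>dyadic_avg f k a h x - f x\<bar> \<partial>lebesgue)"
  have I_eq: "(\<integral>\<^sup>+x. ennreal (norm (u k x)) \<partial>lebesgue) = I k" for k
    unfolding u_def I_def by (intro nn_integral_cong) (auto simp: indicator_def)
  have um[measurable]: "u k \<in> borel_measurable lebesgue" for k unfolding u_def by measurable
  have small: "\<forall>\<^sub>F k in sequentially. I k < ennreal \<epsilon>" if e: "\<epsilon> > 0" for \<epsilon>
  proof -
    obtain g where g: "continuous_on UNIV g" "L1_dist (hcube a h) f g < ennreal (\<epsilon> / 4)"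
      using continuous_approximation[OF f hcube_bounded hcube_lebesgue, of "\<epsilon> / 4"] e by auto
    define \<delta> where "\<delta> = \<epsilon> / (4 * h ^ CARD('n))"
    have \<delta>: "\<delta> > 0" unfolding \<delta>_def using e h by simp
    show ?thesis
      using dyadic_avg_uniform_limit[OF g(1) h \<delta>, of a]
    proof eventually_elim
      case (elim k)
      have "L1_dist (hcube a h) (dyadic_avg g k a h) g \<le> (\<integral>\<^sup>+x\<in>hcube a h. ennreal \<delta> \<partial>lebesgue)"
        using elim by (intro nn_integral_mono) (auto simp: indicator_def intro!: ennreal_leI)
      also have "\<dots> = ennreal (\<epsilon> / 4)"
        using h e by (simp add: nn_integral_cmult_indicator emeasure_hcube ennreal_mult[symmetric] \<delta>_def)
      finally have 1: "L1_dist (hcube a h) (dyadic_avg g k a h) g \<le> ennreal (\<epsilon> / 4)" .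
      have "I k \<le> 2 * L1_dist (hcube a h) f g
         + L1_dist (hcube a h) (dyadic_avg g k a h) g"
        unfolding I_def by (rule dyadic_avg_L1_error[OF f continuous_locally_integrable[OF g(1)] h])
      also have "\<dots> \<le> 2 * ennreal (\<epsilon> / 4) + ennreal (\<epsilon> / 4)"
        using g(2) 1 by (intro add_mono mult_left_mono) auto
      also have "\<dots> = ennreal (\<epsilon> / 4 + \<epsilon> / 4 + \<epsilon> / 4)"
        using e by (simp only: mult_2 ennreal_plus[symmetric])
      also have "\<dots> < ennreal \<epsilon>" using e by (simp add: ennreal_less_iff)
      finally show ?case .
    qed
  qed
  have g0: "dyadic_avg (\<lambda>_. 0) k a h x = 0" for k :: nat and a :: "real^'n" and h x
    by (induction k arbitrary: a h) (auto simp: mean_def set_lebesgue_integral_def)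
  have "I k < \<infinity>" for k
  proof -
    have "locally_integrable (\<lambda>_ :: real^'n. 0)" by (auto simp: locally_integrable_def set_integrable_def)
    then have "I k \<le> 2 * (\<integral>\<^sup>+x\<in>hcube a h. ennreal \<bar>f x - 0\<bar> \<partial>lebesgue)"
      using dyadic_avg_L1_error[OF f _ h, of "\<lambda>_. 0" k a] unfolding I_def g0 by simp
    also have "\<dots> < \<infinity>"
      using nn_set_integral_eq_LINT[OF locally_integrable_diff_const(2)[OF f, of "hcube a h" 0]]
      by (simp add: ennreal_mult_less_top)
    finally show ?thesis .
  qed
  then have ui: "integrable lebesgue (u k)" for k
    by (intro integrableI_bounded) (auto simp: I_eq[simplified])
  have "(\<lambda>k. \<integral>x. norm (u k x) \<partial>lebesgue) \<longlonglongrightarrow> 0"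
  proof (rule order_tendstoI)
    fix b :: real assume "b < 0"
    then show "\<forall>\<^sub>F k in sequentially. b < (\<integral>x. norm (u k x) \<partial>lebesgue)"
      by (intro always_eventually allI) (auto intro: less_le_trans Bochner_Integration.integral_nonneg)
  next
    fix b :: real assume b: "0 < b"
    show "\<forall>\<^sub>F k in sequentially. (\<integral>x. norm (u k x) \<partial>lebesgue) < b"
      using small[OF b]
    proof eventually_elim
      case (elim k)
      have "ennreal (\<integral>x. norm (u k x) \<partial>lebesgue) = I k"
        unfolding I_eq[symmetric] using ui[of k] by (intro nn_integral_eq_integral[symmetric]) auto
      then show ?case using elim b by (metis ennreal_less_iff Bochner_Integration.integral_nonneg norm_ge_zero)
    qed
  qed
  then obtain r :: "nat \<Rightarrow> nat" where r: "strict_mono r" "AE x in lebesgue. (\<lambda>n. u (r n) x) \<longlonglongrightarrow> 0"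
    using tendsto_L1_AE_subseq[of lebesgue u, OF ui] by blast
  have "AE x in lebesgue. x \<in> hcube a h \<longrightarrow> (\<lambda>n. dyadic_avg f (r n) a h x) \<longlonglongrightarrow> f x"
    using r(2)
  proof eventually_elim
    case (elim x)
    then show ?case by (auto simp: u_def LIM_zero_iff)
  qed
  then show ?thesis using r(1) by blast
qed

section \<open>Exponential integrability of functions of bounded mean oscillation\<close>

context dyadic_oscillation
begin

lemma exp_integrability:
  assumes "P a h"
  shows "(\<integral>\<^sup>+x\<in>hcube a h. ennreal (exp (\<eta> * \<bar>f x - mean f (hcube a h)\<bar>)) * ennreal (w x) \<partial>lebesgue)
    \<le> ennreal (2 * exp 1 / \<kappa>) * weight_of w (hcube a h)"
proof -
  define c where "c = mean f (hcube a h)"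
  obtain r :: "nat \<Rightarrow> nat" where
    r: "AE x in lebesgue. x \<in> hcube a h \<longrightarrow> (\<lambda>n. dyadic_avg f (r n) a h x) \<longlonglongrightarrow> f x"
    using dyadic_avg_AE_subseq[OF f P_pos[OF assms], of a] by blast
  define G where "G = (\<lambda>n x. ennreal (exp (\<eta> * \<bar>dyadic_avg f (r n) a h x - c\<bar>)) * ennreal (w x) * indicator (hcube a h) x)"
  have [measurable]: "G n \<in> borel_measurable lebesgue" for n unfolding G_def by measurable
  have "(\<integral>\<^sup>+x\<in>hcube a h. ennreal (exp (\<eta> * \<bar>f x - c\<bar>)) * ennreal (w x) \<partial>lebesgue)
     \<le> (\<integral>\<^sup>+x. liminf (\<lambda>n. G n x) \<partial>lebesgue)"
  proof (intro nn_integral_mono_AE)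
    show "AE x in lebesgue. ennreal (exp (\<eta> * \<bar>f x - c\<bar>)) * ennreal (w x) * indicator (hcube a h) x \<le> liminf (\<lambda>n. G n x)"
      using r
    proof eventually_elim
      case (elim x)
      show ?case
      proof (cases "x \<in> hcube a h")
        case True
        then have l: "(\<lambda>n. dyadic_avg f (r n) a h x) \<longlonglongrightarrow> f x" using elim by simp
        have "(\<lambda>n. exp (\<eta> * \<bar>dyadic_avg f (r n) a h x - c\<bar>) * w x) \<longlonglongrightarrow> exp (\<eta> * \<bar>f x - c\<bar>) * w x"
          by (intro tendsto_intros l)
        then have "(\<lambda>n. ennreal (exp (\<eta> * \<bar>dyadic_avg f (r n) a h x - c\<bar>) * w x)) \<longlonglongrightarrow> ennreal (exp (\<eta> * \<bar>f x - c\<bar>) * w x)"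
          by (rule tendsto_ennrealI)
        then have "(\<lambda>n. G n x) \<longlonglongrightarrow> ennreal (exp (\<eta> * \<bar>f x - c\<bar>) * w x)"
          unfolding G_def using True by (simp add: ennreal_mult')
        then have "liminf (\<lambda>n. G n x) = ennreal (exp (\<eta> * \<bar>f x - c\<bar>) * w x)"
          by (intro lim_imp_Liminf) auto
        then show ?thesis using True by (simp add: ennreal_mult')
      qed simp
    qed
  qed
  also have "\<dots> \<le> liminf (\<lambda>n. \<integral>\<^sup>+x. G n x \<partial>lebesgue)"
    by (rule nn_integral_liminf) simp
  also have "\<dots> \<le> ennreal (2 * exp 1 / \<kappa>) * weight_of w (hcube a h)"
  proof (rule Liminf_le)
    show "\<forall>\<^sub>F n in sequentially. (\<integral>\<^sup>+x. G n x \<partial>lebesgue) \<le> ennreal (2 * exp 1 / \<kappa>) * weight_of w (hcube a h)"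
      using expint_bound[OF assms] unfolding G_def expint_def c_def by (intro always_eventually allI)
  qed simp
  finally show ?thesis unfolding c_def .
qed

text \<open>From \<open>t \<le> exp t\<close> at \<open>t / p\<close> one gets \<open>t powr p \<le> p powr p * exp t\<close>; use this with
\<open>t = \<eta> * \<bar>f - c\<bar>\<close>.\<close>

corollary power_integrability:
  assumes "P a h" and p: "p \<ge> 1"
  shows "(\<integral>\<^sup>+x\<in>hcube a h. ennreal (\<bar>f x - mean f (hcube a h)\<bar> powr p * w x) \<partial>lebesgue)
    \<le> ennreal ((p / \<eta>) powr p * (2 * exp 1 / \<kappa>)) * weight_of w (hcube a h)"
proof -
  define c where "c = mean f (hcube a h)"
  note [measurable] = locally_integrable_measurable[OF f]
  have w0: "w x \<ge> 0" for x using w by (simp add: is_weight_def)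
  have pw: "t powr p \<le> (p / \<eta>) powr p * exp (\<eta> * t)" if "t \<ge> 0" for t
  proof -
    have "\<eta> * t / p \<le> exp (\<eta> * t / p)" using exp_ge_add_one_self[of "\<eta> * t / p"] by linarith
    then have "(\<eta> * t / p) powr p \<le> exp (\<eta> * t / p) powr p"
      using that \<eta>(1) p by (intro powr_mono2) auto
    also have "\<dots> = exp (\<eta> * t)" using p by (simp add: powr_def)
    finally have "(p / \<eta>) powr p * (\<eta> * t / p) powr p \<le> (p / \<eta>) powr p * exp (\<eta> * t)"
      by (rule mult_left_mono) simp
    moreover have "(p / \<eta>) powr p * (\<eta> * t / p) powr p = ((p / \<eta>) * (\<eta> * t / p)) powr p"
      by (rule powr_mult[symmetric])
    moreover have "(p / \<eta>) * (\<eta> * t / p) = t" using \<eta>(1) p by simp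
    ultimately show ?thesis by simp
  qed
  have "(\<integral>\<^sup>+x\<in>hcube a h. ennreal (\<bar>f x - c\<bar> powr p * w x) \<partial>lebesgue)
    \<le> (\<integral>\<^sup>+x. ennreal ((p / \<eta>) powr p) * (ennreal (exp (\<eta> * \<bar>f x - c\<bar>)) * ennreal (w x) * indicator (hcube a h) x) \<partial>lebesgue)"
  proof (intro nn_integral_mono)
    fix x
    have "\<bar>f x - c\<bar> powr p * w x \<le> (p / \<eta>) powr p * exp (\<eta> * \<bar>f x - c\<bar>) * w x"
      using pw[of "\<bar>f x - c\<bar>"] w0[of x] by (intro mult_right_mono) auto
    then show "ennreal (\<bar>f x - c\<bar> powr p * w x) * indicator (hcube a h) x
       \<le> ennreal ((p / \<eta>) powr p) * (ennreal (exp (\<eta> * \<bar>f x - c\<bar>)) * ennreal (w x) * indicator (hcube a h) x)"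
      using w0[of x] by (auto simp: indicator_def ennreal_mult'[symmetric] mult.assoc intro!: ennreal_leI)
  qed
  also have "\<dots> = ennreal ((p / \<eta>) powr p) * (\<integral>\<^sup>+x\<in>hcube a h. ennreal (exp (\<eta> * \<bar>f x - c\<bar>)) * ennreal (w x) \<partial>lebesgue)"
    by (rule nn_integral_cmult) simp
  also have "\<dots> \<le> ennreal ((p / \<eta>) powr p) * (ennreal (2 * exp 1 / \<kappa>) * weight_of w (hcube a h))"
    using exp_integrability[OF assms(1)] unfolding c_def by (rule mult_left_mono) simp
  also have "\<dots> = ennreal ((p / \<eta>) powr p * (2 * exp 1 / \<kappa>)) * weight_of w (hcube a h)"
    using \<kappa> by (subst ennreal_mult) (auto simp only: mult.assoc powr_ge_zero divide_nonneg_pos exp_ge_zero mult_nonneg_nonneg zero_le_numeral)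
  finally show ?thesis unfolding c_def .
qed

end

section \<open>Cubes, balls and weighted oscillations\<close>

lemma dist_le_card_mult:
  fixes x y :: "real ^ 'n"
  assumes "\<And>i. \<bar>x $ i - y $ i\<bar> \<le> h" shows "dist x y \<le> real CARD('n) * h"
proof -
  have "dist x y \<le> (\<Sum>i\<in>UNIV. \<bar>(x - y) $ i\<bar>)" unfolding dist_norm by (rule norm_le_l1_cart)
  also have "\<dots> \<le> (\<Sum>i\<in>(UNIV::'n set). h)" using assms by (intro sum_mono) auto
  finally show ?thesis by simp
qed

lemma dist_less_card_mult:
  fixes x y :: "real ^ 'n"
  assumes "\<And>i. \<bar>x $ i - y $ i\<bar> < h" shows "dist x y < real CARD('n) * h"
proof -
  have "dist x y \<le> (\<Sum>i\<in>UNIV. \<bar>(x - y) $ i\<bar>)" unfolding dist_norm by (rule norm_le_l1_cart)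
  also have "\<dots> < (\<Sum>i\<in>(UNIV::'n set). h)" using assms by (intro sum_strict_mono) auto
  finally show ?thesis by simp
qed

lemma hcube_subset_ball:
  fixes a :: "real ^ 'n" shows "hcube a h \<subseteq> ball a (real CARD('n) * h)"
proof
  fix x assume "x \<in> hcube a h"
  then have "\<bar>a $ i - x $ i\<bar> < h" for i by (auto simp: hcube_def abs_less_iff dest: spec[of _ i])
  then show "x \<in> ball a (real CARD('n) * h)" using dist_less_card_mult[of a x h] by simp
qed

lemma cube_subset_ball:
  fixes a :: "real ^ 'n" assumes "r > 0" shows "cube a r \<subseteq> ball a (real CARD('n) * r)"
proof
  fix x assume "x \<in> cube a r"
  then have "\<bar>a $ i - x $ i\<bar> < r" for i using assms
    by (auto simp: cube_def abs_minus_commute dest!: spec[of _ i])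
  then show "x \<in> ball a (real CARD('n) * r)" using dist_less_card_mult[of a x r] by simp
qed

lemma cube_eq_box: "cube x r = box (\<chi> i. x $ i - r / 2) (\<chi> i. x $ i + r / 2)"
proof -
  have "\<bar>y - z\<bar> < r / 2 \<longleftrightarrow> z - r / 2 < y \<and> y < z + r / 2" for y z :: real by linarith
  then show ?thesis by (simp add: cube_def set_eq_iff mem_box_cart)
qed

lemma cube_lebesgue [simp, measurable]: "cube x r \<in> sets lebesgue"
  by (simp add: cube_eq_box)

definition corner :: "real ^ 'n \<Rightarrow> real \<Rightarrow> real ^ 'n" where
  "corner x r = (\<chi> i. x $ i - r / 2)"

definition centre :: "real ^ 'n \<Rightarrow> real \<Rightarrow> real ^ 'n" where
  "centre a h = (\<chi> i. a $ i + h / 2)"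

lemma corner_centre [simp]: "corner (centre a h) h = a" "centre (corner x r) r = x"
  by (auto simp: corner_def centre_def vec_eq_iff)

text \<open>The two cubes differ by a part of the boundary.\<close>

lemma AE_cube_hcube: "AE y in lebesgue. y \<in> cube x r \<longleftrightarrow> y \<in> hcube (corner x r) r"
proof -
  have e: "(\<chi> i. corner x r $ i + r) = (\<chi> i. x $ i + r / 2)" by (simp add: corner_def vec_eq_iff)
  have c: "cube x r = box (corner x r) (\<chi> i. corner x r $ i + r)" unfolding cube_eq_box e by (simp add: corner_def)
  have "negligible (cbox (corner x r) (\<chi> i. corner x r $ i + r) - box (corner x r) (\<chi> i. corner x r $ i + r))"
    by (rule negligible_frontier_interval)
  then have "AE y in lebesgue. y \<notin> cbox (corner x r) (\<chi> i. corner x r $ i + r) - box (corner x r) (\<chi> i. corner x r $ i + r)"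
    unfolding negligible_iff_null_sets by (rule AE_not_in)
  then show ?thesis
    by eventually_elim (use hcube_sandwich[of "corner x r" r] c in auto)
qed

lemma dist_hcube_corner:
  fixes x :: "real ^ 'n"
  assumes "r > 0" "y \<in> hcube (corner x r) r"
  shows "dist x y \<le> real CARD('n) * r"
proof (rule dist_le_card_mult)
  fix i
  have "x $ i - r / 2 \<le> y $ i" "y $ i < x $ i - r / 2 + r"
    using assms(2) by (auto simp: hcube_def corner_def)
  then show "\<bar>x $ i - y $ i\<bar> \<le> r" using assms(1) by (simp add: abs_le_iff)
qed

lemma set_nn_integral_cube:
  "(\<integral>\<^sup>+y\<in>cube x r. g y \<partial>lebesgue) = (\<integral>\<^sup>+y\<in>hcube (corner x r) r. g y \<partial>lebesgue)"
  by (intro nn_integral_cong_AE, use AE_cube_hcube[of x r] in eventually_elim) (auto simp: indicator_def)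

lemma emeasure_cube: "emeasure lebesgue (cube x r) = emeasure lebesgue (hcube (corner x r) r)"
  using AE_cube_hcube[of x r] by (intro emeasure_eq_AE) auto

lemma mean_cube:
  fixes f :: "real ^ 'n \<Rightarrow> real"
  assumes f: "f \<in> borel_measurable lebesgue"
  shows "mean f (cube x r) = mean f (hcube (corner x r) r)"
proof -
  note [measurable] = f
  have "(LINT y:cube x r|lebesgue. f y) = (LINT y:hcube (corner x r) r|lebesgue. f y)"
    unfolding set_lebesgue_integral_def
  proof (rule integral_cong_AE)
    show "AE y in lebesgue. indicator (cube x r) y *\<^sub>R f y = indicator (hcube (corner x r) r) y *\<^sub>R f y"
      using AE_cube_hcube[of x r] by eventually_elim (auto simp: indicator_def)
  qed auto
  then show ?thesis unfolding mean_def measure_def emeasure_cube by simp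
qed

lemma weight_of_mono: "E \<subseteq> F \<Longrightarrow> weight_of w E \<le> weight_of w F"
  unfolding weight_of_def by (intro nn_integral_mono) (auto simp: indicator_def)

text \<open>Apply the average bound to the indicator of the complement \<open>F\<close> of \<open>E\<close>: it fills at least half of the
cube, hence a fixed fraction of the circumscribed ball \<open>B\<close>, so the weight of \<open>F\<close> is at least a
fraction of the weight of \<open>B\<close>.  The ball is centred at the corner of the cube.  Stated with an upper bound
\<open>X\<close> for the growth factor, so that one constant serves all subcubes of a given cube.\<close>

lemma muckenhoupt_small_sets:
  fixes w :: "real ^ 'n \<Rightarrow> real"
  assumes w: "w \<in> muckenhoupt \<rho> \<theta> p" and p: "1 \<le> p" and \<theta>: "0 < \<theta>" and \<rho>: "\<And>x. \<rho> x > 0"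
  shows "\<exists>c\<ge>1. \<forall>a h E X. 0 < h \<longrightarrow> 1 + real CARD('n) * h / \<rho> a \<le> X \<longrightarrow> E \<in> sets lebesgue \<longrightarrow> E \<subseteq> hcube a h
     \<longrightarrow> measure lebesgue E \<le> h ^ CARD('n) / 2
     \<longrightarrow> weight_of w E \<le> ennreal (1 - (c * X powr \<theta>) powr (- p)) * weight_of w (hcube a h)"
proof -
  define d where "d = real CARD('n)"
  have d: "d \<ge> 1" unfolding d_def by (simp add: Suc_leI)
  have iw: "is_weight w" using w by (simp add: muckenhoupt_def)
  note [measurable] = weight_measurable[OF iw]
  have wpos: "AE x in lebesgue. 0 < w x" by (rule muckenhoupt_AE_pos[OF w p])
  obtain C where C: "C > 0" and Cb: "\<And>x0 r g. r > 0 \<Longrightarrow> g \<in> borel_measurable lebesgue \<Longrightarrow> (\<forall>x. 0 \<le> g x) \<Longrightarrow>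
    emean (\<lambda>x. ennreal (g x)) (ball x0 r) \<le> ennreal (C * (1 + r / \<rho> x0) powr \<theta>)
      * epowr ((\<integral>\<^sup>+x\<in>ball x0 r. ennreal (g x powr p * w x) \<partial>lebesgue) / weight_of w (ball x0 r)) (1 / p)"
    using muckenhoupt_average_bound[OF w p \<rho>] by blast
  define v where "v = measure lebesgue (ball (0::real^'n) 1) * d ^ CARD('n)"
  have v: "v > 0" unfolding v_def using measure_unit_ball_pos[where 'n='n] d by simp
  define c where "c = 1 + 2 * v * C"
  have c: "c \<ge> 1" "2 * v * C \<le> c" unfolding c_def using v C by auto
  have "weight_of w E \<le> ennreal (1 - (c * X powr \<theta>) powr (- p)) * weight_of w (hcube a h)"
    if h: "0 < h" and X: "1 + d * h / \<rho> a \<le> X" and E: "E \<in> sets lebesgue" "E \<subseteq> hcube a h"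
      and Es: "measure lebesgue E \<le> h ^ CARD('n) / 2" for a h E X
  proof -
    define Q F B where "Q = hcube a h" and "F = Q - E" and "B = ball a (d * h)"
    have dh: "d * h > 0" using d h by simp
    have Em: "E \<in> lmeasurable" using E(2) by (intro bounded_set_imp_lmeasurable bounded_subset[OF hcube_bounded] E(1))
    have Fs[measurable]: "F \<in> sets lebesgue" unfolding F_def Q_def using E by auto
    note [measurable] = E(1)
    have QB: "Q \<subseteq> B" unfolding Q_def B_def d_def by (rule hcube_subset_ball)
    have "measure lebesgue F = h ^ CARD('n) - measure lebesgue E"
      unfolding F_def Q_def using E Em h by (subst measurable_measure_Diff) (auto simp: measure_hcube)
    then have Fm: "measure lebesgue F \<ge> h ^ CARD('n) / 2" using Es by linarith
    have FB: "F \<subseteq> B" using QB by (auto simp: F_def)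
    have bB: "bounded B" by (simp add: B_def)
    have Flm: "F \<in> lmeasurable"
      by (intro bounded_set_imp_lmeasurable bounded_subset[OF bB FB] Fs)
    have Bm: "measure lebesgue B = v * h ^ CARD('n)"
      unfolding B_def v_def using measure_ball_scaling[of "d * h" a] dh by (simp add: power_mult_distrib)
    have X1: "X \<ge> 1" using X divide_pos_pos[OF dh \<rho>[of a]] by linarith
    have fin: "weight_of w S < \<infinity>" if "S \<subseteq> B" "S \<in> sets lebesgue" for S
      by (rule weight_of_finite[OF iw bounded_subset[OF bB that(1)] that(2)])
    have Bs: "B \<in> sets lebesgue" by (simp add: B_def)
    have Bpos: "weight_of w B > 0"
      using measure_ball_pos[OF dh, of a] Bs
      by (intro weight_of_pos[OF iw wpos]) (auto simp: B_def emeasure_ball_eq)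
    obtain b where b: "weight_of w B = ennreal b" "b > 0"
      using Bpos fin[OF order_refl Bs] by (cases "weight_of w B") auto
    obtain \<phi> where \<phi>: "weight_of w F = ennreal \<phi>" "\<phi> \<ge> 0"
      using fin[OF FB Fs] by (cases "weight_of w F") auto
    obtain u where u: "weight_of w Q = ennreal u" "u \<ge> 0"
      using fin[OF QB] by (cases "weight_of w Q") (auto simp: Q_def)
    obtain \<psi> where \<psi>: "weight_of w E = ennreal \<psi>" "\<psi> \<ge> 0"
      using fin[of E] E QB by (cases "weight_of w E") (auto simp: Q_def)
    have ub: "u \<le> b" using weight_of_mono[OF QB, of w] u b by (simp add: ennreal_le_iff)
    have "weight_of w Q = weight_of w E + weight_of w F"
    proof -
      have "weight_of w Q = (\<integral>\<^sup>+x. (ennreal (w x) * indicator E x + ennreal (w x) * indicator F x) \<partial>lebesgue)"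
        unfolding weight_of_def using E(2) by (intro nn_integral_cong) (auto simp: F_def Q_def indicator_def)
      also have "\<dots> = weight_of w E + weight_of w F" unfolding weight_of_def by (rule nn_integral_add) auto
      finally show ?thesis .
    qed
    then have sum: "u = \<psi> + \<phi>" using u \<psi> \<phi> by (simp add: ennreal_plus[symmetric] del: ennreal_plus)
    have "emean (\<lambda>x. ennreal (indicator F x)) B \<le> ennreal (C * (1 + d * h / \<rho> a) powr \<theta>)
      * epowr ((\<integral>\<^sup>+x\<in>B. ennreal (indicator F x powr p * w x) \<partial>lebesgue) / weight_of w B) (1 / p)"
      unfolding B_def by (rule Cb[OF dh]) auto
    moreover have "(\<integral>\<^sup>+x\<in>B. ennreal (indicator F x powr p * w x) \<partial>lebesgue) = weight_of w F"
      unfolding weight_of_def using FB by (intro nn_integral_cong) (auto simp: indicator_def)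
    moreover have "emean (\<lambda>x. ennreal (indicator F x)) B = ennreal (measure lebesgue F / measure lebesgue B)"
    proof -
      have "(\<integral>\<^sup>+x\<in>B. ennreal (indicator F x) \<partial>lebesgue) = (\<integral>\<^sup>+x. indicator F x \<partial>lebesgue)"
        using FB by (intro nn_integral_cong) (auto simp: indicator_def)
      also have "\<dots> = ennreal (measure lebesgue F)" using Flm by (simp add: emeasure_eq_measure2)
      finally show ?thesis
        unfolding emean_def using measure_ball_pos[OF dh, of a]
        by (simp add: B_def emeasure_ball_eq divide_ennreal)
    qed
    ultimately have "ennreal (measure lebesgue F / measure lebesgue B)
       \<le> ennreal (C * (1 + d * h / \<rho> a) powr \<theta>) * ennreal ((\<phi> / b) powr (1 / p))"
      using \<phi> b p by (simp add: divide_ennreal epowr_ennreal)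
    then have "measure lebesgue F / measure lebesgue B \<le> C * (1 + d * h / \<rho> a) powr \<theta> * (\<phi> / b) powr (1 / p)"
      using C by (simp add: ennreal_mult[symmetric] ennreal_le_iff)
    also have "\<dots> \<le> C * X powr \<theta> * (\<phi> / b) powr (1 / p)"
      using C X \<theta> \<rho>[of a] dh by (intro mult_right_mono mult_left_mono powr_mono2) (auto intro: add_nonneg_nonneg)
    finally have 1: "measure lebesgue F / measure lebesgue B \<le> C * X powr \<theta> * (\<phi> / b) powr (1 / p)" .
    have "1 / (2 * v) = (h ^ CARD('n) / 2) / measure lebesgue B" using h v unfolding Bm by simp
    also have "\<dots> \<le> measure lebesgue F / measure lebesgue B"
      using Fm by (intro divide_right_mono) auto
    finally have "1 / (2 * v) \<le> C * X powr \<theta> * (\<phi> / b) powr (1 / p)" using 1 by linarith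
    then have "1 \<le> 2 * v * C * X powr \<theta> * (\<phi> / b) powr (1 / p)" using v by (simp add: field_simps)
    also have "\<dots> \<le> c * X powr \<theta> * (\<phi> / b) powr (1 / p)" using c by (intro mult_right_mono) auto
    finally have 2: "1 \<le> c * X powr \<theta> * (\<phi> / b) powr (1 / p)" .
    define Y where "Y = c * X powr \<theta>"
    have Y: "Y > 0" unfolding Y_def using c X1 by simp
    have "1 powr p \<le> (Y * (\<phi> / b) powr (1 / p)) powr p"
      using 2 p unfolding Y_def by (intro powr_mono2) auto
    also have "\<dots> = Y powr p * (\<phi> / b)"
      using Y p \<phi> b by (simp add: powr_mult powr_powr)
    finally have "b \<le> Y powr p * \<phi>" using b by (simp add: field_simps)
    then have "Y powr (- p) * b \<le> Y powr (- p) * (Y powr p * \<phi>)" by (intro mult_left_mono) auto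
    also have "\<dots> = \<phi>" using Y by (simp add: powr_minus field_simps)
    finally have "Y powr (- p) * b \<le> \<phi>" .
    moreover have "Y powr (- p) * u \<le> Y powr (- p) * b" using ub by (intro mult_left_mono) auto
    ultimately have "\<psi> \<le> (1 - Y powr (- p)) * u" using sum by (simp add: algebra_simps)
    moreover have "Y powr (- p) \<le> 1"
    proof -
      have "1 \<le> X powr \<theta>" using X1 \<theta> by (intro ge_one_powr_ge_zero) auto
      then have "1 * 1 \<le> Y" unfolding Y_def using c by (intro mult_mono) auto
      then show ?thesis using p powr_mono2'[of "-p" 1 Y] by simp
    qed
    ultimately show ?thesis
      unfolding \<psi> Q_def[symmetric] u Y_def[symmetric] using u by (simp add: ennreal_mult'[symmetric] ennreal_leI)
  qed
  then show ?thesis using c(1) unfolding d_def by blast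
qed

lemma weighted_osc_leI:
  assumes "(\<integral>\<^sup>+x\<in>E. ennreal (\<bar>f x - mean f E\<bar> powr p * w x) \<partial>lebesgue) \<le> ennreal T * weight_of w E"
    and "T \<ge> 0" "p \<ge> 1"
  shows "weighted_osc p w f E \<le> ennreal (T powr (1 / p))"
proof -
  have "(\<integral>\<^sup>+x\<in>E. ennreal (\<bar>f x - mean f E\<bar> powr p * w x) \<partial>lebesgue) / weight_of w E \<le> ennreal T"
  proof (cases "weight_of w E = 0")
    case True
    then show ?thesis using assms(1) by simp
  next
    case False
    show ?thesis
    proof (cases "weight_of w E = \<infinity>")
      case True then show ?thesis by simp
    next
      case f: False
      have "(\<integral>\<^sup>+x\<in>E. ennreal (\<bar>f x - mean f E\<bar> powr p * w x) \<partial>lebesgue) / weight_of w E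
         \<le> ennreal T * weight_of w E / weight_of w E"
        using assms(1) by (rule divide_right_mono_ennreal)
      also have "\<dots> = ennreal T" using False f by (simp add: ennreal_mult_divide_eq)
      finally show ?thesis .
    qed
  qed
  then have "epowr ((\<integral>\<^sup>+x\<in>E. ennreal (\<bar>f x - mean f E\<bar> powr p * w x) \<partial>lebesgue) / weight_of w E) (1 / p)
     \<le> epowr (ennreal T) (1 / p)" using assms by (intro epowr_mono) auto
  then show ?thesis unfolding weighted_osc_def using assms by (simp add: epowr_ennreal)
qed

lemma divide_left_antimono_ennreal:
  fixes a b c :: ennreal assumes "b \<le> c" shows "a / c \<le> a / b"
proof -
  have "inverse c \<le> inverse b"
  proof (cases "b = 0 \<or> c = \<infinity>")
    case True then show ?thesis by auto
  next
    case False
    then obtain x y where "b = ennreal x" "0 < x" "c = ennreal y" "0 \<le> y"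
      using assms by (cases b; cases c) (auto simp: top_unique)
    moreover have "x \<le> y" using calculation assms by (simp add: ennreal_le_iff)
    ultimately show ?thesis by (simp add: inverse_ennreal ennreal_leI le_imp_inverse_le)
  qed
  then show ?thesis unfolding divide_ennreal_def by (rule mult_left_mono) simp
qed

text \<open>The average bound for \<open>\<bar>f - mean f E\<bar>\<close> restricted to \<open>E\<close>, together with
\<open>weight_of w E \<le> weight_of w B\<close>.  Stated for general \<open>E\<close> to serve cubes and balls.\<close>

lemma average_le_weighted_osc:
  fixes w f :: "real ^ 'n \<Rightarrow> real"
  assumes w: "w \<in> muckenhoupt \<rho> \<theta> p" and p: "1 \<le> p" and \<rho>: "\<And>x. \<rho> x > 0" and f: "locally_integrable f"
  shows "\<exists>K>0. \<forall>x0 R E. 0 < R \<longrightarrow> E \<subseteq> ball x0 R \<longrightarrow> E \<in> sets lebesgue \<longrightarrow>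
    (\<integral>\<^sup>+x\<in>E. ennreal \<bar>f x - mean f E\<bar> \<partial>lebesgue)
      \<le> ennreal (K * (1 + R / \<rho> x0) powr \<theta> * measure lebesgue (ball x0 R)) * weighted_osc p w f E"
proof -
  note [measurable] = locally_integrable_measurable[OF f]
  obtain C where C: "C > 0" and Cb: "\<And>x0 r g. r > 0 \<Longrightarrow> g \<in> borel_measurable lebesgue \<Longrightarrow> (\<forall>x. 0 \<le> g x) \<Longrightarrow>
    emean (\<lambda>x. ennreal (g x)) (ball x0 r) \<le> ennreal (C * (1 + r / \<rho> x0) powr \<theta>)
      * epowr ((\<integral>\<^sup>+x\<in>ball x0 r. ennreal (g x powr p * w x) \<partial>lebesgue) / weight_of w (ball x0 r)) (1 / p)"
    using muckenhoupt_average_bound[OF w p \<rho>] by blast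
  have "(\<integral>\<^sup>+x\<in>E. ennreal \<bar>f x - mean f E\<bar> \<partial>lebesgue)
      \<le> ennreal (C * (1 + R / \<rho> x0) powr \<theta> * measure lebesgue (ball x0 R)) * weighted_osc p w f E"
    if R: "0 < R" and E: "E \<subseteq> ball x0 R" and Em[measurable]: "E \<in> sets lebesgue" for x0 R E
  proof -
    define B where "B = ball x0 R"
    define m where "m = measure lebesgue B"
    have m: "m > 0" "emeasure lebesgue B = ennreal m"
      unfolding m_def B_def using R by (auto simp: measure_ball_pos emeasure_ball_eq)
    define g where "g = (\<lambda>x. \<bar>f x - mean f E\<bar> * indicator E x)"
    define J where "J = (\<integral>\<^sup>+x\<in>E. ennreal \<bar>f x - mean f E\<bar> \<partial>lebesgue)"
    have gm: "g \<in> borel_measurable lebesgue" unfolding g_def by measurable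
    have J: "(\<integral>\<^sup>+x\<in>B. ennreal (g x) \<partial>lebesgue) = J"
      unfolding J_def g_def using E by (intro nn_integral_cong) (auto simp: indicator_def B_def)
    have I: "(\<integral>\<^sup>+x\<in>B. ennreal (g x powr p * w x) \<partial>lebesgue) = (\<integral>\<^sup>+x\<in>E. ennreal (\<bar>f x - mean f E\<bar> powr p * w x) \<partial>lebesgue)"
      unfolding g_def using E by (intro nn_integral_cong) (auto simp: indicator_def B_def)
    have "emean (\<lambda>x. ennreal (g x)) B \<le> ennreal (C * (1 + R / \<rho> x0) powr \<theta>)
      * epowr ((\<integral>\<^sup>+x\<in>B. ennreal (g x powr p * w x) \<partial>lebesgue) / weight_of w B) (1 / p)"
      unfolding B_def by (rule Cb[OF R gm]) (auto simp: g_def)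
    also have "\<dots> \<le> ennreal (C * (1 + R / \<rho> x0) powr \<theta>) * weighted_osc p w f E"
      unfolding I weighted_osc_def using p weight_of_mono[OF E, of w]
      by (intro mult_left_mono epowr_mono divide_left_antimono_ennreal) (auto simp: B_def)
    finally have "J / ennreal m \<le> ennreal (C * (1 + R / \<rho> x0) powr \<theta>) * weighted_osc p w f E"
      unfolding emean_def J m .
    then have "J / ennreal m * ennreal m \<le> ennreal (C * (1 + R / \<rho> x0) powr \<theta>) * weighted_osc p w f E * ennreal m"
      by (rule mult_right_mono) simp
    moreover have "J / ennreal m * ennreal m = J"
      using m by (simp add: ennreal_divide_times ennreal_mult_divide_eq)
    ultimately have "J \<le> ennreal (C * (1 + R / \<rho> x0) powr \<theta>) * ennreal m * weighted_osc p w f E"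
      by (simp add: mult_ac)
    also have "ennreal (C * (1 + R / \<rho> x0) powr \<theta>) * ennreal m = ennreal (C * (1 + R / \<rho> x0) powr \<theta> * m)"
      using C m by (simp add: ennreal_mult)
    finally show ?thesis unfolding J_def m_def B_def .
  qed
  then show ?thesis using C by blast
qed

lemma one_plus_scaled_powr_le:
  fixes k t N :: real
  assumes "k \<ge> 1" "t \<ge> 0" "N \<ge> 0"
  shows "(1 + k * t) powr N \<le> k powr N * (1 + t) powr N"
proof -
  have "(1 + k * t) powr N \<le> (k * (1 + t)) powr N"
    using assms by (intro powr_mono2) (auto simp: algebra_simps)
  then show ?thesis using assms by (simp add: powr_mult)
qed

lemma BMO_if_weighted_osc:
  fixes w f :: "real ^ 'n \<Rightarrow> real"
  assumes w: "w \<in> muckenhoupt \<rho> \<theta> p" and \<theta>: "0 < \<theta>" and p: "1 \<le> p" and \<rho>: "\<And>x. \<rho> x > 0" and f: "locally_integrable f"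
    and C: "C > 0" and N: "N > 0"
    and osc: "\<And>x0 r. r > 0 \<Longrightarrow> weighted_osc p w f (cube x0 r) \<le> ennreal (C * (1 + r / \<rho> x0) powr N)"
  shows "f \<in> BMO \<rho> (\<theta> + N)"
proof -
  define d where "d = real CARD('n)"
  have d: "d \<ge> 1" unfolding d_def by (simp add: Suc_leI)
  define v where "v = measure lebesgue (ball (0::real^'n) 1) * d ^ CARD('n)"
  have v: "v > 0" unfolding v_def using measure_unit_ball_pos[where 'n='n] d by simp
  obtain K where K: "K > 0" and Kb: "\<And>x0 R E. 0 < R \<Longrightarrow> E \<subseteq> ball x0 R \<Longrightarrow> E \<in> sets lebesgue \<Longrightarrow>
    (\<integral>\<^sup>+x\<in>E. ennreal \<bar>f x - mean f E\<bar> \<partial>lebesgue)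
      \<le> ennreal (K * (1 + R / \<rho> x0) powr \<theta> * measure lebesgue (ball x0 R)) * weighted_osc p w f E"
    using average_le_weighted_osc[OF w p \<rho> f] by blast
  define M where "M = K * d powr \<theta> * v * C"
  have "ennreal ((1 + r / \<rho> x0) powr (- (\<theta> + N))) * emean (\<lambda>x. ennreal \<bar>f x - mean f (cube x0 r)\<bar>) (cube x0 r) \<le> ennreal M"
    if r: "r > 0" for x0 r
  proof -
    define t where "t = r / \<rho> x0"
    have t: "t > 0" unfolding t_def using r \<rho>[of x0] by simp
    have dr: "d * r > 0" using d r by simp
    have bm: "measure lebesgue (ball x0 (d * r)) = v * r ^ CARD('n)"
      unfolding v_def using measure_ball_scaling[of "d * r" x0] dr by (simp add: power_mult_distrib)
    have em: "emeasure lebesgue (cube x0 r) = ennreal (r ^ CARD('n))"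
      using r by (simp add: emeasure_cube emeasure_hcube)
    have "(\<integral>\<^sup>+x\<in>cube x0 r. ennreal \<bar>f x - mean f (cube x0 r)\<bar> \<partial>lebesgue)
      \<le> ennreal (K * (1 + d * t) powr \<theta> * (v * r ^ CARD('n))) * weighted_osc p w f (cube x0 r)"
      using Kb[OF dr, of "cube x0 r" x0] cube_subset_ball[OF r, of x0] unfolding bm[symmetric] t_def d_def by simp
    also have "\<dots> \<le> ennreal (K * (d powr \<theta> * (1 + t) powr \<theta>) * (v * r ^ CARD('n))) * ennreal (C * (1 + t) powr N)"
      using osc[OF r, of x0] one_plus_scaled_powr_le[of d t \<theta>] d t \<theta> K v r unfolding t_def[symmetric]
      by (intro mult_mono ennreal_leI mult_right_mono mult_left_mono) auto
    also have "\<dots> = ennreal (M * (1 + t) powr (\<theta> + N) * r ^ CARD('n))"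
      using K v C r t by (simp add: ennreal_mult[symmetric] M_def powr_add mult_ac)
    finally have "emean (\<lambda>x. ennreal \<bar>f x - mean f (cube x0 r)\<bar>) (cube x0 r)
       \<le> ennreal (M * (1 + t) powr (\<theta> + N) * r ^ CARD('n)) / ennreal (r ^ CARD('n))"
      unfolding emean_def em by (rule divide_right_mono_ennreal)
    also have "\<dots> = ennreal (M * (1 + t) powr (\<theta> + N))"
      using K v C r t d by (subst divide_ennreal) (auto simp: M_def)
    finally have "ennreal ((1 + t) powr (- (\<theta> + N))) * emean (\<lambda>x. ennreal \<bar>f x - mean f (cube x0 r)\<bar>) (cube x0 r)
       \<le> ennreal ((1 + t) powr (- (\<theta> + N))) * ennreal (M * (1 + t) powr (\<theta> + N))"
      by (rule mult_left_mono) simp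
    also have "\<dots> = ennreal ((1 + t) powr (- (\<theta> + N)) * (M * (1 + t) powr (\<theta> + N)))"
      using K v C d by (simp add: ennreal_mult' M_def)
    also have "(1 + t) powr (- (\<theta> + N)) * (M * (1 + t) powr (\<theta> + N)) = M"
      using t by (simp only: powr_minus) simp
    finally show ?thesis unfolding t_def .
  qed
  then have "(SUP x0. SUP r\<in>{0<..}.
        ennreal ((1 + r / \<rho> x0) powr (- (\<theta> + N)))
        * emean (\<lambda>x. ennreal \<bar>f x - mean f (cube x0 r)\<bar>) (cube x0 r)) \<le> ennreal M"
    by (intro SUP_least) auto
  also have "\<dots> < \<infinity>" by simp
  finally show ?thesis unfolding BMO_def using f by blast
qed

lemma Lip_if_weighted_osc:
  fixes w f :: "real ^ 'n \<Rightarrow> real"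
  assumes w: "w \<in> muckenhoupt \<rho> \<theta> p" and \<theta>: "0 < \<theta>" and p: "1 \<le> p" and \<rho>: "\<And>x. \<rho> x > 0" and f: "locally_integrable f"
    and C: "C > 0" and N: "N > 0" and \<beta>: "0 < \<beta>"
    and osc: "\<And>x0 r. r > 0 \<Longrightarrow> weighted_osc p w f (ball x0 r)
        / epowr (emeasure lebesgue (ball x0 r)) (\<beta> / real CARD('n)) \<le> ennreal (C * (1 + r / \<rho> x0) powr N)"
  shows "f \<in> Lip \<rho> (\<theta> + N) \<beta>"
proof -
  define d where "d = real CARD('n)"
  have d: "d \<ge> 1" unfolding d_def by (simp add: Suc_leI)
  obtain K where K: "K > 0" and Kb: "\<And>x0 R E. 0 < R \<Longrightarrow> E \<subseteq> ball x0 R \<Longrightarrow> E \<in> sets lebesgue \<Longrightarrow>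
    (\<integral>\<^sup>+x\<in>E. ennreal \<bar>f x - mean f E\<bar> \<partial>lebesgue)
      \<le> ennreal (K * (1 + R / \<rho> x0) powr \<theta> * measure lebesgue (ball x0 R)) * weighted_osc p w f E"
    using average_le_weighted_osc[OF w p \<rho> f] by blast
  have "ennreal ((1 + r / \<rho> x0) powr (- (\<theta> + N))) * ((\<integral>\<^sup>+x\<in>ball x0 r. ennreal \<bar>f x - mean f (ball x0 r)\<bar> \<partial>lebesgue)
           / epowr (emeasure lebesgue (ball x0 r)) (1 + \<beta> / d)) \<le> ennreal (K * C)"
    if r: "r > 0" for x0 r
  proof -
    define t where "t = r / \<rho> x0"
    have t: "t > 0" unfolding t_def using r \<rho>[of x0] by simp
    define m where "m = measure lebesgue (ball x0 r)"
    have m: "m > 0" "emeasure lebesgue (ball x0 r) = ennreal m"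
      unfolding m_def using r by (auto simp: measure_ball_pos emeasure_ball_eq)
    define W where "W = weighted_osc p w f (ball x0 r)"
    have "W / ennreal (m powr (\<beta> / d)) \<le> ennreal (C * (1 + t) powr N)"
      using osc[OF r, of x0] m unfolding W_def t_def d_def by (simp add: epowr_ennreal_pos)
    then have "W / ennreal (m powr (\<beta> / d)) * ennreal (m powr (\<beta> / d)) \<le> ennreal (C * (1 + t) powr N) * ennreal (m powr (\<beta> / d))"
      by (rule mult_right_mono) simp
    then have W: "W \<le> ennreal (C * (1 + t) powr N * m powr (\<beta> / d))"
      using m C by (simp add: ennreal_divide_times ennreal_mult_divide_eq ennreal_mult)
    have "(\<integral>\<^sup>+x\<in>ball x0 r. ennreal \<bar>f x - mean f (ball x0 r)\<bar> \<partial>lebesgue)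
      \<le> ennreal (K * (1 + t) powr \<theta> * m) * W"
      using Kb[OF r order_refl, of x0] unfolding t_def m_def W_def by simp
    also have "\<dots> \<le> ennreal (K * (1 + t) powr \<theta> * m) * ennreal (C * (1 + t) powr N * m powr (\<beta> / d))"
      by (rule mult_left_mono[OF W]) simp
    also have "\<dots> = ennreal (K * C * (1 + t) powr (\<theta> + N) * m powr (1 + \<beta> / d))"
      using K C m t by (simp add: ennreal_mult[symmetric] powr_add mult_ac)
    finally have "(\<integral>\<^sup>+x\<in>ball x0 r. ennreal \<bar>f x - mean f (ball x0 r)\<bar> \<partial>lebesgue) / ennreal (m powr (1 + \<beta> / d))
       \<le> ennreal (K * C * (1 + t) powr (\<theta> + N) * m powr (1 + \<beta> / d)) / ennreal (m powr (1 + \<beta> / d))"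
      by (rule divide_right_mono_ennreal)
    also have "\<dots> = ennreal (K * C * (1 + t) powr (\<theta> + N))"
      using K C m by (subst divide_ennreal) auto
    finally have "ennreal ((1 + t) powr (- (\<theta> + N))) * ((\<integral>\<^sup>+x\<in>ball x0 r. ennreal \<bar>f x - mean f (ball x0 r)\<bar> \<partial>lebesgue) / ennreal (m powr (1 + \<beta> / d)))
       \<le> ennreal ((1 + t) powr (- (\<theta> + N))) * ennreal (K * C * (1 + t) powr (\<theta> + N))"
      by (rule mult_left_mono) simp
    also have "\<dots> = ennreal ((1 + t) powr (- (\<theta> + N)) * (K * C * (1 + t) powr (\<theta> + N)))"
      using K C by (simp add: ennreal_mult')
    also have "(1 + t) powr (- (\<theta> + N)) * (K * C * (1 + t) powr (\<theta> + N)) = K * C"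
      using t by (simp only: powr_minus) simp
    finally show ?thesis unfolding t_def using m by (simp add: epowr_ennreal_pos)
  qed
  then have "(SUP x0. SUP r\<in>{0<..}.
        ennreal ((1 + r / \<rho> x0) powr (- (\<theta> + N)))
        * ((\<integral>\<^sup>+x\<in>ball x0 r. ennreal \<bar>f x - mean f (ball x0 r)\<bar> \<partial>lebesgue)
           / epowr (emeasure lebesgue (ball x0 r)) (1 + \<beta> / real CARD('n)))) \<le> ennreal (K * C)"
    unfolding d_def by (intro SUP_least) auto
  also have "\<dots> < \<infinity>" by simp
  finally show ?thesis unfolding Lip_def using f by blast
qed

lemma SUP_radius_finite_bound:
  fixes \<Phi> :: "'a \<Rightarrow> real \<Rightarrow> ennreal" and b :: "'a \<Rightarrow> real \<Rightarrow> real"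
  assumes "(SUP x0. SUP r\<in>{0<..}. ennreal (b x0 r powr (- \<theta>)) * \<Phi> x0 r) < \<infinity>"
    and b: "\<And>x0 r. r > 0 \<Longrightarrow> b x0 r > 0"
  obtains A where "A > 0" "\<And>x0 r. r > 0 \<Longrightarrow> \<Phi> x0 r \<le> ennreal (A * b x0 r powr \<theta>)"
proof -
  obtain A' where A': "(SUP x0. SUP r\<in>{0<..}. ennreal (b x0 r powr (- \<theta>)) * \<Phi> x0 r) = ennreal A'" "A' \<ge> 0"
    using assms(1) by (cases "SUP x0. SUP r\<in>{0<..}. ennreal (b x0 r powr (- \<theta>)) * \<Phi> x0 r") auto
  show thesis
  proof (rule that[of "A' + 1"])
    show "A' + 1 > 0" using A' by simp
    fix x0 and r :: real assume r: "r > 0"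
    have "ennreal (b x0 r powr (- \<theta>)) * \<Phi> x0 r \<le> (SUP r\<in>{0<..}. ennreal (b x0 r powr (- \<theta>)) * \<Phi> x0 r)"
      using r by (intro SUP_upper) auto
    also have "\<dots> \<le> ennreal A'" unfolding A'(1)[symmetric] by (rule SUP_upper) simp
    also have "\<dots> \<le> ennreal (A' + 1)" by (intro ennreal_leI) simp
    finally have "ennreal (b x0 r powr \<theta>) * (ennreal (b x0 r powr (- \<theta>)) * \<Phi> x0 r) \<le> ennreal (b x0 r powr \<theta>) * ennreal (A' + 1)"
      by (rule mult_left_mono) simp
    moreover have "ennreal (b x0 r powr \<theta>) * (ennreal (b x0 r powr (- \<theta>)) * \<Phi> x0 r) = \<Phi> x0 r"
      using b[OF r, of x0] by (simp add: mult.assoc[symmetric] ennreal_mult[symmetric] powr_minus)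
    ultimately show "\<Phi> x0 r \<le> ennreal ((A' + 1) * b x0 r powr \<theta>)"
      using A' by (simp add: ennreal_mult mult.commute)
  qed
qed

lemma weighted_osc_cube:
  fixes f w :: "real ^ 'n \<Rightarrow> real"
  assumes "f \<in> borel_measurable lebesgue"
  shows "weighted_osc p w f (cube x r) = weighted_osc p w f (hcube (corner x r) r)"
  unfolding weighted_osc_def weight_of_def set_nn_integral_cube mean_cube[OF assms] ..

text \<open>Let \<open>Q\<close> be the given cube.  Slow variation of \<open>\<rho>\<close> bounds the growth factors of all subcubes of \<open>Q\<close>
by one number \<open>X\<close>, a constant times a power of \<open>1 + r / \<rho> x0\<close>.  On them \<open>f\<close> has mean oscillation at
most \<open>A0 * X powr \<gamma>\<close> and the weight satisfies the small set condition with
\<open>\<kappa> = (c * X powr \<theta>) powr (- p)\<close>, so the moment bound is a power of \<open>X\<close>.\<close>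

lemma weighted_osc_if_BMO:
  fixes w f :: "real ^ 'n \<Rightarrow> real"
  assumes w: "w \<in> muckenhoupt \<rho> \<theta> p" and \<theta>: "0 < \<theta>" and p: "1 \<le> p" and \<rho>: "slowly_varying \<rho>"
    and f: "f \<in> BMO \<rho> \<gamma>" and \<gamma>: "\<gamma> > 0"
  shows "\<exists>C>0. \<exists>N>0. \<forall>x0. \<forall>r>0. weighted_osc p w f (cube x0 r) \<le> ennreal (C * (1 + r / \<rho> x0) powr N)"
proof -
  define d where "d = real CARD('n)"
  have d: "d \<ge> 1" unfolding d_def by (simp add: Suc_leI)
  have \<rho>pos: "\<And>x. \<rho> x > 0" using \<rho> by (simp add: slowly_varying_def)
  have iw: "is_weight w" using w by (simp add: muckenhoupt_def)
  have fl: "locally_integrable f" using f by (simp add: BMO_def)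
  have fm: "f \<in> borel_measurable lebesgue" by (rule locally_integrable_measurable[OF fl])
  obtain Cs Ns where Cs: "Cs \<ge> 1" and Ns: "Ns \<ge> 1"
    and sv: "\<And>x y r h. 0 \<le> h \<Longrightarrow> h \<le> r \<Longrightarrow> dist x y \<le> r \<Longrightarrow> 1 + h / \<rho> y \<le> Cs * (1 + r / \<rho> x) powr Ns"
    using \<rho> unfolding slowly_varying_def by blast
  have bp: "1 + r / \<rho> x > 0" if "r > 0" for r x using that \<rho>pos[of x] by (simp add: add_pos_pos)
  obtain A0 where A0: "A0 > 0" and A0b: "\<And>x r. r > 0 \<Longrightarrow>
      emean (\<lambda>y. ennreal \<bar>f y - mean f (cube x r)\<bar>) (cube x r) \<le> ennreal (A0 * (1 + r / \<rho> x) powr \<gamma>)"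
    by (rule SUP_radius_finite_bound[where b = "\<lambda>x r. 1 + r / \<rho> x" and \<theta> = \<gamma>
        and \<Phi> = "\<lambda>x r. emean (\<lambda>y. ennreal \<bar>f y - mean f (cube x r)\<bar>) (cube x r)"])
      (use f bp in \<open>auto simp: BMO_def\<close>)
  have hosc: "(LINT x:hcube a h|lebesgue. \<bar>f x - mean f (hcube a h)\<bar>) \<le> A0 * (1 + h / \<rho> (centre a h)) powr \<gamma> * h ^ CARD('n)"
    if h: "h > 0" for a h
  proof -
    have "emean (\<lambda>y. ennreal \<bar>f y - mean f (cube (centre a h) h)\<bar>) (cube (centre a h) h)
       = ennreal (LINT x:hcube a h|lebesgue. \<bar>f x - mean f (hcube a h)\<bar>) / ennreal (h ^ CARD('n))"
      unfolding emean_def set_nn_integral_cube mean_cube[OF fm] emeasure_cube corner_centre emeasure_hcube[OF h]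
      by (subst nn_set_integral_eq_LINT) (auto intro: locally_integrable_diff_const[OF fl])
    also have "\<dots> = ennreal ((LINT x:hcube a h|lebesgue. \<bar>f x - mean f (hcube a h)\<bar>) / h ^ CARD('n))"
      using h by (intro divide_ennreal) (auto simp: set_lebesgue_integral_def intro!: Bochner_Integration.integral_nonneg)
    finally have "ennreal ((LINT x:hcube a h|lebesgue. \<bar>f x - mean f (hcube a h)\<bar>) / h ^ CARD('n))
       \<le> ennreal (A0 * (1 + h / \<rho> (centre a h)) powr \<gamma>)"
      using A0b[OF h, of "centre a h"] by simp
    then have "(LINT x:hcube a h|lebesgue. \<bar>f x - mean f (hcube a h)\<bar>) / h ^ CARD('n) \<le> A0 * (1 + h / \<rho> (centre a h)) powr \<gamma>"
      using A0 by (simp add: ennreal_le_iff)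
    then show ?thesis using h by (simp add: divide_le_eq)
  qed
  obtain c where c: "c \<ge> 1" and small: "\<And>a h E X. 0 < h \<Longrightarrow> 1 + d * h / \<rho> a \<le> X \<Longrightarrow> E \<in> sets lebesgue \<Longrightarrow> E \<subseteq> hcube a h
     \<Longrightarrow> measure lebesgue E \<le> h ^ CARD('n) / 2
     \<Longrightarrow> weight_of w E \<le> ennreal (1 - (c * X powr \<theta>) powr (- p)) * weight_of w (hcube a h)"
    using muckenhoupt_small_sets[OF w p \<theta> \<rho>pos] unfolding d_def by blast
  define L where "L = 2 + (2::real) ^ CARD('n)"
  have L: "L > 0" unfolding L_def by (simp add: add_pos_pos)
  define M where "M = 12 * p * L * A0 * c powr (2 * p)"
  have M: "M > 0" unfolding M_def using p L A0 c by simp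
  define e where "e = \<gamma> + 2 * p * \<theta>"
  have e: "e > 0" unfolding e_def using \<gamma> p \<theta> by (simp add: add_pos_pos)
  have main: "weighted_osc p w f (hcube (corner x0 r) r) \<le> ennreal (M * X powr e)"
    if r: "r > 0" and X: "X = Cs * (1 + d * r / \<rho> x0) powr Ns" for x0 r X
  proof -
    define P where "P = (\<lambda>a h. 0 < h \<and> h \<le> r \<and> hcube a h \<subseteq> hcube (corner x0 r) r)"
    have X1: "X \<ge> 1"
    proof -
      have "1 \<le> (1 + d * r / \<rho> x0) powr Ns" using d r \<rho>pos[of x0] Ns by (intro ge_one_powr_ge_zero) auto
      then have "1 * 1 \<le> Cs * (1 + d * r / \<rho> x0) powr Ns" using Cs by (intro mult_mono) auto
      then show ?thesis unfolding X by simp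
    qed
    have P_pos: "0 < h" if "P a h" for a h using that by (simp add: P_def)
    have near: "dist x0 y \<le> d * r" if "y \<in> hcube (corner x0 r) r" for y
      using dist_hcube_corner[OF r that] by (simp add: d_def)
    have PX: "1 + h / \<rho> (centre a h) \<le> X" "1 + d * h / \<rho> a \<le> X" if Pa: "P a h" for a h
    proof -
      have h: "0 < h" "h \<le> r" and sub: "hcube a h \<subseteq> hcube (corner x0 r) r" using Pa by (auto simp: P_def)
      have "r \<le> d * r" using d r by (simp add: mult_le_cancel_right1)
      then have hd: "h \<le> d * r" using h by linarith
      have "centre a h \<in> hcube a h" "a \<in> hcube a h" using h by (auto simp: hcube_def centre_def)
      then have "dist x0 (centre a h) \<le> d * r" "dist x0 a \<le> d * r" using sub near by blast+
      then show "1 + h / \<rho> (centre a h) \<le> X" "1 + d * h / \<rho> a \<le> X"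
        unfolding X using h hd d by (auto intro!: sv)
    qed
    define A \<kappa> where "A = A0 * X powr \<gamma>" and "\<kappa> = (c * X powr \<theta>) powr (- p)"
    have A: "A > 0" unfolding A_def using A0 X1 by simp
    have cX: "c * X powr \<theta> \<ge> 1"
    proof -
      have "1 \<le> X powr \<theta>" using X1 \<theta> by (intro ge_one_powr_ge_zero) auto
      then have "1 * 1 \<le> c * X powr \<theta>" using c by (intro mult_mono) auto
      then show ?thesis by simp
    qed
    have \<kappa>: "0 < \<kappa>" "\<kappa> \<le> 1"
      unfolding \<kappa>_def using cX p powr_mono2'[of "-p" 1 "c * X powr \<theta>"] by auto
    interpret dyadic_oscillation f w P A \<kappa>
    proof
      show "P (child a h e) (h / 2)" if "P a h" for a h e
        using that hcube_child_subset[of h a e] by (auto simp: P_def)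
      show "(LINT x:hcube a h|lebesgue. \<bar>f x - mean f (hcube a h)\<bar>) \<le> A * h ^ CARD('n)" if Pa: "P a h" for a h
      proof -
        have h: "h > 0" using Pa by (rule P_pos)
        have "(1 + h / \<rho> (centre a h)) powr \<gamma> \<le> X powr \<gamma>"
          using PX[OF Pa] \<gamma> bp[OF h, of "centre a h"] by (intro powr_mono2) auto
        then have "A0 * (1 + h / \<rho> (centre a h)) powr \<gamma> * h ^ CARD('n) \<le> A * h ^ CARD('n)"
          unfolding A_def using A0 h by (intro mult_right_mono mult_left_mono) auto
        then show ?thesis using hosc[OF h, of a] by linarith
      qed
      show "weight_of w E \<le> ennreal (1 - \<kappa>) * weight_of w (hcube a h)"
        if "P a h" "E \<in> sets lebesgue" "E \<subseteq> hcube a h" "measure lebesgue E \<le> h ^ CARD('n) / 2" for a h E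
        unfolding \<kappa>_def using that PX by (intro small P_pos) auto
    qed (use fl iw P_pos A \<kappa> in auto)
    define Q where "Q = hcube (corner x0 r) r"
    have PQ: "P (corner x0 r) r" using r by (simp add: P_def)
    define T where "T = (p / \<eta>) powr p * (2 * exp 1 / \<kappa>)"
    have T0: "T \<ge> 0" unfolding T_def using \<kappa> by simp
    have "weighted_osc p w f Q \<le> ennreal (T powr (1 / p))"
      unfolding Q_def using power_integrability[OF PQ p] T0 p unfolding T_def by (intro weighted_osc_leI)
    moreover have "T powr (1 / p) \<le> M * X powr e"
    proof -
      have e3: "exp (1::real) \<le> 3" by (rule exp_le)
      have p\<eta>: "p / \<eta> = 2 * p * L * A / \<kappa>"
        unfolding \<eta>_def jump_def L_def using A \<kappa> by (simp add: field_simps)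
      have ge1: "2 * exp 1 / \<kappa> \<ge> 1"
      proof -
        have "\<kappa> \<le> 2 * exp 1" using \<kappa>(2) one_le_exp_iff[of "1::real"] by linarith
        then show ?thesis using \<kappa> by simp
      qed
      have "T powr (1 / p) = (p / \<eta>) * (2 * exp 1 / \<kappa>) powr (1 / p)"
      proof -
        have "T powr (1 / p) = ((p / \<eta>) powr p) powr (1 / p) * (2 * exp 1 / \<kappa>) powr (1 / p)"
          unfolding T_def by (rule powr_mult)
        also have "((p / \<eta>) powr p) powr (1 / p) = p / \<eta>" using p \<eta>(1) by (simp add: powr_powr)
        finally show ?thesis .
      qed
      also have "\<dots> \<le> (p / \<eta>) * (2 * exp 1 / \<kappa>) powr 1"
        using ge1 p \<eta>(1) by (intro mult_left_mono powr_mono) auto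
      also have "\<dots> \<le> (p / \<eta>) * (6 / \<kappa>)"
        using ge1 e3 \<kappa> p \<eta>(1) by (intro mult_left_mono) (auto intro: divide_right_mono)
      also have "\<dots> = 12 * p * L * A * (1 / \<kappa>) * (1 / \<kappa>)" unfolding p\<eta> using \<kappa> by simp
      also have "1 / \<kappa> = (c * X powr \<theta>) powr p" unfolding \<kappa>_def by (simp add: powr_minus_divide)
      also have "12 * p * L * A * (c * X powr \<theta>) powr p * (c * X powr \<theta>) powr p
         = 12 * p * L * A * (c * X powr \<theta>) powr (2 * p)" by (simp add: powr_add[symmetric] mult.assoc)
      also have "(c * X powr \<theta>) powr (2 * p) = c powr (2 * p) * X powr (2 * p * \<theta>)"
        using c X1 by (simp add: powr_mult powr_powr mult_ac)
      also have "12 * p * L * A * (c powr (2 * p) * X powr (2 * p * \<theta>)) = M * X powr e"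
        unfolding M_def A_def e_def by (simp add: powr_add mult_ac)
      finally show ?thesis .
    qed
    ultimately show ?thesis unfolding Q_def by (meson ennreal_leI order_trans)
  qed
  have pos: "M * (Cs * d powr Ns) powr e > 0" "Ns * e > 0" using M Cs d Ns e by simp_all
  have "weighted_osc p w f (cube x0 r) \<le> ennreal (M * (Cs * d powr Ns) powr e * (1 + r / \<rho> x0) powr (Ns * e))"
    if r: "r > 0" for x0 r
  proof -
    define t where "t = r / \<rho> x0"
    have t: "t > 0" unfolding t_def using r \<rho>pos[of x0] by simp
    have "weighted_osc p w f (cube x0 r) \<le> ennreal (M * (Cs * (1 + d * r / \<rho> x0) powr Ns) powr e)"
      unfolding weighted_osc_cube[OF fm] by (rule main[OF r refl])
    also have "\<dots> \<le> ennreal (M * (Cs * (d powr Ns * (1 + t) powr Ns)) powr e)"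
      using one_plus_scaled_powr_le[of d t Ns] d t Ns M Cs e unfolding t_def
      by (intro ennreal_leI mult_left_mono powr_mono2) auto
    also have "\<dots> = ennreal (M * (Cs * d powr Ns) powr e * (1 + t) powr (Ns * e))"
      using Cs d t by (simp add: powr_mult powr_powr mult_ac)
    finally show "weighted_osc p w f (cube x0 r) \<le> ennreal (M * (Cs * d powr Ns) powr e * (1 + r / \<rho> x0) powr (Ns * e))"
      unfolding t_def .
  qed
  then show ?thesis using pos by blast
qed

section \<open>Lipschitz functions\<close>

text \<open>The increments from one generation to the next are summed as a geometric series; the constant
\<open>S = J / (1 - (1/2) powr \<beta>)\<close> is the solution of \<open>S * (1/2) powr \<beta> + J = S\<close>, which makes the
induction close.\<close>

lemma dyadic_avg_geometric:
  fixes f :: "real ^ 'n \<Rightarrow> real"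
  assumes P_pos: "\<And>a h. P a h \<Longrightarrow> 0 < h" and P_child: "\<And>a h e. P a h \<Longrightarrow> P (child a h e) (h / 2)"
    and J: "\<And>a h e. P a h \<Longrightarrow> \<bar>mean f (subcube a h e) - mean f (hcube a h)\<bar> \<le> J * h powr \<beta>"
    and \<beta>: "\<beta> > 0" and J0: "J \<ge> 0" and Pa: "P a h"
  shows "\<bar>dyadic_avg f k a h x - mean f (hcube a h)\<bar> \<le> J / (1 - (1/2) powr \<beta>) * h powr \<beta>"
  using Pa
proof (induction k arbitrary: a h)
  have q: "(1/2::real) powr \<beta> < 1"
    using powr_less_mono2[of \<beta> "1/2" "1::real"] \<beta> by simp
  case (0 a h)
  have "0 \<le> J / (1 - (1/2) powr \<beta>) * h powr \<beta>"
    using divide_nonneg_pos[OF J0, of "1 - (1/2) powr \<beta>"] q by (intro mult_nonneg_nonneg) (simp_all only: diff_gt_0_iff_gt powr_ge_zero)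
  then show ?case by (simp only: dyadic_avg.simps diff_self abs_zero)
next
  have q: "(1/2::real) powr \<beta> < 1"
    using powr_less_mono2[of \<beta> "1/2" "1::real"] \<beta> by simp
  case (Suc k a h)
  define e where "e = child_index a h x"
  define S where "S = J / (1 - (1/2) powr \<beta>)"
  have "\<bar>dyadic_avg f k (child a h e) (h / 2) x - mean f (subcube a h e)\<bar> \<le> S * (h / 2) powr \<beta>"
    unfolding S_def by (rule Suc.IH[OF P_child[OF Suc.prems]])
  moreover have "\<bar>mean f (subcube a h e) - mean f (hcube a h)\<bar> \<le> J * h powr \<beta>"
    by (rule J[OF Suc.prems])
  moreover have "S * (h / 2) powr \<beta> + J * h powr \<beta> = S * h powr \<beta>"
  proof -
    have "1 - (1/2) powr \<beta> \<noteq> 0" using q by linarith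
    from iffD1[OF nonzero_eq_divide_eq[OF this] S_def]
    have J_eq: "J = S * (1 - (1/2) powr \<beta>)" by (rule sym)
    have "(h / 2) powr \<beta> = h powr \<beta> * (1/2) powr \<beta>"
      using P_pos[OF Suc.prems] powr_mult[of h "1/2" \<beta>] by simp
    then show ?thesis by (subst J_eq) (simp add: algebra_simps)
  qed
  ultimately show ?case unfolding S_def[symmetric] by (simp add: e_def)
qed

text \<open>A dyadic cube and its children lie in the ball about the corner of the cube with \<open>d\<close> times its side as
radius.  All their averages are therefore close to the average over that ball, by the Lipschitz condition
there.  Summing over the generations inside a cube that contains the given ball, and comparing that cube with
the ball, bounds the almost everywhere limit of the dyadic averages.\<close>

lemma Lip_AE_bound:
  fixes f :: "real ^ 'n \<Rightarrow> real"
  assumes \<rho>: "slowly_varying \<rho>" and f: "f \<in> Lip \<rho> \<gamma> \<beta>" and \<gamma>: "\<gamma> > 0" and \<beta>: "0 < \<beta>"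
  shows "\<exists>C>0. \<exists>N>0. \<forall>x0. \<forall>r>0. AE x in lebesgue. x \<in> ball x0 r \<longrightarrow>
    \<bar>f x - mean f (ball x0 r)\<bar> \<le> C * (1 + r / \<rho> x0) powr N * r powr \<beta>"
proof -
  define d where "d = real CARD('n)"
  have d: "d \<ge> 1" unfolding d_def by (simp add: Suc_leI)
  have \<rho>pos: "\<And>x. \<rho> x > 0" using \<rho> by (simp add: slowly_varying_def)
  have fl: "locally_integrable f" using f by (simp add: Lip_def)
  obtain Cs Ns where Cs: "Cs \<ge> 1" and Ns: "Ns \<ge> 1"
    and sv: "\<And>x y r h. 0 \<le> h \<Longrightarrow> h \<le> r \<Longrightarrow> dist x y \<le> r \<Longrightarrow> 1 + h / \<rho> y \<le> Cs * (1 + r / \<rho> x) powr Ns"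
    using \<rho> unfolding slowly_varying_def by blast
  have bp: "1 + r / \<rho> x > 0" if "r > 0" for r x using that \<rho>pos[of x] by (simp add: add_pos_pos)
  obtain A0 where A0: "A0 > 0" and A0b: "\<And>x r. r > 0 \<Longrightarrow>
      (\<integral>\<^sup>+y\<in>ball x r. ennreal \<bar>f y - mean f (ball x r)\<bar> \<partial>lebesgue)
           / epowr (emeasure lebesgue (ball x r)) (1 + \<beta> / d) \<le> ennreal (A0 * (1 + r / \<rho> x) powr \<gamma>)"
    by (rule SUP_radius_finite_bound[where b = "\<lambda>x r. 1 + r / \<rho> x" and \<theta> = \<gamma>
        and \<Phi> = "\<lambda>x r. (\<integral>\<^sup>+y\<in>ball x r. ennreal \<bar>f y - mean f (ball x r)\<bar> \<partial>lebesgue)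
           / epowr (emeasure lebesgue (ball x r)) (1 + \<beta> / d)"])
      (use f bp in \<open>auto simp: Lip_def d_def\<close>)
  have bosc: "(LINT y:ball x r|lebesgue. \<bar>f y - mean f (ball x r)\<bar>)
      \<le> A0 * (1 + r / \<rho> x) powr \<gamma> * measure lebesgue (ball x r) powr (1 + \<beta> / d)" if r: "r > 0" for x r
  proof -
    define m where "m = measure lebesgue (ball x r)"
    have m: "m > 0" "emeasure lebesgue (ball x r) = ennreal m"
      unfolding m_def using r by (auto simp: measure_ball_pos emeasure_ball_eq)
    define I where "I = (LINT y:ball x r|lebesgue. \<bar>f y - mean f (ball x r)\<bar>)"
    have I: "I \<ge> 0" unfolding I_def by (intro set_LINT_nonneg) simp
    have "(\<integral>\<^sup>+y\<in>ball x r. ennreal \<bar>f y - mean f (ball x r)\<bar> \<partial>lebesgue) = ennreal I"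
      unfolding I_def by (intro nn_set_integral_eq_LINT locally_integrable_diff_const[OF fl]) auto
    then have "ennreal (I / m powr (1 + \<beta> / d)) \<le> ennreal (A0 * (1 + r / \<rho> x) powr \<gamma>)"
      using A0b[OF r, of x] m I by (simp add: epowr_ennreal_pos divide_ennreal)
    then have "I / m powr (1 + \<beta> / d) \<le> A0 * (1 + r / \<rho> x) powr \<gamma>"
      using A0 by (simp add: ennreal_le_iff)
    then show ?thesis unfolding I_def[symmetric] m_def[symmetric] using m by (simp add: divide_le_eq)
  qed
  define w0 where "w0 = measure lebesgue (ball (0::real^'n) 1)"
  have w0: "w0 > 0" unfolding w0_def by (rule measure_unit_ball_pos)
  define v where "v = w0 * d ^ CARD('n)"
  have v: "v > 0" unfolding v_def using w0 d by simp
  define z where "z = (1/2::real) powr \<beta>"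
  have z: "z < 1" using powr_less_mono2[of \<beta> "1/2" "1::real"] \<beta> by (simp add: z_def)
  define c where "c = (1 + 2 ^ CARD('n)) / (1 - z) + 1 + 2 ^ CARD('n) / w0"
  have c: "c > 0" unfolding c_def using z w0 by (simp add: add_pos_pos)
  define G0 where "G0 = A0 * v powr (1 + \<beta> / d)"
  have G0: "G0 > 0" unfolding G0_def using A0 v by simp
  have main: "AE x in lebesgue. x \<in> ball x0 r \<longrightarrow> \<bar>f x - mean f (ball x0 r)\<bar> \<le> c * (G0 * X powr \<gamma>) * (2 * r) powr \<beta>"
    if r: "r > 0" and X: "X = Cs * (1 + 2 * d * r / \<rho> x0) powr Ns" for x0 r X
  proof -
    define G where "G = G0 * X powr \<gamma>"
    \<comment> \<open>Side of the cube about \<open>x0\<close> that circumscribes the given ball.\<close>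
    define R where "R = 2 * r"
    have R: "R > 0" unfolding R_def using r by simp
    define a0 where "a0 = corner x0 R"
    define P where "P = (\<lambda>a h. 0 < h \<and> h \<le> R \<and> hcube a h \<subseteq> hcube a0 R)"
    have X0: "X \<ge> 0" unfolding X using Cs by simp
    have G: "G \<ge> 0" unfolding G_def using G0 X0 by simp
    have P_pos: "0 < h" if "P a h" for a h using that by (simp add: P_def)
    have P_child: "P (child a h e) (h / 2)" if "P a h" for a h e
      using that hcube_child_subset[of h a e] by (auto simp: P_def)
    have near: "dist x0 y \<le> d * R" if "y \<in> hcube a0 R" for y
      using dist_hcube_corner[OF R, of y x0] that by (simp add: a0_def d_def)
    have ball_osc: "(LINT y:ball a (d * h)|lebesgue. \<bar>f y - mean f (ball a (d * h))\<bar>) \<le> G * h powr \<beta> * h ^ CARD('n)"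
      if Pa: "P a h" for a h
    proof -
      have h: "0 < h" "h \<le> R" and sub: "hcube a h \<subseteq> hcube a0 R" using Pa by (auto simp: P_def)
      have dh: "d * h > 0" using d h by simp
      have "a \<in> hcube a h" using h by (auto simp: hcube_def)
      then have "dist x0 a \<le> d * R" using sub near by blast
      then have "1 + d * h / \<rho> a \<le> X"
        unfolding X using sv[of "d * h" "d * R" x0 a] h d by (simp add: R_def mult_ac)
      then have 1: "(1 + d * h / \<rho> a) powr \<gamma> \<le> X powr \<gamma>"
        using \<gamma> bp[OF dh, of a] by (intro powr_mono2) auto
      have m: "measure lebesgue (ball a (d * h)) = v * h ^ CARD('n)"
        unfolding v_def w0_def using measure_ball_scaling[of "d * h" a] dh by (simp add: power_mult_distrib)
      have "measure lebesgue (ball a (d * h)) powr (1 + \<beta> / d) = v powr (1 + \<beta> / d) * (h powr d) powr (1 + \<beta> / d)"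
      proof -
        have "measure lebesgue (ball a (d * h)) = v * h powr d" unfolding m using h by (simp add: d_def powr_realpow)
        then show ?thesis by (simp only: powr_mult)
      qed
      also have "(h powr d) powr (1 + \<beta> / d) = h powr d * h powr \<beta>"
        using d h by (simp add: powr_powr powr_add[symmetric] algebra_simps)
      also have "h powr d = h ^ CARD('n)" unfolding d_def using h by (simp add: powr_realpow)
      finally have 2: "measure lebesgue (ball a (d * h)) powr (1 + \<beta> / d) = v powr (1 + \<beta> / d) * (h ^ CARD('n) * h powr \<beta>)" .
      have "(LINT y:ball a (d * h)|lebesgue. \<bar>f y - mean f (ball a (d * h))\<bar>)
         \<le> A0 * (1 + d * h / \<rho> a) powr \<gamma> * (v powr (1 + \<beta> / d) * (h ^ CARD('n) * h powr \<beta>))"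
        using bosc[OF dh, of a] unfolding 2 .
      also have "\<dots> \<le> A0 * X powr \<gamma> * (v powr (1 + \<beta> / d) * (h ^ CARD('n) * h powr \<beta>))"
        using 1 A0 h by (intro mult_right_mono mult_left_mono) auto
      also have "\<dots> = G * h powr \<beta> * h ^ CARD('n)" unfolding G_def G0_def by (simp add: mult_ac)
      finally show ?thesis .
    qed
    have near_ball: "\<bar>mean f E - mean f (ball a (d * h))\<bar> \<le> G * h powr \<beta> * h ^ CARD('n) / measure lebesgue E"
      if Pa: "P a h" and E: "E \<subseteq> hcube a h" "E \<in> sets lebesgue" "measure lebesgue E > 0" for a h E
    proof -
      have "E \<subseteq> ball a (d * h)" using E(1) hcube_subset_ball[of a h] unfolding d_def by blast
      then have "\<bar>mean f E - mean f (ball a (d * h))\<bar>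
         \<le> (LINT y:ball a (d * h)|lebesgue. \<bar>f y - mean f (ball a (d * h))\<bar>) / measure lebesgue E"
        using E by (intro abs_mean_diff_le[OF fl]) auto
      also have "\<dots> \<le> G * h powr \<beta> * h ^ CARD('n) / measure lebesgue E"
        using ball_osc[OF Pa] by (intro divide_right_mono) auto
      finally show ?thesis .
    qed
    have cube_near: "\<bar>mean f (hcube a h) - mean f (ball a (d * h))\<bar> \<le> G * h powr \<beta>" if Pa: "P a h" for a h
      using near_ball[OF Pa order_refl] P_pos[OF Pa] by (simp add: measure_hcube)
    have J: "\<bar>mean f (subcube a h e) - mean f (hcube a h)\<bar> \<le> ((1 + 2 ^ CARD('n)) * G) * h powr \<beta>"
      if Pa: "P a h" for a h e
    proof -
      have h: "h > 0" using Pa by (rule P_pos)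
      have "\<bar>mean f (subcube a h e) - mean f (ball a (d * h))\<bar>
         \<le> G * h powr \<beta> * h ^ CARD('n) / measure lebesgue (subcube a h e)"
        using h hcube_child_subset[OF h] by (intro near_ball[OF Pa]) (auto simp: measure_hcube)
      also have "\<dots> = 2 ^ CARD('n) * G * h powr \<beta>"
        using h by (simp add: measure_hcube power_divide)
      finally show ?thesis using cube_near[OF Pa] by (simp add: distrib_right)
    qed
    have P0: "P a0 R" using R by (simp add: P_def)
    have "ball x0 r \<subseteq> hcube a0 R"
    proof
      fix y assume y: "y \<in> ball x0 r"
      have "\<bar>y $ i - x0 $ i\<bar> < r" for i
        using component_le_norm_cart[of "y - x0" i] y by (simp add: dist_norm norm_minus_commute)
      then show "y \<in> hcube a0 R"
        by (auto simp: hcube_def a0_def corner_def R_def abs_less_iff algebra_simps less_imp_le)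
    qed
    then have "\<bar>mean f (ball x0 r) - mean f (ball a0 (d * R))\<bar> \<le> G * R powr \<beta> * R ^ CARD('n) / measure lebesgue (ball x0 r)"
      using measure_ball_pos[OF r, of x0] by (intro near_ball[OF P0]) auto
    also have "\<dots> = G * R powr \<beta> * (2 ^ CARD('n) / w0)"
      unfolding w0_def using measure_ball_scaling[of r x0] r by (simp add: R_def power_mult_distrib)
    finally have ball_near: "\<bar>mean f (ball x0 r) - mean f (ball a0 (d * R))\<bar> \<le> G * R powr \<beta> * (2 ^ CARD('n) / w0)" .
    obtain s :: "nat \<Rightarrow> nat" where
      s: "AE x in lebesgue. x \<in> hcube a0 R \<longrightarrow> (\<lambda>n. dyadic_avg f (s n) a0 R x) \<longlonglongrightarrow> f x"
      using dyadic_avg_AE_subseq[OF fl R, of a0] by blast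
    show ?thesis
      using s
    proof eventually_elim
      case (elim x)
      show ?case
      proof
        assume x: "x \<in> ball x0 r"
        then have lim: "(\<lambda>n. dyadic_avg f (s n) a0 R x) \<longlonglongrightarrow> f x"
          using elim \<open>ball x0 r \<subseteq> hcube a0 R\<close> by blast
        define S where "S = (1 + 2 ^ CARD('n)) * G / (1 - z) * R powr \<beta>"
        have "\<bar>dyadic_avg f (s n) a0 R x - mean f (hcube a0 R)\<bar> \<le> S" for n
          unfolding S_def z_def using G by (intro dyadic_avg_geometric[where P = P] P_pos P_child J \<beta> P0) auto
        then have "\<bar>f x - mean f (hcube a0 R)\<bar> \<le> S"
          by (intro LIMSEQ_le_const2[where X = "\<lambda>n. \<bar>dyadic_avg f (s n) a0 R x - mean f (hcube a0 R)\<bar>"] tendsto_intros lim) auto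
        then have "\<bar>f x - mean f (ball x0 r)\<bar> \<le> S + G * R powr \<beta> + G * R powr \<beta> * (2 ^ CARD('n) / w0)"
          using cube_near[OF P0] ball_near by linarith
        also have "\<dots> = c * G * R powr \<beta>" unfolding S_def c_def by (simp add: algebra_simps)
        finally show "\<bar>f x - mean f (ball x0 r)\<bar> \<le> c * (G0 * X powr \<gamma>) * (2 * r) powr \<beta>"
          unfolding G_def R_def .
      qed
    qed
  qed
  define M where "M = c * G0 * (Cs * (2 * d) powr Ns) powr \<gamma> * 2 powr \<beta>"
  have pos: "M > 0" "Ns * \<gamma> > 0" unfolding M_def using c G0 Cs d Ns \<gamma> by simp_all
  have "AE x in lebesgue. x \<in> ball x0 r \<longrightarrow>
    \<bar>f x - mean f (ball x0 r)\<bar> \<le> M * (1 + r / \<rho> x0) powr (Ns * \<gamma>) * r powr \<beta>" if r: "r > 0" for x0 r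
  proof -
    define t where "t = r / \<rho> x0"
    have t: "t > 0" unfolding t_def using r \<rho>pos[of x0] by simp
    define X where "X = Cs * (1 + 2 * d * r / \<rho> x0) powr Ns"
    have "X \<le> Cs * ((2 * d) powr Ns * (1 + t) powr Ns)"
      using one_plus_scaled_powr_le[of "2 * d" t Ns] d t Ns Cs unfolding X_def t_def
      by (intro mult_left_mono) auto
    then have "X powr \<gamma> \<le> (Cs * ((2 * d) powr Ns * (1 + t) powr Ns)) powr \<gamma>"
      using \<gamma> Cs unfolding X_def by (intro powr_mono2) auto
    also have "\<dots> = (Cs * (2 * d) powr Ns) powr \<gamma> * (1 + t) powr (Ns * \<gamma>)"
      by (simp only: powr_mult powr_powr mult.assoc)
    finally have "c * (G0 * X powr \<gamma>) * (2 * r) powr \<beta>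
       \<le> c * (G0 * ((Cs * (2 * d) powr Ns) powr \<gamma> * (1 + t) powr (Ns * \<gamma>))) * (2 * r) powr \<beta>"
      using c G0 by (intro mult_right_mono mult_left_mono) auto
    also have "\<dots> = M * (1 + t) powr (Ns * \<gamma>) * r powr \<beta>"
      unfolding M_def powr_mult[of 2 r] by (simp only: mult_ac)
    finally have le: "c * (G0 * X powr \<gamma>) * (2 * r) powr \<beta> \<le> M * (1 + t) powr (Ns * \<gamma>) * r powr \<beta>" .
    show ?thesis
      using main[OF r X_def] by eventually_elim (use le in \<open>auto simp: t_def\<close>)
  qed
  then show ?thesis using pos by blast
qed

lemma weighted_osc_if_Lip:
  fixes w f :: "real ^ 'n \<Rightarrow> real"
  assumes w: "is_weight w" and p: "1 \<le> p" and \<rho>: "slowly_varying \<rho>"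
    and f: "f \<in> Lip \<rho> \<gamma> \<beta>" and \<gamma>: "\<gamma> > 0" and \<beta>: "0 < \<beta>"
  shows "\<exists>C>0. \<exists>N>0. \<forall>x0. \<forall>r>0. weighted_osc p w f (ball x0 r)
     / epowr (emeasure lebesgue (ball x0 r)) (\<beta> / real CARD('n)) \<le> ennreal (C * (1 + r / \<rho> x0) powr N)"
proof -
  define d where "d = real CARD('n)"
  have d: "d \<ge> 1" unfolding d_def by (simp add: Suc_leI)
  note [measurable] = weight_measurable[OF w]
  have w0: "w x \<ge> 0" for x using w by (simp add: is_weight_def)
  obtain C N where C: "C > 0" and N: "N > 0" and AEb: "\<And>x0 r. r > 0 \<Longrightarrow> AE x in lebesgue. x \<in> ball x0 r \<longrightarrow>
    \<bar>f x - mean f (ball x0 r)\<bar> \<le> C * (1 + r / \<rho> x0) powr N * r powr \<beta>"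
    using Lip_AE_bound[OF \<rho> f \<gamma> \<beta>] by blast
  define u where "u = measure lebesgue (ball (0::real^'n) 1)"
  have u: "u > 0" unfolding u_def by (rule measure_unit_ball_pos)
  define M where "M = C / u powr (\<beta> / d)"
  have M: "M > 0" unfolding M_def using C u by simp
  have "weighted_osc p w f (ball x0 r) / epowr (emeasure lebesgue (ball x0 r)) (\<beta> / d)
     \<le> ennreal (M * (1 + r / \<rho> x0) powr N)" if r: "r > 0" for x0 r
  proof -
    define T where "T = C * (1 + r / \<rho> x0) powr N * r powr \<beta>"
    have T: "T \<ge> 0" unfolding T_def using C by simp
    define B where "B = ball x0 r"
    have [measurable]: "B \<in> sets lebesgue" by (simp add: B_def)
    have m: "measure lebesgue B > 0" "emeasure lebesgue B = ennreal (measure lebesgue B)"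
      unfolding B_def using r by (auto simp: measure_ball_pos emeasure_ball_eq)
    have mb: "measure lebesgue B powr (\<beta> / d) = u powr (\<beta> / d) * r powr \<beta>"
    proof -
      have "measure lebesgue B = u * r powr d"
        unfolding B_def u_def d_def using r measure_ball_scaling[of r x0] by (simp add: powr_realpow)
      then show ?thesis using d by (simp add: powr_mult powr_powr)
    qed
    have "(\<integral>\<^sup>+x\<in>B. ennreal (\<bar>f x - mean f B\<bar> powr p * w x) \<partial>lebesgue)
       \<le> (\<integral>\<^sup>+x. ennreal (T powr p) * (ennreal (w x) * indicator B x) \<partial>lebesgue)"
    proof (intro nn_integral_mono_AE)
      show "AE x in lebesgue. ennreal (\<bar>f x - mean f B\<bar> powr p * w x) * indicator B x
          \<le> ennreal (T powr p) * (ennreal (w x) * indicator B x)"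
        using AEb[OF r, of x0]
      proof eventually_elim
        case (elim x)
        then have "\<bar>f x - mean f B\<bar> powr p * w x \<le> T powr p * w x" if "x \<in> B"
          using that p w0[of x] unfolding B_def T_def by (intro mult_right_mono powr_mono2) auto
        then show ?case by (auto simp: indicator_def ennreal_mult'[symmetric] w0 intro!: ennreal_leI)
      qed
    qed
    also have "\<dots> = ennreal (T powr p) * weight_of w B"
      unfolding weight_of_def by (rule nn_integral_cmult) simp
    finally have "weighted_osc p w f B \<le> ennreal ((T powr p) powr (1 / p))"
      using p by (intro weighted_osc_leI) auto
    also have "(T powr p) powr (1 / p) = T" using p T by (simp add: powr_powr)
    finally have "weighted_osc p w f B / epowr (emeasure lebesgue B) (\<beta> / d)
        \<le> ennreal T / epowr (emeasure lebesgue B) (\<beta> / d)" by (rule divide_right_mono_ennreal)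
    also have "\<dots> = ennreal (T / (u powr (\<beta> / d) * r powr \<beta>))"
      using m T u r unfolding m(2) by (simp add: epowr_ennreal_pos mb divide_ennreal)
    also have "T / (u powr (\<beta> / d) * r powr \<beta>) = M * (1 + r / \<rho> x0) powr N"
      unfolding T_def M_def using r by simp
    finally show ?thesis unfolding B_def .
  qed
  then show ?thesis using M N unfolding d_def by blast
qed

section \<open>Characterisation by weighted oscillations\<close>

theorem corollary3p7:
  fixes V \<omega> f :: "real ^ 'n \<Rightarrow> real" and s :: ennreal and p :: real
  defines "\<rho> \<equiv> critical_radius V"
  assumes dim: "3 \<le> CARD('n)"
    and V_nonneg: "\<And>x. 0 \<le> V x"
    and V_loc: "locally_integrable V"
    and V_nonzero: "\<not> (AE x in lebesgue. V x = 0)"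
    and s: "ennreal (real CARD('n) / 2) \<le> s"
    and V_RH: "reverse_holder s V"
    and p: "1 \<le> p"
    and weight: "\<omega> \<in> muckenhoupt_inf \<rho> p"
    and f: "locally_integrable f"
  shows "(f \<in> BMO_inf \<rho> \<longleftrightarrow>
            (\<exists>C>0. \<exists>N>0. \<forall>x0. \<forall>r>0.
               weighted_osc p \<omega> f (cube x0 r) \<le> ennreal (C * (1 + r / \<rho> x0) powr N)))
       \<and> (\<forall>\<beta>. 0 < \<beta> \<and> \<beta> < 1 \<longrightarrow>
            (f \<in> Lip_inf \<rho> \<beta> \<longleftrightarrow>
              (\<exists>C>0. \<exists>N'>0. \<forall>x0. \<forall>r>0.
                 weighted_osc p \<omega> f (ball x0 r)
                   / epowr (emeasure lebesgue (ball x0 r)) (\<beta> / real CARD('n))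
                 \<le> ennreal (C * (1 + r / \<rho> x0) powr N'))))"
proof -
  have \<rho>: "slowly_varying \<rho>"
    unfolding \<rho>_def by (rule slowly_varying_critical_radius[OF dim V_nonneg V_loc V_nonzero s V_RH])
  have \<rho>pos: "\<And>x. \<rho> x > 0" using \<rho> by (simp add: slowly_varying_def)
  obtain \<theta> where \<theta>: "0 < \<theta>" and w: "\<omega> \<in> muckenhoupt \<rho> \<theta> p"
    using weight unfolding muckenhoupt_inf_def by blast
  have iw: "is_weight \<omega>" using w by (simp add: muckenhoupt_def)
  have "f \<in> BMO_inf \<rho> \<longleftrightarrow>
     (\<exists>C>0. \<exists>N>0. \<forall>x0. \<forall>r>0. weighted_osc p \<omega> f (cube x0 r) \<le> ennreal (C * (1 + r / \<rho> x0) powr N))"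
    (is "_ = ?R")
  proof
    assume "f \<in> BMO_inf \<rho>"
    then obtain \<gamma> where "\<gamma> > 0" "f \<in> BMO \<rho> \<gamma>" unfolding BMO_inf_def by blast
    then show ?R using weighted_osc_if_BMO[OF w \<theta> p \<rho>] by blast
  next
    assume ?R
    then obtain C N where CN: "C > 0" "N > 0"
      "\<And>x0 r. r > 0 \<Longrightarrow> weighted_osc p \<omega> f (cube x0 r) \<le> ennreal (C * (1 + r / \<rho> x0) powr N)" by blast
    then have "f \<in> BMO \<rho> (\<theta> + N)" by (rule BMO_if_weighted_osc[OF w \<theta> p \<rho>pos f])
    then show "f \<in> BMO_inf \<rho>" using \<theta> CN(2) unfolding BMO_inf_def by (intro UN_I[of "\<theta> + N"]) auto
  qed
  moreover have "f \<in> Lip_inf \<rho> \<beta> \<longleftrightarrow>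
     (\<exists>C>0. \<exists>N'>0. \<forall>x0. \<forall>r>0. weighted_osc p \<omega> f (ball x0 r)
         / epowr (emeasure lebesgue (ball x0 r)) (\<beta> / real CARD('n)) \<le> ennreal (C * (1 + r / \<rho> x0) powr N'))"
    (is "_ = ?R") if \<beta>: "0 < \<beta>" for \<beta>
  proof
    assume "f \<in> Lip_inf \<rho> \<beta>"
    then obtain \<gamma> where "\<gamma> > 0" "f \<in> Lip \<rho> \<gamma> \<beta>" unfolding Lip_inf_def by blast
    then show ?R using weighted_osc_if_Lip[OF iw p \<rho> _ _ \<beta>] by blast
  next
    assume ?R
    then obtain C N where CN: "C > 0" "N > 0"
      "\<And>x0 r. r > 0 \<Longrightarrow> weighted_osc p \<omega> f (ball x0 r)
         / epowr (emeasure lebesgue (ball x0 r)) (\<beta> / real CARD('n)) \<le> ennreal (C * (1 + r / \<rho> x0) powr N)" by blast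
    have "f \<in> Lip \<rho> (\<theta> + N) \<beta>" by (rule Lip_if_weighted_osc[OF w \<theta> p \<rho>pos f CN(1,2) \<beta> CN(3)])
    then show "f \<in> Lip_inf \<rho> \<beta>" using \<theta> CN(2) unfolding Lip_inf_def by (intro UN_I[of "\<theta> + N"]) auto
  qed
  ultimately show ?thesis by blast
qed

end
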